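(* The set $FFix(\mathbb{P}^2)\cup DFix(\mathbb{P}^2)$ is closed in $\mathcal{M}(\mathbb{P}^2)$.
   Context: $\mathbb{P}^2$ is the complex projective plane. A meromorphic (equivalently, rational) self-map $f:\mathbb{P}^2\to\mathbb{P}^2$ is a holomorphic map from $\mathbb{P}^2$ minus a finite set of points to $\mathbb{P}^2$; the closure of its graph is an algebraic subvariety $\Gamma_f\subset\mathbb{P}^2\times\mathbb{P}^2$, called the graph of $f$. $\mathcal{M}(\mathbb{P}^2)$ denotes the space of all meromorphic self-maps of $\mathbb{P}^2$, with the topology of strong convergence: $f_n$ converges strongly to $f\in\mathcal{M}(\mathbb{P}^2)$ if for every compact $K\subset\mathbb{P}^2$ the sets $\Gamma_{f_n}\cap(K\times\mathbb{P}^2)$ converge to $\Gamma_f\cap(K\times\mathbb{P}^2)$ in the Hausdorff metric (with respect to some Hermitian metrics on the factors; the notion does not depend on their choice). Since $\mathbb{P}^2$ is compact, this is the convergence of the graphs $\Gamma_{f_n}$ to the graph $\Gamma_f$ in the Hausdorff metric on compact subsets of $\mathbb{P}^2\times\mathbb{P}^2$. A (holomorphic) fixed point of $f$ is a point $p$ such that $f$ is holomorphic in a neighborhood of $p$ and $f(p)=p$. $FFix(\mathbb{P}^2)\subset\mathcal{M}(\mathbb{P}^2)$ is the set of meromorphic self-maps having no fixed points. $DFix(\mathbb{P}^2)\subset\mathcal{M}(\mathbb{P}^2)$ is the set of meromorphic self-maps having a curve of fixed points, i.e. for which there is a complex curve in $\mathbb{P}^2$ all of whose points, except possibly the finitely many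 indeterminacy points of $f$ on it, are fixed points of $f$. *)

theory Defs
  imports "HOL-Analysis.Analysis"
begin

definition proportional :: "complex^3 \<Rightarrow> complex^3 \<Rightarrow> bool" where
  "proportional x y \<longleftrightarrow> x \<noteq> 0 \<and> y \<noteq> 0 \<and> (\<exists>c. y = c *s x)"

lemma part_equivp_proportional: "part_equivp proportional"
proof (rule part_equivpI)
  show "\<exists>x. proportional x x"
    by (rule exI[of _ "axis 1 1"]) (auto simp: proportional_def axis_eq_0_iff intro!: exI[of _ 1])
  show "symp proportional"
  proof (rule sympI)
    fix x y assume "proportional x y"
    then obtain c where c: "x \<noteq> 0" "y \<noteq> 0" "y = c *s x" by (auto simp: proportional_def)
    then have "c \<noteq> 0" by auto
    then have "x = inverse c *s y" using c by (simp add: vector_smult_assoc)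
    then show "proportional y x" using c unfolding proportional_def by blast
  qed
  show "transp proportional"
    by (rule transpI) (auto simp: proportional_def vector_smult_assoc)
qed

quotient_type cp2 = "complex^3" / partial: proportional
  morphisms rep_cp2 proj
  by (rule part_equivp_proportional)

definition herm :: "complex^3 \<Rightarrow> complex^3 \<Rightarrow> complex" where
  "herm x y = (\<Sum>i\<in>UNIV. x $ i * cnj (y $ i))"

definition cos_angle :: "complex^3 \<Rightarrow> complex^3 \<Rightarrow> real" where
  "cos_angle x y = cmod (herm x y) / (norm x * norm y)"

lemma Re_herm: "Re (herm x y) = x \<bullet> y"
  by (simp add: herm_def inner_vec_def inner_complex_def)

lemma herm_commute: "herm y x = cnj (herm x y)"
  by (simp add: herm_def mult.commute)

lemma herm_scale_left: "herm (c *s x) y = c * herm x y"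
  by (simp add: herm_def sum_distrib_left mult.assoc)

lemma herm_scale_right: "herm x (c *s y) = cnj c * herm x y"
  by (subst (1 2) herm_commute) (simp add: herm_scale_left)

lemma norm_scale: "norm (c *s x) = cmod c * norm (x :: complex^3)"
  by (simp add: norm_vec_def L2_set_def norm_mult power_mult_distrib sum_distrib_left [symmetric]
      real_sqrt_mult)

lemma cos_angle_commute: "cos_angle x y = cos_angle y x"
  by (subst (2) cos_angle_def, subst herm_commute) (simp add: cos_angle_def mult.commute)

lemma cos_angle_scale_left: "c \<noteq> 0 \<Longrightarrow> cos_angle (c *s x) y = cos_angle x y"
  by (simp add: cos_angle_def herm_scale_left norm_scale norm_mult)

lemma cos_angle_scale_right: "c \<noteq> 0 \<Longrightarrow> cos_angle x (c *s y) = cos_angle x y"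
  by (subst (1 2) cos_angle_commute) (simp add: cos_angle_scale_left)

lemma herm_phase:
  obtains c where "cmod c = 1" "(c *s x) \<bullet> y = cmod (herm x y)"
proof (cases "herm x y = 0")
  case True
  then show ?thesis using that[of 1] by (simp flip: Re_herm)
next
  case False
  let ?h = "herm x y"
  have "Re (herm ((cnj ?h / cmod ?h) *s x) y) = cmod ?h"
    using False by (simp add: herm_scale_left complex_norm_square[symmetric] mult.commute[of "cnj ?h"]
        power2_eq_square flip: of_real_mult)
  then show ?thesis using that[of "cnj ?h / cmod ?h"] False by (simp add: Re_herm norm_divide)
qed

lemma cos_angle_le_1: "cos_angle x y \<le> 1"
proof -
  obtain c where c: "cmod c = 1" "(c *s x) \<bullet> y = cmod (herm x y)" by (rule herm_phase)
  have "cmod (herm x y) \<le> norm x * norm y"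
    using norm_cauchy_schwarz[of "c *s x" y] c by (simp add: norm_scale)
  then show ?thesis
    unfolding cos_angle_def by (cases "norm x * norm y = 0") (auto intro!: divide_le_eq_1_pos[THEN iffD2])
qed

lemma cos_angle_ge_0: "cos_angle x y \<ge> 0"
  by (simp add: cos_angle_def)

lemma cos_angle_self: "x \<noteq> 0 \<Longrightarrow> cos_angle x x = 1"
proof -
  assume "x \<noteq> 0"
  have "herm x x = of_real (x \<bullet> x)"
    by (rule complex_eqI) (simp_all add: Re_herm, simp add: herm_def)
  then show ?thesis using \<open>x \<noteq> 0\<close>
    by (simp add: cos_angle_def dot_square_norm power2_eq_square norm_mult)
qed

lemma cos_angle_eq_1:
  assumes "x \<noteq> 0" "y \<noteq> 0" "cos_angle x y = 1"
  shows "proportional x y"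
proof -
  obtain c where c: "cmod c = 1" "(c *s x) \<bullet> y = cmod (herm x y)" by (rule herm_phase)
  have "(c *s x) \<bullet> y = norm (c *s x) * norm y"
    using assms c by (simp add: cos_angle_def norm_scale field_simps)
  then have e: "norm (c *s x) *\<^sub>R y = norm y *\<^sub>R (c *s x)"
    by (simp add: norm_cauchy_schwarz_eq)
  have n: "norm (c *s x) = norm x" using c by (simp add: norm_scale)
  have sc: "r *\<^sub>R v = complex_of_real r *s v" for r and v :: "complex^3"
    by (simp add: vec_eq_iff scaleR_conv_of_real[where 'a = complex])
  have "y = complex_of_real (inverse (norm x)) *s (norm x *\<^sub>R y)"
    using assms(1) by (simp add: sc vector_smult_assoc flip: of_real_mult)
  also have "\<dots> = (complex_of_real (inverse (norm x)) * complex_of_real (norm y) * c) *s x"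
    using e n by (simp add: sc vector_smult_assoc mult.assoc)
  finally show ?thesis using assms by (auto simp: proportional_def)
qed

lemma cos_angle_normalize:
  fixes x :: "complex^3"
  assumes "x \<noteq> 0"
  obtains c where "c \<noteq> 0" "norm (c *s x) = 1"
  using that[of "complex_of_real (inverse (norm x))"] assms by (simp add: norm_scale norm_divide norm_inverse)

lemma cos_angle_triangle_unit:
  assumes "norm x = 1" "norm y = 1" "norm z = 1"
  defines "a \<equiv> cos_angle x y" and "b \<equiv> cos_angle y z"
  shows "a * b - sqrt (1 - a\<^sup>2) * sqrt (1 - b\<^sup>2) \<le> cos_angle x z"
proof -
  obtain c where c: "cmod c = 1" "(c *s x) \<bullet> y = cmod (herm x y)" by (rule herm_phase)
  obtain d where d: "cmod d = 1" "(d *s z) \<bullet> y = cmod (herm z y)" by (rule herm_phase)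
  define x' z' where "x' = c *s x" and "z' = d *s z"
  have n: "norm x' = 1" "norm z' = 1" using c d assms by (simp_all add: x'_def z'_def norm_scale)
  have ip: "x' \<bullet> y = a" "z' \<bullet> y = b"
    using c d assms by (simp_all add: x'_def z'_def a_def b_def cos_angle_commute[of y z])
       (simp_all add: cos_angle_def)
  then have ip': "y \<bullet> x' = a" "y \<bullet> z' = b" by (simp_all add: inner_commute)
  have sq: "x' \<bullet> x' = 1" "z' \<bullet> z' = 1" "y \<bullet> y = 1" using n assms by (simp_all add: dot_square_norm)
  have nx: "norm (x' - a *\<^sub>R y) = sqrt (1 - a\<^sup>2)"
    by (simp add: norm_eq_sqrt_inner inner_diff ip ip' sq power2_eq_square)
  have nz: "norm (z' - b *\<^sub>R y) = sqrt (1 - b\<^sup>2)"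
    by (simp add: norm_eq_sqrt_inner inner_diff ip ip' sq power2_eq_square)
  have "(x' - a *\<^sub>R y) \<bullet> (z' - b *\<^sub>R y) = x' \<bullet> z' - a * b"
    by (simp add: inner_diff ip ip' sq)
  moreover have "- (norm (x' - a *\<^sub>R y) * norm (z' - b *\<^sub>R y)) \<le> (x' - a *\<^sub>R y) \<bullet> (z' - b *\<^sub>R y)"
    using norm_cauchy_schwarz[of "- (x' - a *\<^sub>R y)" "z' - b *\<^sub>R y"] 
    by (simp only: inner_minus_left norm_minus_cancel)
  ultimately have "a * b - sqrt (1 - a\<^sup>2) * sqrt (1 - b\<^sup>2) \<le> x' \<bullet> z'" by (simp add: nx nz)
  also have "\<dots> \<le> cmod (herm x' z')" using complex_Re_le_cmod[of "herm x' z'"] by (simp add: Re_herm)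
  also have "\<dots> = cos_angle x' z'" by (simp add: cos_angle_def n)
  also have "\<dots> = cos_angle x z" using c d unfolding x'_def z'_def
    by (subst cos_angle_scale_left, force, subst cos_angle_scale_right) auto
  finally show ?thesis .
qed

lemma arccos_cos_angle_triangle:
  assumes "x \<noteq> 0" "y \<noteq> 0" "z \<noteq> 0"
  shows "arccos (cos_angle x z) \<le> arccos (cos_angle x y) + arccos (cos_angle y z)"
proof -
  obtain p where p: "p \<noteq> 0" "norm (p *s x) = 1" using assms(1) by (rule cos_angle_normalize)
  obtain q where q: "q \<noteq> 0" "norm (q *s y) = 1" using assms(2) by (rule cos_angle_normalize)
  obtain r where r: "r \<noteq> 0" "norm (r *s z) = 1" using assms(3) by (rule cos_angle_normalize)
  define a b where "a = cos_angle x y" and "b = cos_angle y z"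
  have ab: "0 \<le> a" "a \<le> 1" "0 \<le> b" "b \<le> 1"
    by (simp_all add: a_def b_def cos_angle_ge_0 cos_angle_le_1)
  have "a * b - sqrt (1 - a\<^sup>2) * sqrt (1 - b\<^sup>2) \<le> cos_angle x z"
    using cos_angle_triangle_unit[OF p(2) q(2) r(2)] p q r
    by (simp add: cos_angle_scale_left cos_angle_scale_right a_def b_def)
  moreover have "cos (arccos a + arccos b) = a * b - sqrt (1 - a\<^sup>2) * sqrt (1 - b\<^sup>2)"
    using ab by (simp add: cos_add sin_arccos)
  ultimately have le: "cos (arccos a + arccos b) \<le> cos_angle x z" by simp
  have "arccos a \<le> pi/2" "arccos b \<le> pi/2" using ab arccos_le_pi2[of a] arccos_le_pi2[of b] by simp_all
  moreover have "0 \<le> arccos a" "0 \<le> arccos b" using ab by (auto intro!: arccos_lbound)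
  ultimately have "arccos (cos (arccos a + arccos b)) = arccos a + arccos b"
    by (intro arccos_cos) auto
  moreover have "arccos (cos_angle x z) \<le> arccos (cos (arccos a + arccos b))"
    using le cos_angle_le_1[of x z] by (intro arccos_le_arccos) auto
  ultimately show ?thesis by (simp add: a_def b_def)
qed

(* The distance is the geodesic distance of the Fubini-Study metric, so that the distance
   on cp2 \<times> cp2 from the library's product instance is that of the product Hermitian metric. *)
instantiation cp2 :: metric_space
begin

lift_definition dist_cp2 :: "cp2 \<Rightarrow> cp2 \<Rightarrow> real" is "\<lambda>x y. arccos (cos_angle x y)"
proof -
  fix x1 x2 y1 y2 assume "proportional x1 x2" "proportional y1 y2"
  then obtain c d where "x2 = c *s x1" "y2 = d *s y1" "x2 \<noteq> 0" "y2 \<noteq> 0"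
    by (auto simp: proportional_def)
  moreover from this have "c \<noteq> 0" "d \<noteq> 0" by auto
  ultimately show "arccos (cos_angle x1 y1) = arccos (cos_angle x2 y2)"
    by (simp add: cos_angle_scale_left cos_angle_scale_right)
qed

definition uniformity_cp2 :: "(cp2 \<times> cp2) filter" where
  "uniformity_cp2 = (INF e\<in>{0 <..}. principal {(x, y). dist x y < e})"

definition open_cp2 :: "cp2 set \<Rightarrow> bool" where
  "open_cp2 U \<longleftrightarrow> (\<forall>x\<in>U. eventually (\<lambda>(x', y). x' = x \<longrightarrow> y \<in> U) uniformity)"

instance
proof
  fix p q r :: cp2
  show "dist p q = 0 \<longleftrightarrow> p = q"
  proof transfer
    fix x y assume xy: "proportional x x" "proportional y y"
    show "arccos (cos_angle x y) = 0 \<longleftrightarrow> proportional x y"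
    proof
      assume "arccos (cos_angle x y) = 0"
      then have "cos_angle x y = 1"
        using cos_arccos[of "cos_angle x y"] cos_angle_ge_0[of x y] cos_angle_le_1[of x y] by simp
      then show "proportional x y" using xy by (intro cos_angle_eq_1) (auto simp: proportional_def)
    next
      assume "proportional x y"
      then obtain c where "y = c *s x" "y \<noteq> 0" "x \<noteq> 0" by (auto simp: proportional_def)
      moreover from this have "c \<noteq> 0" by auto
      ultimately show "arccos (cos_angle x y) = 0" by (simp add: cos_angle_scale_right cos_angle_self)
    qed
  qed
  show "dist p q \<le> dist p r + dist q r"
  proof transfer
    fix x y z assume "proportional x x" "proportional y y" "proportional z z"
    then show "arccos (cos_angle x y) \<le> arccos (cos_angle x z) + arccos (cos_angle y z)"
      using arccos_cos_angle_triangle[of x z y] cos_angle_commute[of z y]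
      by (simp add: proportional_def)
  qed
qed (simp_all add: uniformity_cp2_def open_cp2_def)

end

lemma dist_proj: "x \<noteq> 0 \<Longrightarrow> y \<noteq> 0 \<Longrightarrow> dist (proj x) (proj y) = arccos (cos_angle x y)"
  by (rule dist_cp2.abs_eq) (auto simp: proportional_def intro!: exI[of _ 1])

lemma proj_eq_iff: "x \<noteq> 0 \<Longrightarrow> y \<noteq> 0 \<Longrightarrow> proj x = proj y \<longleftrightarrow> (\<exists>c. y = c *s x)"
  using Quotient_rel_abs2[OF Quotient_cp2] Quotient3_rel[OF Quotient3_cp2, of x y]
  by (auto simp: proportional_def intro: exI[of _ 1])

lemma dist_cp2_le: "dist (p :: cp2) q \<le> pi / 2"
  by transfer (rule arccos_le_pi2[OF cos_angle_ge_0 cos_angle_le_1])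


lemma continuous_on_proj: "continuous_on (- {0}) proj"
  unfolding continuous_on_def
proof
  fix x :: "complex^3" assume "x \<in> - {0}"
  then have x: "x \<noteq> 0" by simp
  have "continuous_on (- {0}) (\<lambda>y. arccos (cos_angle y x))"
  proof (rule continuous_on_arccos)
    show "continuous_on (- {0}) (\<lambda>y. cos_angle y x)"
      unfolding cos_angle_def herm_def using x by (intro continuous_intros) auto
    show "\<forall>y\<in>- {0}. -1 \<le> cos_angle y x \<and> cos_angle y x \<le> 1"
      using cos_angle_le_1[of _ x] order_trans[OF _ cos_angle_ge_0[of _ x], of "-1"] by simp
  qed
  then have "((\<lambda>y. arccos (cos_angle y x)) \<longlongrightarrow> arccos (cos_angle x x)) (at x within - {0})"
    using x by (auto simp: continuous_on_def)
  then have "((\<lambda>y. arccos (cos_angle y x)) \<longlongrightarrow> 0) (at x within - {0})"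
    using x by (simp add: cos_angle_self)
  moreover have "\<forall>\<^sub>F y in at x within - {0}. arccos (cos_angle y x) = dist (proj y) (proj x)"
    using x by (auto simp: eventually_at_filter dist_proj)
  ultimately have "((\<lambda>y. dist (proj y) (proj x)) \<longlongrightarrow> 0) (at x within - {0})"
    by (rule Lim_transform_eventually)
  then show "(proj \<longlongrightarrow> proj x) (at x within - {0})"
    by (subst tendsto_dist_iff)
qed

(* aff 1, aff 2, aff 3 parametrize the affine pieces [1:z:w], [z:1:w], [z:w:1];
   inv (aff i) is the corresponding chart on range (aff i). *)
definition hom_coords :: "3 \<Rightarrow> complex^2 \<Rightarrow> complex^3" where
  "hom_coords i z =
     (if i = 1 then vector [1, z $ 1, z $ 2]
      else if i = 2 then vector [z $ 1, 1, z $ 2]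
      else vector [z $ 1, z $ 2, 1])"

definition aff :: "3 \<Rightarrow> complex^2 \<Rightarrow> cp2" where
  "aff i z = proj (hom_coords i z)"

definition complex_differentiable :: "(complex^2 \<Rightarrow> complex^2) \<Rightarrow> complex^2 \<Rightarrow> bool" where
  "complex_differentiable F z \<longleftrightarrow>
     (\<exists>F'. (F has_derivative F') (at z) \<and> (\<forall>c v. F' (c *s v) = c *s F' v))"

definition holomorphic_map :: "cp2 set \<Rightarrow> (cp2 \<Rightarrow> cp2) \<Rightarrow> bool" where
  "holomorphic_map U h \<longleftrightarrow> open U \<and> continuous_on U h \<and>
     (\<forall>i j z. aff i z \<in> U \<and> h (aff i z) \<in> range (aff j) \<longrightarrow>
        complex_differentiable (\<lambda>w. inv (aff j) (h (aff i w))) z)"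

definition holomorphic_off_finite :: "(cp2 \<rightharpoonup> cp2) \<Rightarrow> bool" where
  "holomorphic_off_finite f \<longleftrightarrow> finite (- dom f) \<and> holomorphic_map (dom f) (\<lambda>p. the (f p))"

lemma hom_coords_nth:
  "hom_coords 1 z = vector [1, z $ 1, z $ 2]"
  "hom_coords 2 z = vector [z $ 1, 1, z $ 2]"
  "hom_coords 3 z = vector [z $ 1, z $ 2, 1]"
  by (simp_all add: hom_coords_def)

lemma hom_coords_self [simp]: "hom_coords i z $ i = 1"
  using exhaust_3[of i] by (auto simp: hom_coords_nth)

lemma hom_coords_nonzero [simp]: "hom_coords i z \<noteq> 0"
  by (metis hom_coords_self zero_index zero_neq_one)

lemma inj_hom_coords: "inj (hom_coords i)"
proof (rule injI)
  fix z w assume "hom_coords i z = hom_coords i w"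
  then have "\<forall>k. hom_coords i z $ k = hom_coords i w $ k" by simp
  then have "z $ 1 = w $ 1 \<and> z $ 2 = w $ 2"
    using exhaust_3[of i] by (auto simp: hom_coords_nth forall_3)
  then show "z = w" by (simp add: vec_eq_iff forall_2)
qed

lemma inj_aff: "inj (aff i)"
proof (rule injI)
  fix z w assume "aff i z = aff i w"
  then obtain c where c: "hom_coords i w = c *s hom_coords i z"
    by (auto simp: aff_def proj_eq_iff)
  then have "hom_coords i w $ i = c * hom_coords i z $ i" by simp
  then have "c = 1" by simp
  with c show "z = w" using inj_hom_coords[of i] by (simp add: inj_eq)
qed

lemma infinite_UNIV_cp2: "infinite (UNIV :: cp2 set)"
proof
  assume "finite (UNIV :: cp2 set)"
  then have "finite (range (aff 1))" by (rule rev_finite_subset) simp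
  then have "finite (UNIV :: (complex^2) set)" using inj_aff by (rule finite_imageD)
  then show False using finite_imp_bounded not_bounded_UNIV by blast
qed

lemma continuous_on_hom_coords: "continuous_on UNIV (hom_coords i)"
proof -
  have "continuous_on UNIV (\<lambda>z :: complex^2. z $ l)" for l by (intro continuous_intros)
  then have "continuous_on UNIV (\<lambda>z. hom_coords i z $ k)" for k
    using exhaust_3[of i] exhaust_3[of k] by (auto simp: hom_coords_nth)
  then have "continuous_on UNIV (\<lambda>z. \<chi> k. hom_coords i z $ k)" by (rule continuous_on_vec_lambda)
  then show ?thesis by simp
qed

lemma continuous_on_aff: "continuous_on UNIV (aff i)"
  unfolding aff_def
  by (rule continuous_on_compose2[OF continuous_on_proj continuous_on_hom_coords]) auto

lemma holomorphic_map_cong: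
  assumes "holomorphic_map U h" "open V" "V \<subseteq> U" "\<And>p. p \<in> V \<Longrightarrow> k p = h p"
  shows "holomorphic_map V k"
  unfolding holomorphic_map_def
proof (intro conjI allI impI)
  show "open V" by fact
  have "continuous_on V h" using assms by (auto simp: holomorphic_map_def intro: continuous_on_subset)
  then show "continuous_on V k" using assms(4) by (simp cong: continuous_on_cong)
next
  fix i j z assume z: "aff i z \<in> V \<and> k (aff i z) \<in> range (aff j)"
  then have "complex_differentiable (\<lambda>w. inv (aff j) (h (aff i w))) z"
    using assms by (auto simp: holomorphic_map_def)
  then obtain F' where F': "((\<lambda>w. inv (aff j) (h (aff i w))) has_derivative F') (at z)"
      "\<forall>c v. F' (c *s v) = c *s F' v"
    by (auto simp: complex_differentiable_def)
  have o: "open (aff i -` V)" using continuous_on_aff assms(2) by (simp add: open_vimage)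
  have "((\<lambda>w. inv (aff j) (k (aff i w))) has_derivative F') (at z)"
    by (rule has_derivative_transform_within_open[OF F'(1) o]) (use z assms(4) in auto)
  then show "complex_differentiable (\<lambda>w. inv (aff j) (k (aff i w))) z"
    using F'(2) by (auto simp: complex_differentiable_def)
qed

lemma holomorphic_map_Un:
  assumes "holomorphic_map U h" "holomorphic_map V h"
  shows "holomorphic_map (U \<union> V) h"
  using assms by (auto simp: holomorphic_map_def intro!: continuous_on_open_Un)

lemma holomorphic_off_finite_map_add:
  assumes f: "holomorphic_off_finite f" and g: "holomorphic_off_finite g"
    and eq: "\<And>p. p \<in> dom f \<Longrightarrow> p \<in> dom g \<Longrightarrow> f p = g p"
  shows "holomorphic_off_finite (f ++ g)" "f \<subseteq>\<^sub>m f ++ g" "g \<subseteq>\<^sub>m f ++ g"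
proof -
  show "g \<subseteq>\<^sub>m f ++ g" by simp
  show le: "f \<subseteq>\<^sub>m f ++ g"
    using eq by (force simp: map_le_def map_add_def split: option.splits)
  have vf: "the ((f ++ g) p) = the (f p)" if "p \<in> dom f" for p
    using le that unfolding map_le_def by metis
  have vg: "the ((f ++ g) p) = the (g p)" if "p \<in> dom g" for p
    using that by (simp add: map_add_dom_app_simps(1))
  have hf: "holomorphic_map (dom f) (\<lambda>p. the (f p))" and hg: "holomorphic_map (dom g) (\<lambda>p. the (g p))"
    using f g by (simp_all add: holomorphic_off_finite_def)
  have "holomorphic_map (dom f) (\<lambda>p. the ((f ++ g) p))"
    by (rule holomorphic_map_cong[OF hf _ subset_refl vf]) (use hf in \<open>simp add: holomorphic_map_def\<close>)
  moreover have "holomorphic_map (dom g) (\<lambda>p. the ((f ++ g) p))"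
    by (rule holomorphic_map_cong[OF hg _ subset_refl vg]) (use hg in \<open>simp add: holomorphic_map_def\<close>)
  ultimately have "holomorphic_map (dom (f ++ g)) (\<lambda>p. the ((f ++ g) p))"
    using holomorphic_map_Un by (simp add: Un_commute)
  then show "holomorphic_off_finite (f ++ g)"
    using f by (auto simp: holomorphic_off_finite_def intro: rev_finite_subset)
qed

(* A meromorphic map is represented by its extension to the largest possible domain:
   dom f is the set where f is holomorphic, its complement is the finite set of
   indeterminacy points. *)
typedef mero_map = "{f. holomorphic_off_finite f \<and>
    (\<forall>g. holomorphic_off_finite g \<and> f \<subseteq>\<^sub>m g \<longrightarrow> g = f)}"
  morphisms partial_map Abs_mero_map
proof -
  define c where "c = aff 1 0"
  have "holomorphic_map UNIV (\<lambda>p. c)"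
    by (auto simp: holomorphic_map_def complex_differentiable_def intro!: exI[of _ "\<lambda>_. 0"])
  then have "holomorphic_off_finite (\<lambda>p. Some c)"
    by (simp add: holomorphic_off_finite_def dom_def)
  moreover have "g = (\<lambda>p. Some c)" if "(\<lambda>p. Some c) \<subseteq>\<^sub>m g" for g :: "cp2 \<rightharpoonup> cp2"
    using that by (auto simp: map_le_def dom_def)
  ultimately show ?thesis by blast
qed

definition graph_of :: "mero_map \<Rightarrow> (cp2 \<times> cp2) set" where
  "graph_of f = closure (Map.graph (partial_map f))"

lemma holomorphic_off_finite_partial_map: "holomorphic_off_finite (partial_map f)"
  using partial_map[of f] by simp

lemma partial_map_maximal:
  "holomorphic_off_finite g \<Longrightarrow> partial_map f \<subseteq>\<^sub>m g \<Longrightarrow> g = partial_map f"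
  using partial_map[of f] by blast

lemma graph_of_nonempty: "graph_of f \<noteq> {}"
proof -
  have "dom (partial_map f) \<noteq> {}"
    using holomorphic_off_finite_partial_map[of f] infinite_UNIV_cp2
    by (auto simp: holomorphic_off_finite_def)
  then have "Map.graph (partial_map f) \<noteq> {}" by (auto simp: Map.graph_def)
  then show ?thesis by (simp add: graph_of_def)
qed

lemma graph_of_on_dom:
  assumes "p \<in> dom (partial_map f)" "(p, q) \<in> graph_of f"
  shows "partial_map f p = Some q"
proof -
  obtain s where s: "\<And>n. s n \<in> Map.graph (partial_map f)" "s \<longlonglongrightarrow> (p, q)"
    using assms(2) unfolding graph_of_def closure_sequential by blast
  have c: "continuous_on (dom (partial_map f)) (\<lambda>p. the (partial_map f p))"
    using holomorphic_off_finite_partial_map[of f]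
    by (simp add: holomorphic_off_finite_def holomorphic_map_def)
  have s': "partial_map f (fst (s n)) = Some (snd (s n))" for n
    using s(1)[of n] by (auto simp: Map.graph_def)
  have "(\<lambda>n. fst (s n)) \<longlonglongrightarrow> p" using tendsto_fst[OF s(2)] by simp
  then have "(\<lambda>n. the (partial_map f (fst (s n)))) \<longlonglongrightarrow> the (partial_map f p)"
    by (rule continuous_on_tendsto_compose[OF c]) (use assms(1) s' in \<open>simp_all add: domIff\<close>)
  then have "(\<lambda>n. snd (s n)) \<longlonglongrightarrow> the (partial_map f p)" by (simp add: s')
  moreover have "(\<lambda>n. snd (s n)) \<longlonglongrightarrow> q" using tendsto_snd[OF s(2)] by simp
  ultimately have "the (partial_map f p) = q" by (rule LIMSEQ_unique)
  then show ?thesis using assms(1) by auto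
qed

lemma graph_of_inject: "graph_of f = graph_of g \<longleftrightarrow> f = g"
proof
  assume eq: "graph_of f = graph_of g"
  let ?f = "partial_map f" and ?g = "partial_map g"
  have "?f p = ?g p" if pf: "p \<in> dom ?f" and pg: "p \<in> dom ?g" for p
  proof -
    obtain q where q: "?g p = Some q" using pg by auto
    then have "(p, q) \<in> Map.graph ?g" by (simp add: Map.graph_def)
    then have "(p, q) \<in> graph_of f"
      unfolding eq unfolding graph_of_def by (rule subsetD[OF closure_subset])
    then show ?thesis using graph_of_on_dom[OF pf] q by simp
  qed
  then have add: "holomorphic_off_finite (?f ++ ?g)" "?f \<subseteq>\<^sub>m ?f ++ ?g" "?g \<subseteq>\<^sub>m ?f ++ ?g"
    by (intro holomorphic_off_finite_map_add[OF holomorphic_off_finite_partial_map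
          holomorphic_off_finite_partial_map]; blast)+
  have "?f ++ ?g = ?f" "?f ++ ?g = ?g"
    by (rule partial_map_maximal[OF add(1,2)], rule partial_map_maximal[OF add(1,3)])
  then show "f = g" by (simp add: partial_map_inject)
qed simp

definition hausdorff_dist :: "'a::metric_space set \<Rightarrow> 'a set \<Rightarrow> real" where
  "hausdorff_dist A B = max (SUP a\<in>A. infdist a B) (SUP b\<in>B. infdist b A)"

lemma bounded_cp2_prod: "bounded (S :: (cp2 \<times> cp2) set)"
proof -
  have "dist x y \<le> pi / 2 + pi / 2" for x y :: "cp2 \<times> cp2"
  proof -
    have "dist x y \<le> \<bar>dist (fst x) (fst y)\<bar> + \<bar>dist (snd x) (snd y)\<bar>"
      unfolding dist_prod_def by (rule sqrt_sum_squares_le_sum_abs)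
    also have "\<dots> \<le> pi / 2 + pi / 2" using dist_cp2_le by (intro add_mono) simp_all
    finally show ?thesis .
  qed
  then show ?thesis unfolding bounded_def by blast
qed

lemma bdd_above_infdist:
  assumes "bounded A" "B \<noteq> {}"
  shows "bdd_above ((\<lambda>a. infdist a B) ` A)"
proof -
  obtain b where b: "b \<in> B" using assms(2) by blast
  obtain e where "\<forall>a\<in>A. dist b a \<le> e" using assms(1) bounded_any_center[of A b] by blast
  then have "infdist a B \<le> e" if "a \<in> A" for a
    using infdist_le[OF b, of a] that by (force simp: dist_commute)
  then show ?thesis by (rule bdd_aboveI2)
qed

lemma hausdorff_dist_commute: "hausdorff_dist A B = hausdorff_dist B A"
  by (simp add: hausdorff_dist_def max.commute)

lemma infdist_le_hausdorff_dist:
  assumes "bounded A" "B \<noteq> {}" "a \<in> A"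
  shows "infdist a B \<le> hausdorff_dist A B"
  using cSUP_upper[OF assms(3) bdd_above_infdist[OF assms(1,2)]] by (simp add: hausdorff_dist_def)

lemma hausdorff_dist_leI:
  assumes "A \<noteq> {}" "B \<noteq> {}" "\<And>a. a \<in> A \<Longrightarrow> infdist a B \<le> r" "\<And>b. b \<in> B \<Longrightarrow> infdist b A \<le> r"
  shows "hausdorff_dist A B \<le> r"
  using assms by (auto simp: hausdorff_dist_def intro!: cSUP_least)

lemma infdist_le_infdist_add_hausdorff_dist:
  assumes "bounded B" "B \<noteq> {}" "C \<noteq> {}"
  shows "infdist a C \<le> infdist a B + hausdorff_dist B C"
proof -
  have "infdist a C - hausdorff_dist B C \<le> dist a b" if "b \<in> B" for b
    using infdist_triangle[of a C b] infdist_le_hausdorff_dist[OF assms(1,3) that] by linarith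
  then have "infdist a C - hausdorff_dist B C \<le> infdist a B"
    unfolding infdist_notempty[OF assms(2)] using assms(2) by (intro cINF_greatest) auto
  then show ?thesis by linarith
qed

lemma hausdorff_dist_triangle:
  assumes "bounded A" "bounded B" "bounded C" "A \<noteq> {}" "B \<noteq> {}" "C \<noteq> {}"
  shows "hausdorff_dist A C \<le> hausdorff_dist A B + hausdorff_dist B C"
proof (rule hausdorff_dist_leI)
  show "infdist a C \<le> hausdorff_dist A B + hausdorff_dist B C" if "a \<in> A" for a
    using infdist_le_infdist_add_hausdorff_dist[of B C a] infdist_le_hausdorff_dist[of A B a]
      assms that by linarith
  show "infdist c A \<le> hausdorff_dist A B + hausdorff_dist B C" if "c \<in> C" for c
    using infdist_le_infdist_add_hausdorff_dist[of B A c] infdist_le_hausdorff_dist[of C B c]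
      assms that hausdorff_dist_commute[of A B] hausdorff_dist_commute[of B C] by linarith
qed (use assms in auto)

lemma hausdorff_dist_eq_0:
  assumes "bounded A" "bounded B" "A \<noteq> {}" "B \<noteq> {}" "closed A" "closed B" 
  shows "hausdorff_dist A B = 0 \<longleftrightarrow> A = B"
proof
  have *: "X \<subseteq> Y" if "hausdorff_dist X Y = 0" "bounded X" "Y \<noteq> {}" "closed Y"
    for X Y :: "'a set"
  proof
    fix x assume "x \<in> X"
    then have "infdist x Y = 0"
      using infdist_le_hausdorff_dist[of X Y x] infdist_nonneg[of x Y] that by simp
    then show "x \<in> Y" using in_closed_iff_infdist_zero that by blast
  qed
  assume "hausdorff_dist A B = 0"
  then show "A = B" using *[of A B] *[of B A] assms hausdorff_dist_commute[of A B] by auto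
next
  assume "A = B"
  then show "hausdorff_dist A B = 0" using assms by (simp add: hausdorff_dist_def)
qed

(* cp2 being compact, strong convergence of meromorphic maps is convergence of their graphs
   in the Hausdorff distance. *)
instantiation mero_map :: metric_space
begin

definition dist_mero_map :: "mero_map \<Rightarrow> mero_map \<Rightarrow> real" where
  "dist_mero_map f g = hausdorff_dist (graph_of f) (graph_of g)"

definition uniformity_mero_map :: "(mero_map \<times> mero_map) filter" where
  "uniformity_mero_map = (INF e\<in>{0 <..}. principal {(x, y). dist x y < e})"

definition open_mero_map :: "mero_map set \<Rightarrow> bool" where
  "open_mero_map U \<longleftrightarrow> (\<forall>x\<in>U. eventually (\<lambda>(x', y). x' = x \<longrightarrow> y \<in> U) uniformity)"

instance
proof
  fix f g h :: mero_map
  show "dist f g = 0 \<longleftrightarrow> f = g"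
    unfolding dist_mero_map_def
    by (subst hausdorff_dist_eq_0)
       (simp_all add: bounded_cp2_prod graph_of_nonempty graph_of_inject, simp_all add: graph_of_def)
  show "dist f g \<le> dist f h + dist g h"
    unfolding dist_mero_map_def hausdorff_dist_commute[of "graph_of g"]
    by (intro hausdorff_dist_triangle bounded_cp2_prod graph_of_nonempty)
qed (simp_all add: uniformity_mero_map_def open_mero_map_def)

end

(* By maximality of the domain, f is holomorphic near p iff p lies in the (open) domain:
   a local holomorphic extension across p could be glued to f. *)
definition fixed_point :: "mero_map \<Rightarrow> cp2 \<Rightarrow> bool" where
  "fixed_point f p \<longleftrightarrow> p \<in> dom (partial_map f) \<and> partial_map f p = Some p"

(* A homogeneous polynomial of degree d in three variables with coefficients a i j, i + j \<le> d. *)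
definition form :: "nat \<Rightarrow> (nat \<Rightarrow> nat \<Rightarrow> complex) \<Rightarrow> complex^3 \<Rightarrow> complex" where
  "form d a x = (\<Sum>i\<le>d. \<Sum>j\<le>d - i. a i j * (x $ 1) ^ i * (x $ 2) ^ j * (x $ 3) ^ (d - i - j))"

definition complex_curve :: "cp2 set \<Rightarrow> bool" where
  "complex_curve C \<longleftrightarrow>
     (\<exists>d a. d \<ge> 1 \<and> (\<exists>i j. i + j \<le> d \<and> a i j \<noteq> 0) \<and> C = proj ` {x. x \<noteq> 0 \<and> form d a x = 0})"

definition FFix :: "mero_map set" where
  "FFix = {f. \<not> (\<exists>p. fixed_point f p)}"

definition DFix :: "mero_map set" where
  "DFix = {f. \<exists>C. complex_curve C \<and> (\<forall>p\<in>C \<inter> dom (partial_map f). fixed_point f p)}"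

end

theory Submission
  imports Defs "HOL-Complex_Analysis.Complex_Analysis"
    "HOL-Computational_Algebra.Field_as_Ring" "HOL-Computational_Algebra.Polynomial_Factorial"
begin

text \<open>
  Let \<open>f\<close> have a fixed point \<open>p\<close> but no curve of fixed points; maps near \<open>f\<close> share both properties, so the
  complement of the set is open.

  Restricted to a line that avoids the indeterminacy points, \<open>f\<close> is rational by Liouville's theorem; hence
  it is rational in each of two affine coordinates and, by a theorem of Hurwitz, rational: \<open>f = [P1 : P2 : P3]\<close>
  with coprime polynomials. A common factor of the minors \<open>x\<^sub>i P\<^sub>j - x\<^sub>j P\<^sub>i\<close> would be a curve of fixed points.
  As there is none, only finitely many fixed points are affine.

  Convergence of the graphs gives uniform convergence on compact sets of the domain of \<open>f\<close>; there Hartogs'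
  theorem on isolated points removes the indeterminacy points of the approximating maps. Since \<open>p\<close> is
  isolated, it persists as a fixed point of the nearby maps by a two-dimensional form of Hurwitz's theorem
  on zeros. Finally some line avoids the indeterminacy points and the fixed points of \<open>f\<close>. The nearby maps
  have no fixed points on it either, but it meets every curve, so they have no curve of fixed points.
\<close>

section \<open>Holomorphic functions of two variables\<close>

text \<open>Finiteness of the affine fixed points of \<open>f\<close> carries both halves of the
  argument: isolation is what makes a fixed point persist, and finiteness leaves room for a line
  without fixed points. This is why \<open>f\<close> must be rational. A priori its fixed point set
  is only analytic off finitely many points, while \<open>DFix\<close> asks for an algebraic curve
  in the whole plane; a common factor of the minors supplies such a curve, and in its absence
  elimination leaves finitely many points. Of the nearby maps nothing algebraic is used, not even a
  bound on their degrees, only that they are uniformly close to \<open>f\<close> on compact subsets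
  of its domain. Their indeterminacy points might accumulate there. They do not, because close
  graphs force the values near such a point into a single affine chart, where Hartogs' theorem
  applies to two scalar functions.\<close>

lemma contour_integral_circlepath_eq:
  "contour_integral (circlepath c r) f =
     integral (cbox 0 1) (\<lambda>t. f (circlepath c r t) * (2 * pi * \<i> * r * exp (2 * pi * \<i> * t)))"
  unfolding contour_integral_integral cbox_interval
  by (intro integral_cong) (simp add: vector_derivative_circlepath)

lemma circlepath_in_sphere: "0 \<le> r \<Longrightarrow> circlepath c r t \<in> sphere c r"
  by (simp add: circlepath dist_norm norm_mult)

lemma continuous_on_contour_integral_circlepath:
  fixes k :: "'a::topological_space \<Rightarrow> complex \<Rightarrow> complex"
  assumes "0 \<le> r" and k: "continuous_on (U \<times> sphere c r) (\<lambda>(x, u). k x u)"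
  shows "continuous_on U (\<lambda>x. contour_integral (circlepath c r) (k x))"
proof -
  have cc: "continuous_on S (circlepath c r)" for S by (auto simp: circlepath intro!: continuous_intros)
  have "continuous_on (U \<times> cbox 0 1) (\<lambda>p. (\<lambda>(x, u). k x u) (fst p, circlepath c r (snd p)))"
    by (rule continuous_on_compose2[OF k])
       (use assms(1) in \<open>auto simp: circlepath_in_sphere simp del: mem_sphere intro!: continuous_intros continuous_on_compose2[OF cc]\<close>)
  then have "continuous_on (U \<times> cbox 0 1)
      (\<lambda>p. k (fst p) (circlepath c r (snd p)) * (2 * pi * \<i> * r * exp (2 * pi * \<i> * complex_of_real (snd p))))"
    unfolding case_prod_unfold by (intro continuous_intros) simp_all
  then show ?thesis
    unfolding contour_integral_circlepath_eq
    by (intro integral_continuous_on_param) (simp add: case_prod_unfold)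
qed

text \<open>Differentiation under the integral sign, over the parameter interval of the circle. It
  asks for a jointly continuous derivative in the parameter, which \<open>hol2\<close> functions
  will be shown to have.\<close>

lemma holomorphic_on_contour_integral_circlepath:
  fixes k :: "complex \<Rightarrow> complex \<Rightarrow> complex"
  assumes r: "0 \<le> r" and U: "open U" "convex U"
    and k: "continuous_on (U \<times> sphere c r) (\<lambda>(x, u). k x u)"
    and k': "continuous_on (U \<times> sphere c r) (\<lambda>(x, u). k' x u)"
    and d: "\<And>x u. x \<in> U \<Longrightarrow> u \<in> sphere c r \<Longrightarrow> ((\<lambda>x. k x u) has_field_derivative k' x u) (at x)"
  shows "(\<lambda>x. contour_integral (circlepath c r) (k x)) holomorphic_on U"
proof -
  define e where "e t = 2 * pi * \<i> * r * exp (2 * pi * \<i> * complex_of_real t)" for t :: real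
  have ce: "continuous_on S e" for S unfolding e_def by (intro continuous_intros)
  have cc: "continuous_on S (circlepath c r)" for S by (auto simp: circlepath intro!: continuous_intros)
  have *: "continuous_on (U \<times> cbox 0 1) (\<lambda>(x, t). h x (circlepath c r t) * e t)"
    if "continuous_on (U \<times> sphere c r) (\<lambda>(x, u). h x u)" for h
  proof -
    have "continuous_on (U \<times> cbox 0 1) (\<lambda>p. (\<lambda>(x, u). h x u) (fst p, circlepath c r (snd p)))"
      by (rule continuous_on_compose2[OF that])
         (use r in \<open>auto simp: circlepath_in_sphere simp del: mem_sphere intro!: continuous_intros continuous_on_compose2[OF cc]\<close>)
    moreover have "continuous_on (U \<times> cbox 0 1) (\<lambda>p. e (snd p))"
      by (rule continuous_on_compose2[OF ce[of UNIV]]) (auto intro!: continuous_intros)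
    ultimately show ?thesis by (auto simp: case_prod_unfold intro!: continuous_intros)
  qed
  show ?thesis
    unfolding contour_integral_circlepath_eq e_def[symmetric]
  proof (rule leibniz_rule_holomorphic[where fx = "\<lambda>x t. k' x (circlepath c r t) * e t"])
    fix x and t :: real assume "x \<in> U" "t \<in> cbox 0 1"
    then show "((\<lambda>x. k x (circlepath c r t) * e t) has_field_derivative
        k' x (circlepath c r t) * e t) (at x within U)"
      using circlepath_in_sphere[OF r]
      by (intro DERIV_cmult_right) (rule DERIV_subset[OF d], auto simp del: mem_sphere)
  next
    fix x assume x: "x \<in> U"
    have "continuous_on (cbox 0 1) (\<lambda>t. (\<lambda>(x, t). k x (circlepath c r t) * e t) (x, t))"
      by (rule continuous_on_compose2[OF *[OF k]]) (use x in \<open>auto intro!: continuous_intros\<close>)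
    then show "(\<lambda>t. k x (circlepath c r t) * e t) integrable_on cbox 0 1"
      by (intro integrable_continuous) simp
  qed (use *[OF k'] U in auto)
qed

text \<open>Holomorphy in the sense of Osgood: joint continuity makes Cauchy integrals in one
  variable depend well on the other, and all further regularity is drawn from these
  integrals.\<close>

definition hol2 :: "(complex \<times> complex) set \<Rightarrow> (complex \<Rightarrow> complex \<Rightarrow> complex) \<Rightarrow> bool" where
  "hol2 U g \<longleftrightarrow> open U \<and> continuous_on U (\<lambda>(z, w). g z w) \<and>
     (\<forall>z w. (z, w) \<in> U \<longrightarrow> (\<lambda>z. g z w) field_differentiable at z \<and> g z field_differentiable at w)"

lemma hol2_swap: "hol2 U g \<Longrightarrow> hol2 (prod.swap ` U) (\<lambda>w z. g z w)"
proof -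
  assume g: "hol2 U g"
  have "continuous_on (prod.swap ` U) (\<lambda>p. (\<lambda>(z, w). g z w) (prod.swap p))"
    by (rule continuous_on_compose2[where t = U])
       (use g in \<open>auto simp: hol2_def prod.swap_def intro!: continuous_intros\<close>)
  moreover have "open (prod.swap ` U)"
  proof -
    have "prod.swap ` U = prod.swap -` U" by (auto simp: image_iff Bex_def)
    then show ?thesis using g by (auto simp: hol2_def prod.swap_def intro!: open_vimage continuous_intros)
  qed
  ultimately show ?thesis using g by (auto simp: hol2_def case_prod_unfold)
qed

lemma hol2_subset: "hol2 U g \<Longrightarrow> open V \<Longrightarrow> V \<subseteq> U \<Longrightarrow> hol2 V g"
  by (auto simp: hol2_def intro: continuous_on_subset)

lemma hol2_holomorphic_fst: "hol2 U g \<Longrightarrow> (\<And>z. z \<in> S \<Longrightarrow> (z, w) \<in> U) \<Longrightarrow> (\<lambda>z. g z w) holomorphic_on S"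
  by (auto simp: hol2_def holomorphic_on_def intro: field_differentiable_at_within)

lemma hol2_holomorphic_snd: "hol2 U g \<Longrightarrow> (\<And>w. w \<in> S \<Longrightarrow> (z, w) \<in> U) \<Longrightarrow> g z holomorphic_on S"
  by (auto simp: hol2_def holomorphic_on_def intro: field_differentiable_at_within)

lemma open_prod_cball:
  fixes z w :: complex
  assumes "open U" "(z, w) \<in> U"
  obtains r where "r > 0" "cball z r \<times> cball w r \<subseteq> U"
proof -
  obtain A B where AB: "open A" "open B" "(z, w) \<in> A \<times> B" "A \<times> B \<subseteq> U"
    using assms by (rule open_prod_elim)
  obtain a where a: "a > 0" "cball z a \<subseteq> A" using AB open_contains_cball by (metis mem_Sigma_iff)
  obtain b where b: "b > 0" "cball w b \<subseteq> B" using AB open_contains_cball by (metis mem_Sigma_iff)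
  have "cball z (min a b) \<times> cball w (min a b) \<subseteq> A \<times> B" using a b by auto
  then show ?thesis using that[of "min a b"] a b AB by auto
qed

text \<open>Cauchy's formula for the derivative writes the partial derivative as a circle integral
  with jointly continuous integrand.\<close>

lemma continuous_on_deriv_fst_aux:
  assumes g: "hol2 U g" and sub: "cball z0 r \<times> ball w0 r \<subseteq> U" and r: "r > 0"
  shows "continuous_on (ball z0 r \<times> ball w0 r) (\<lambda>(z, w). deriv (\<lambda>z. g z w) z)"
proof -
  have cg: "continuous_on U (\<lambda>(z, w). g z w)" using g by (simp add: hol2_def)
  have "continuous_on ((ball z0 r \<times> ball w0 r) \<times> sphere z0 r)
      (\<lambda>(x, u). g u (snd x) / (u - fst x)^2)"
  proof -
    have "continuous_on ((ball z0 r \<times> ball w0 r) \<times> sphere z0 r)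
        (\<lambda>p. (\<lambda>(z, w). g z w) (snd p, snd (fst p)))"
      by (rule continuous_on_compose2[OF cg]) (use sub in \<open>auto intro!: continuous_intros\<close>)
    then show ?thesis by (auto simp: case_prod_unfold dist_norm intro!: continuous_intros)
  qed
  then have c: "continuous_on (ball z0 r \<times> ball w0 r)
      (\<lambda>x. contour_integral (circlepath z0 r) (\<lambda>u. g u (snd x) / (u - fst x)^2))"
    using r by (intro continuous_on_contour_integral_circlepath) auto
  have eq: "contour_integral (circlepath z0 r) (\<lambda>u. g u w / (u - z)^2) / (2 * pi * \<i>) = deriv (\<lambda>z. g z w) z"
    if "z \<in> ball z0 r" "w \<in> ball w0 r" for z w
  proof -
    have h: "(\<lambda>z. g z w) holomorphic_on cball z0 r"
      by (rule hol2_holomorphic_fst[OF g]) (use sub that in auto)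
    have "contour_integral (circlepath z0 r) (\<lambda>u. g u w / (u - z)^2) = (2 * pi * \<i>) * deriv (\<lambda>z. g z w) z"
      by (rule Cauchy_contour_integral_circlepath_2)
         (use h that in \<open>auto intro: holomorphic_on_imp_continuous_on holomorphic_on_subset\<close>)
    then show ?thesis by simp
  qed
  have "continuous_on (ball z0 r \<times> ball w0 r)
      (\<lambda>x. contour_integral (circlepath z0 r) (\<lambda>u. g u (snd x) / (u - fst x)^2) / (2 * pi * \<i>))"
    using c by (intro continuous_intros) auto
  then show ?thesis
    by (rule continuous_on_eq) (use eq in auto)
qed

lemma continuous_on_deriv_fst:
  assumes g: "hol2 U g"
  shows "continuous_on U (\<lambda>(z, w). deriv (\<lambda>z. g z w) z)"
proof -
  have "\<exists>V. p \<in> V \<and> open V \<and> V \<subseteq> U \<and> continuous_on V (\<lambda>(z, w). deriv (\<lambda>z. g z w) z)" if "p \<in> U" for p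
  proof -
    have "open U" "(fst p, snd p) \<in> U" using that g by (simp_all add: hol2_def)
    then obtain r where "r > 0" "cball (fst p) r \<times> cball (snd p) r \<subseteq> U" by (rule open_prod_cball)
    then show ?thesis
      using continuous_on_deriv_fst_aux[OF g, of "fst p" r "snd p"]
      by (intro exI[of _ "ball (fst p) r \<times> ball (snd p) r"]) (auto simp: mem_Times_iff subset_iff open_Times)
  qed
  then obtain V where V: "\<And>p. p \<in> U \<Longrightarrow> p \<in> V p \<and> open (V p) \<and> V p \<subseteq> U \<and>
      continuous_on (V p) (\<lambda>(z, w). deriv (\<lambda>z. g z w) z)"
    by metis
  then have U: "U = (\<Union>p\<in>U. V p)" by blast
  show ?thesis by (subst U, rule continuous_on_open_UN) (use V in auto)
qed

lemma continuous_on_deriv_snd: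
  assumes g: "hol2 U g"
  shows "continuous_on U (\<lambda>(z, w). deriv (g z) w)"
proof -
  have "continuous_on U (\<lambda>p. (\<lambda>(w, z). deriv (\<lambda>w. g z w) w) (prod.swap p))"
    by (rule continuous_on_compose2[OF continuous_on_deriv_fst[OF hol2_swap[OF g]]])
       (auto simp: prod.swap_def intro!: continuous_intros)
  then show ?thesis by (simp add: case_prod_unfold)
qed

text \<open>Differentiation under the integral sign, with a weight \<open>q\<close> that leaves room
  for the Cauchy kernels \<open>1 / (u - w)\<close> and \<open>1 / (u - w)^2\<close>.\<close>

lemma holomorphic_on_Cauchy_fst:
  assumes g: "hol2 U g" and sub: "ball z0 r \<times> sphere w0 s \<subseteq> U" and s: "s \<ge> 0"
    and q: "continuous_on (sphere w0 s) q"
  shows "(\<lambda>z. contour_integral (circlepath w0 s) (\<lambda>u. g z u * q u)) holomorphic_on ball z0 r"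
proof -
  have q': "continuous_on (ball z0 r \<times> sphere w0 s) (\<lambda>p. q (snd p))"
    by (rule continuous_on_compose2[OF q]) (auto intro!: continuous_intros)
  show ?thesis
  proof (rule holomorphic_on_contour_integral_circlepath[where k' = "\<lambda>z u. deriv (\<lambda>z. g z u) z * q u"])
    show "continuous_on (ball z0 r \<times> sphere w0 s) (\<lambda>(x, u). g x u * q u)"
      using continuous_on_subset[OF _ sub, of "\<lambda>(z, w). g z w"] g q'
      by (auto simp: hol2_def case_prod_unfold intro!: continuous_intros)
    show "continuous_on (ball z0 r \<times> sphere w0 s) (\<lambda>(x, u). deriv (\<lambda>z. g z u) x * q u)"
      using continuous_on_subset[OF continuous_on_deriv_fst[OF g] sub] q'
      by (auto simp: case_prod_unfold intro!: continuous_intros)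
    show "((\<lambda>x. g x u * q u) has_field_derivative deriv (\<lambda>z. g z u) x * q u) (at x)"
      if "x \<in> ball z0 r" "u \<in> sphere w0 s" for x u
    proof -
      have "(x, u) \<in> U" using sub that by blast
      then have "(\<lambda>z. g z u) field_differentiable at x" using g by (simp add: hol2_def)
      then show ?thesis by (intro DERIV_cmult_right) (simp add: field_differentiable_derivI)
    qed
  qed (use s in auto)
qed

lemma hol2_deriv_snd:
  assumes g: "hol2 U g"
  shows "hol2 U (\<lambda>z w. deriv (g z) w)"
  unfolding hol2_def
proof (intro conjI allI impI)
  show U: "open U" using g by (simp add: hol2_def)
  show "continuous_on U (\<lambda>(z, w). deriv (g z) w)" by (rule continuous_on_deriv_snd[OF g])
  fix z0 w0 assume zw: "(z0, w0) \<in> U"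
  obtain r where r: "r > 0" "cball z0 r \<times> cball w0 r \<subseteq> U" using open_prod_cball[OF U zw] .
  have "g z0 holomorphic_on ball w0 r" by (rule hol2_holomorphic_snd[OF g]) (use r in auto)
  then have "deriv (g z0) holomorphic_on ball w0 r" by (rule holomorphic_deriv) auto
  then show "deriv (g z0) field_differentiable at w0"
    using r by (intro holomorphic_on_imp_differentiable_at[of _ "ball w0 r"]) auto
  have "(\<lambda>z. contour_integral (circlepath w0 r) (\<lambda>u. g z u * (1 / (u - w0)^2)) / (2 * pi * \<i>)) holomorphic_on ball z0 r"
    using r by (intro holomorphic_intros holomorphic_on_Cauchy_fst[OF g]) (auto intro!: continuous_intros)
  moreover have "contour_integral (circlepath w0 r) (\<lambda>u. g z u * (1 / (u - w0)^2)) / (2 * pi * \<i>) = deriv (g z) w0"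
    if "z \<in> ball z0 r" for z
  proof -
    have h: "g z holomorphic_on cball w0 r" by (rule hol2_holomorphic_snd[OF g]) (use r that in auto)
    have "contour_integral (circlepath w0 r) (\<lambda>u. g z u / (u - w0)^2) = (2 * pi * \<i>) * deriv (g z) w0"
      by (rule Cauchy_contour_integral_circlepath_2)
         (use h r in \<open>auto intro: holomorphic_on_imp_continuous_on holomorphic_on_subset\<close>)
    then show ?thesis by simp
  qed
  ultimately have "(\<lambda>z. deriv (g z) w0) holomorphic_on ball z0 r" by (rule holomorphic_transform)
  then show "(\<lambda>z. deriv (g z) w0) field_differentiable at z0"
    using r by (intro holomorphic_on_imp_differentiable_at[of _ "ball z0 r"]) auto
qed

text \<open>Continuity of a partial derivative yields the total derivative. The definition of
  \<open>holomorphic_map\<close> speaks of total derivatives, so this is the way back from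
  \<open>hol2\<close>.\<close>

lemma hol2_has_derivative:
  assumes g: "hol2 U g" and zw: "(z, w) \<in> U"
  shows "((\<lambda>(z, w). g z w) has_derivative (\<lambda>(a, b). deriv (\<lambda>z. g z w) z * a + deriv (g z) w * b)) (at (z, w))"
proof -
  obtain r where r: "r > 0" "cball z r \<times> cball w r \<subseteq> U"
    using open_prod_cball[OF _ zw] g by (auto simp: hol2_def)
  let ?B = "\<lambda>x y. blinfun_mult_right (deriv (g x) y)"
  have "((\<lambda>(x, y). g x y) has_derivative
      (\<lambda>(tx, ty). deriv (\<lambda>z. g z w) z * tx + blinfun_apply (?B z w) ty)) (at (z, w) within ball z r \<times> ball w r)"
  proof (rule has_derivative_partialsI)
    show "((\<lambda>x. g x w) has_derivative (*) (deriv (\<lambda>z. g z w) z)) (at z within ball z r)"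
    proof -
      have "((\<lambda>x. g x w) has_field_derivative deriv (\<lambda>z. g z w) z) (at z)"
        by (rule field_differentiable_derivI) (use g zw in \<open>simp add: hol2_def\<close>)
      then show ?thesis by (rule has_derivative_at_withinI[OF has_field_derivative_imp_has_derivative])
    qed
    show "(g x has_derivative blinfun_apply (?B x y)) (at y within ball w r)"
      if "x \<in> ball z r" "y \<in> ball w r" for x y
    proof -
      have "(x, y) \<in> U" using r that by auto
      then have "(g x has_field_derivative deriv (g x) y) (at y)"
        by (intro field_differentiable_derivI) (use g in \<open>simp add: hol2_def\<close>)
      then have "(g x has_derivative (*) (deriv (g x) y)) (at y)"
        by (rule has_field_derivative_imp_has_derivative)
      then show ?thesis by (simp add: blinfun_mult_right.rep_eq has_derivative_at_withinI)
    qed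
    have "continuous_on (ball z r \<times> ball w r) (\<lambda>(x, y). deriv (g x) y)"
      by (rule continuous_on_subset[OF continuous_on_deriv_snd[OF g]]) (use r in auto)
    then have "continuous_on (ball z r \<times> ball w r) (\<lambda>(x, y). ?B x y)"
      by (auto simp: case_prod_unfold intro!: continuous_intros)
    then show "continuous (at (z, w) within ball z r \<times> ball w r) (\<lambda>(x, y). ?B x y)"
      using r by (simp add: continuous_on_eq_continuous_within)
  qed (use r in auto)
  then show ?thesis
    by (simp add: at_within_open[of "(z, w)" "ball z r \<times> ball w r"] r open_Times)
qed

text \<open>The extension is the Cauchy integral in \<open>w\<close> over the circle of radius
  \<open>r\<close> around \<open>w0\<close>. That circle misses the puncture for every
  \<open>z\<close>, so the integral is holomorphic on the whole bidisc.\<close>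

lemma hol2_extend_point:
  assumes g: "hol2 (ball z0 R \<times> ball w0 R - {(z0, w0)}) g" and r: "0 < r" "r < R"
  obtains G where "hol2 (ball z0 r \<times> ball w0 r) G"
    "\<And>z w. (z, w) \<in> ball z0 r \<times> ball w0 r - {(z0, w0)} \<Longrightarrow> G z w = g z w"
proof -
  define U where "U = ball z0 R \<times> ball w0 R - {(z0, w0)}"
  define W where "W = ball z0 r \<times> ball w0 r"
  define G where "G z w = contour_integral (circlepath w0 r) (\<lambda>u. g z u * (1 / (u - w))) / (2 * pi * \<i>)" for z w
  have cg: "continuous_on U (\<lambda>(z, w). g z w)" using g by (simp add: hol2_def U_def)
  have sub: "ball z0 r \<times> sphere w0 r \<subseteq> U" using r by (auto simp: U_def)
  have c: "continuous_on W (\<lambda>x. contour_integral (circlepath w0 r) (\<lambda>u. g (fst x) u * (1 / (u - snd x))))"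
  proof (rule continuous_on_contour_integral_circlepath)
    have "continuous_on (W \<times> sphere w0 r) (\<lambda>p. (\<lambda>(z, w). g z w) (fst (fst p), snd p))"
      by (rule continuous_on_compose2[OF cg]) (use r in \<open>auto simp: U_def W_def intro!: continuous_intros\<close>)
    then show "continuous_on (W \<times> sphere w0 r) (\<lambda>(x, u). g (fst x) u * (1 / (u - snd x)))"
      by (auto simp: case_prod_unfold W_def intro!: continuous_intros)
  qed (use r in simp)
  have cG: "continuous_on W (\<lambda>(z, w). G z w)"
    unfolding G_def using c by (auto simp: case_prod_unfold intro!: continuous_intros)
  have hz: "(\<lambda>z. G z w) holomorphic_on ball z0 r" if "w \<in> ball w0 r" for w
    unfolding G_def
    by (intro holomorphic_intros holomorphic_on_Cauchy_fst[of U])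
       (use g sub r that in \<open>auto simp: U_def intro!: continuous_intros\<close>)
  have hw: "G z holomorphic_on ball w0 r" if "z \<in> ball z0 r" for z
    unfolding G_def
  proof (intro holomorphic_intros
      holomorphic_on_contour_integral_circlepath[where k' = "\<lambda>w u. g z u * (1 / (u - w)^2)"])
    have "continuous_on (ball w0 r \<times> sphere w0 r) (\<lambda>p. (\<lambda>(z, w). g z w) (z, snd p))"
      by (rule continuous_on_compose2[OF cg]) (use r that in \<open>auto simp: U_def intro!: continuous_intros\<close>)
    then show "continuous_on (ball w0 r \<times> sphere w0 r) (\<lambda>(x, u). g z u * (1 / (u - x)))"
      "continuous_on (ball w0 r \<times> sphere w0 r) (\<lambda>(x, u). g z u * (1 / (u - x)^2))"
      by (auto simp: case_prod_unfold intro!: continuous_intros)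
    fix x u assume "x \<in> ball w0 r" "u \<in> sphere w0 r"
    then have "u \<noteq> x" by auto
    then show "((\<lambda>x. g z u * (1 / (u - x))) has_field_derivative g z u * (1 / (u - x)^2)) (at x)"
      by (auto intro!: derivative_eq_intros simp: power2_eq_square)
  qed (use r in auto)
  have hol: "hol2 W G"
    unfolding hol2_def
  proof (intro conjI allI impI)
    show "open W" by (simp add: W_def open_Times)
    fix z w assume "(z, w) \<in> W"
    then have "z \<in> ball z0 r" "w \<in> ball w0 r" by (auto simp: W_def)
    then show "(\<lambda>z. G z w) field_differentiable at z" "G z field_differentiable at w"
      using hz hw open_ball holomorphic_on_imp_differentiable_at by blast+
  qed (rule cG)
  have eq1: "G z w = g z w" if "z \<in> ball z0 r" "w \<in> ball w0 r" "z \<noteq> z0" for z w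
  proof -
    have "g z holomorphic_on cball w0 r"
      by (rule hol2_holomorphic_snd[OF g]) (use r that in auto)
    then have "((\<lambda>u. g z u / (u - w)) has_contour_integral (2 * of_real pi * \<i> * g z w)) (circlepath w0 r)"
      using that by (intro Cauchy_integral_circlepath_simple) (auto simp: dist_norm norm_minus_commute)
    then show ?thesis by (simp add: G_def contour_integral_unique)
  qed
  \<comment> \<open>For \<open>z = z0\<close> the disc bounded by the circle contains the puncture
    and Cauchy's formula fails; the equality passes to the limit from
    \<open>z \<noteq> z0\<close>.\<close>
  have eq2: "G z0 w = g z0 w" if w: "w \<in> ball w0 r" "w \<noteq> w0" for w
  proof -
    have "isCont (\<lambda>z. G z w) z0"
      using holomorphic_on_imp_differentiable_at[OF hz[OF w(1)]] r
      by (intro field_differentiable_imp_continuous_at) simp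
    then have 1: "((\<lambda>z. G z w) \<longlongrightarrow> G z0 w) (at z0)" by (simp add: isCont_def)
    have "(\<lambda>z. g z w) field_differentiable at z0"
      using g r w by (auto simp: hol2_def)
    then have "isCont (\<lambda>z. g z w) z0" by (rule field_differentiable_imp_continuous_at)
    then have "((\<lambda>z. g z w) \<longlongrightarrow> g z0 w) (at z0)" by (simp add: isCont_def)
    moreover have "\<forall>\<^sub>F z in at z0. g z w = G z w"
      using eq1 w r unfolding eventually_at by (intro exI[of _ r]) (auto simp: dist_commute)
    ultimately have "((\<lambda>z. G z w) \<longlongrightarrow> g z0 w) (at z0)" by (rule Lim_transform_eventually)
    from LIM_unique[OF 1 this] show ?thesis .
  qed
  show ?thesis
  proof (rule that[of G])
    show "hol2 (ball z0 r \<times> ball w0 r) G" using hol by (simp add: W_def)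
    show "G z w = g z w" if "(z, w) \<in> ball z0 r \<times> ball w0 r - {(z0, w0)}" for z w
      using that eq1[of z w] eq2[of w] by (cases "z = z0") auto
  qed
qed

section \<open>Isolated common zeros of two holomorphic functions\<close>

lemma hol2_mult: "hol2 U f \<Longrightarrow> hol2 U g \<Longrightarrow> hol2 U (\<lambda>z w. f z w * g z w)"
  by (auto simp: hol2_def case_prod_unfold intro!: continuous_intros derivative_intros)

lemma hol2_divide:
  "hol2 U f \<Longrightarrow> hol2 U g \<Longrightarrow> (\<And>z w. (z, w) \<in> U \<Longrightarrow> g z w \<noteq> 0) \<Longrightarrow> hol2 U (\<lambda>z w. f z w / g z w)"
  by (auto simp: hol2_def case_prod_unfold intro!: continuous_intros derivative_intros)

lemma hol2_const: "open U \<Longrightarrow> hol2 U (\<lambda>z w. c)"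
  by (auto simp: hol2_def case_prod_unfold)

lemma hol2_diff: "hol2 U f \<Longrightarrow> hol2 U g \<Longrightarrow> hol2 U (\<lambda>z w. f z w - g z w)"
  by (auto simp: hol2_def case_prod_unfold intro!: continuous_intros derivative_intros)

lemma open_nonzero_hol2:
  assumes "hol2 U F"
  shows "open {p \<in> U. F (fst p) (snd p) \<noteq> 0}"
proof -
  have "open (U \<inter> (\<lambda>(z, w). F z w) -` (- {0}))"
    using assms by (intro continuous_open_preimage) (auto simp: hol2_def)
  also have "U \<inter> (\<lambda>(z, w). F z w) -` (- {0}) = {p \<in> U. F (fst p) (snd p) \<noteq> 0}" by auto
  finally show ?thesis .
qed

text \<open>The argument principle with a weight \<open>H\<close>. Applied fibrewise it turns sums
  over the zeros of \<open>F\<close>, with multiplicity, into integrals that depend holomorphically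
  on a parameter.\<close>

lemma contour_integral_weighted_zeros:
  assumes F: "F holomorphic_on ball c R" and H: "H holomorphic_on ball c R" and s: "0 < s" "s < R"
    and nz: "\<And>w. w \<in> sphere c s \<Longrightarrow> F w \<noteq> 0"
  shows "finite {w \<in> ball c s. F w = 0}"
    and "contour_integral (circlepath c s) (\<lambda>u. deriv F u * H u / F u) =
       2 * pi * \<i> * (\<Sum>w\<in>{w \<in> ball c s. F w = 0}. H w * of_int (zorder F w))"
proof -
  \<comment> \<open>An intermediate radius: the closed disc of radius \<open>t\<close> is compact in
    the domain, so its zeros are finite in number, and its interior contains the circle of radius
    \<open>s\<close>.\<close>
  define t where "t = (s + R) / 2"
  have t: "s < t" "t < R" using s by (auto simp: t_def)
  have cs: "c + s \<in> sphere c s" "c + s \<in> ball c R" using s by (auto simp: dist_norm)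
  have fin: "finite {w \<in> cball c t. F w = 0}"
  proof (cases "F constant_on ball c R")
    case True
    then have "F w \<noteq> 0" if "w \<in> cball c t" for w
      using nz[OF cs(1)] cs(2) t that unfolding constant_on_def by (metis mem_ball mem_cball le_less_trans)
    then show ?thesis by (simp add: conj_commute cong: conj_cong)
  next
    case False
    show ?thesis
      by (rule holomorphic_compact_finite_zeros[OF F _ _ _ _ False]) (use t in auto)
  qed
  then show fin': "finite {w \<in> ball c s. F w = 0}"
    by (rule rev_finite_subset) (use t in auto)
  have fin'': "finite {w \<in> ball c t. F w = 0}"
    by (rule finite_subset[OF _ fin]) auto
  have "contour_integral (circlepath c s) (\<lambda>u. deriv F u * H u / F u) =
     2 * pi * \<i> * (\<Sum>p\<in>{w \<in> ball c t. F w = 0 \<or> w \<in> {}}. winding_number (circlepath c s) p * H p * of_int (zorder F p))"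
  proof (rule argument_principle)
    show "path_image (circlepath c s) \<subseteq> ball c t - {w \<in> ball c t. F w = 0 \<or> w \<in> {}}"
      using t s nz by auto
    show "\<forall>z. z \<notin> ball c t \<longrightarrow> winding_number (circlepath c s) z = 0"
      using t s by (auto intro!: winding_number_zero_outside[of _ "cball c s"])
    show "finite {w \<in> ball c t. F w = 0 \<or> w \<in> {}}" using fin'' by simp
  qed (use t F H in \<open>auto intro: holomorphic_on_subset\<close>)
  also have "(\<Sum>p\<in>{w \<in> ball c t. F w = 0 \<or> w \<in> {}}. winding_number (circlepath c s) p * H p * of_int (zorder F p)) =
      (\<Sum>p\<in>{w \<in> ball c s. F w = 0}. winding_number (circlepath c s) p * H p * of_int (zorder F p))"
  proof (rule sum.mono_neutral_right)
    show "\<forall>p\<in>{w \<in> ball c t. F w = 0 \<or> w \<in> {}} - {w \<in> ball c s. F w = 0}.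
       winding_number (circlepath c s) p * H p * of_int (zorder F p) = 0"
    proof
      fix p assume p: "p \<in> {w \<in> ball c t. F w = 0 \<or> w \<in> {}} - {w \<in> ball c s. F w = 0}"
      then have "p \<notin> cball c s" using nz[of p] by auto
      then have "winding_number (circlepath c s) p = 0"
        using s by (auto intro!: winding_number_zero_outside[of _ "cball c s"])
      then show "winding_number (circlepath c s) p * H p * of_int (zorder F p) = 0" by simp
    qed
  qed (use t fin'' in auto)
  also have "\<dots> = (\<Sum>w\<in>{w \<in> ball c s. F w = 0}. H w * of_int (zorder F w))"
    by (rule sum.cong) (auto simp: winding_number_circlepath dist_norm norm_minus_commute)
  finally show "contour_integral (circlepath c s) (\<lambda>u. deriv F u * H u / F u) =
       2 * pi * \<i> * (\<Sum>w\<in>{w \<in> ball c s. F w = 0}. H w * of_int (zorder F w))" .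
qed

lemma zorder_ge_1:
  assumes "F holomorphic_on ball c R" "w \<in> ball c R" "F w = 0" "v \<in> ball c R" "F v \<noteq> 0"
  shows "zorder F w \<ge> 1"
proof -
  have "F analytic_on {w}" using assms(1,2) by (meson analytic_at holomorphic_on_subset open_ball)
  moreover have "\<exists>\<^sub>F w in at w. F w \<noteq> 0"
  proof -
    obtain r where r: "0 < r" "\<And>z. z \<in> ball w r - {w} \<Longrightarrow> F z \<noteq> 0"
      using isolated_zeros[OF assms(1) open_ball connected_ball assms(2,3,4,5)] by metis
    then have "\<forall>\<^sub>F z in at w. F z \<noteq> 0"
      unfolding eventually_at by (intro exI[of _ r]) (auto simp: dist_commute)
    then show ?thesis by (rule eventually_frequently[rotated]) simp
  qed
  ultimately have "zorder F w > 0" using assms(3) zorder_pos_iff'[of F w] by blast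
  then show ?thesis by simp
qed

lemma open_tube_sphere:
  fixes K :: "complex set"
  assumes W: "open W" and K: "compact K" and sub: "{z0} \<times> K \<subseteq> W"
  obtains r where "r > 0" "ball z0 r \<times> K \<subseteq> W"
proof -
  obtain A where A: "open A" "z0 \<in> A" "A \<times> K \<subseteq> W"
    using Elementary_Topology.tube_lemma[OF K W sub] by blast
  obtain r where "r > 0" "ball z0 r \<subseteq> A" using A open_contains_ball by blast
  then show ?thesis using that[of r] A(3) by blast
qed

text \<open>Near a point of the curve \<open>F = 0\<close> at which \<open>|G| + \<epsilon>|z|\<^sup>2\<close> is maximal on the curve, the sum of \<open>G\<close>
  over the branches is a holomorphic function of \<open>z\<close> to which the maximum principle applies.\<close>

lemma curve_no_interior_max:
  assumes F: "hol2 (ball 0 R \<times> ball 0 R) F" and zw: "z0 \<in> ball 0 R" "w0 \<in> ball 0 R" "F z0 w0 = 0"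
    and nz: "w1 \<in> ball 0 R" "F z0 w1 \<noteq> 0"
    and G: "hol2 V G" "(z0, w0) \<in> V" and V': "open V'" "(z0, w0) \<in> V'" and \<epsilon>: "\<epsilon> > 0"
    and max: "\<And>z w. (z, w) \<in> V' \<Longrightarrow> (z, w) \<in> V \<Longrightarrow> F z w = 0 \<Longrightarrow>
        cmod (G z w) + \<epsilon> * (cmod z)\<^sup>2 \<le> cmod (G z0 w0) + \<epsilon> * (cmod z0)\<^sup>2"
  shows False
proof -
  define B :: "(complex \<times> complex) set" where "B = ball 0 R \<times> ball 0 R"
  define W where "W = V \<inter> V' \<inter> B"
  have oV: "open V" using G by (simp add: hol2_def)
  have oW: "open W" unfolding W_def B_def using oV V' by (auto intro!: open_Times)
  have FW: "hol2 W F" and GW: "hol2 W G"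
    using hol2_subset[OF F oW] hol2_subset[OF G(1) oW] by (auto simp: W_def B_def)
  have "(z0, w0) \<in> W" using zw G V' by (auto simp: W_def B_def)
  with oW obtain a where a: "a > 0" "cball z0 a \<times> cball w0 a \<subseteq> W" by (rule open_prod_cball)
  have Fz0: "F z0 holomorphic_on ball 0 R"
    by (rule hol2_holomorphic_snd[OF F]) (use zw in auto)
  obtain b where b: "b > 0" "\<And>w. w \<in> ball w0 b - {w0} \<Longrightarrow> F z0 w \<noteq> 0"
    using isolated_zeros[OF Fz0 open_ball connected_ball zw(2,3) nz] by metis
  define s where "s = min a b / 2"
  have s: "0 < s" "s < a" "s < b" using a b by (auto simp: s_def)
  define W' where "W' = {p \<in> W. F (fst p) (snd p) \<noteq> 0}"
  have oW': "open W'" unfolding W'_def by (rule open_nonzero_hol2[OF FW])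
  \<comment> \<open>The branches cannot leave the disc around \<open>w0\<close> through its
    boundary, for \<open>z\<close> near \<open>z0\<close> by the tube lemma. Hence their number,
    with multiplicity, will be constant.\<close>
  have "{z0} \<times> sphere w0 s \<subseteq> W'"
    using a s b(2) by (auto simp: W'_def)
  with oW' obtain r0 where r0: "r0 > 0" "ball z0 r0 \<times> sphere w0 s \<subseteq> W'"
    using open_tube_sphere by (metis compact_sphere)
  define r where "r = min a r0"
  have r: "r > 0" "r \<le> a" "ball z0 r \<times> sphere w0 s \<subseteq> W'" using r0 a by (auto simp: r_def)
  have sub: "(z, w) \<in> W" if "z \<in> ball z0 r" "w \<in> ball w0 a" for z w using that a r by auto
  define Z where "Z z = {w \<in> ball w0 s. F z w = 0}" for z
  \<comment> \<open>The sum of \<open>H\<close> over the branches above \<open>z\<close>. The factor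
    1 is the weight \<open>q\<close> of \<open>holomorphic_on_Cauchy_fst\<close>.\<close>
  define S where "S H z = contour_integral (circlepath w0 s) (\<lambda>u. deriv (F z) u * H z u / F z u * 1) / (2 * pi * \<i>)"
    for H :: "complex \<Rightarrow> complex \<Rightarrow> complex" and z
  have Seq: "S H z = (\<Sum>w\<in>Z z. H z w * of_int (zorder (F z) w))" and finZ: "finite (Z z)"
    if H: "hol2 W H" and z: "z \<in> ball z0 r" for H z
  proof -
    have 1: "F z holomorphic_on ball w0 a" "H z holomorphic_on ball w0 a"
      by (rule hol2_holomorphic_snd[OF FW], use sub z in simp, rule hol2_holomorphic_snd[OF H], use sub z in simp)
    have 2: "F z w \<noteq> 0" if "w \<in> sphere w0 s" for w
    proof -
      have "(z, w) \<in> W'" using r(3) z that by blast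
      then show ?thesis by (simp add: W'_def)
    qed
    show "S H z = (\<Sum>w\<in>Z z. H z w * of_int (zorder (F z) w))" "finite (Z z)"
      using contour_integral_weighted_zeros[OF 1 s(1,2) 2] by (simp_all add: S_def Z_def)
  qed
  have Shol: "S H holomorphic_on ball z0 r" if H: "hol2 W H" for H
    unfolding S_def
  proof (intro holomorphic_intros holomorphic_on_Cauchy_fst[of W'])
    have "hol2 W' (\<lambda>z u. deriv (F z) u * H z u)"
      by (rule hol2_subset[OF hol2_mult[OF hol2_deriv_snd[OF FW] H] oW']) (auto simp: W'_def)
    then show "hol2 W' (\<lambda>z u. deriv (F z) u * H z u / F z u)"
      by (rule hol2_divide[OF _ hol2_subset[OF FW oW']]) (auto simp: W'_def)
  qed (use r s in auto)
  define N where "N = S (\<lambda>z w. 1)"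
  have Nhol: "N holomorphic_on ball z0 r" unfolding N_def by (rule Shol) (simp add: hol2_const oW)
  have Neq: "N z = of_int (\<Sum>w\<in>Z z. zorder (F z) w)" if "z \<in> ball z0 r" for z
    unfolding N_def by (subst Seq) (use oW that in \<open>auto simp: hol2_const\<close>)
  \<comment> \<open>\<open>N\<close> counts the branches; it is continuous and integer valued, so
    two different values are at least 1 apart.\<close>
  have "N constant_on ball z0 r"
  proof (rule continuous_discrete_range_constant)
    show "\<exists>e>0. \<forall>y. y \<in> ball z0 r \<and> N y \<noteq> N x \<longrightarrow> e \<le> norm (N y - N x)" if "x \<in> ball z0 r" for x
    proof (intro exI[of _ 1] conjI allI impI)
      fix y assume y: "y \<in> ball z0 r \<and> N y \<noteq> N x"
      define m n where "m = (\<Sum>w\<in>Z x. zorder (F x) w)" and "n = (\<Sum>w\<in>Z y. zorder (F y) w)"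
      have mn: "N x = of_int m" "N y = of_int n" using that y Neq by (auto simp: m_def n_def)
      with y have "m \<noteq> n" by auto
      then have "1 \<le> \<bar>real_of_int (n - m)\<bar>" by linarith
      also have "\<dots> = norm (complex_of_int (n - m))" by (rule norm_of_int[symmetric])
      finally show "1 \<le> norm (N y - N x)" by (simp add: mn)
    qed simp
  qed (use Nhol in \<open>auto intro: holomorphic_on_imp_continuous_on\<close>)
  then obtain N0 where N0: "\<And>z. z \<in> ball z0 r \<Longrightarrow> N z = N0" by (auto simp: constant_on_def)
  define n where "n = (\<Sum>w\<in>Z z0. zorder (F z0) w)"
  have z0r: "z0 \<in> ball z0 r" using r by simp
  have N0n: "N0 = of_int n" using Neq[OF z0r] N0[OF z0r] by (simp add: n_def)
  have "F z0 w \<noteq> 0" if "w \<in> ball w0 s" "w \<noteq> w0" for w using b(2)[of w] that s by auto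
  then have Zz0: "Z z0 = {w0}" using s zw(3) by (auto simp: Z_def)
  have n1: "n \<ge> 1"
    using zorder_ge_1[OF Fz0 zw(2,3) nz] by (simp add: n_def Zz0)
  have SG: "S G z0 = of_int n * G z0 w0" by (subst Seq[OF GW z0r]) (simp add: Zz0 n_def)
  \<comment> \<open>The phase that turns \<open>G z0 w0\<close> into its modulus. It is 0 if
    \<open>G z0 w0\<close> is 0, hence only \<open>cmod c \<le> 1\<close> is claimed.\<close>
  define c where "c = cnj (sgn (G z0 w0))"
  have c: "cmod c \<le> 1" "c * G z0 w0 = cmod (G z0 w0)"
  proof -
    show "cmod c \<le> 1" by (simp add: c_def norm_sgn)
    show "c * G z0 w0 = cmod (G z0 w0)"
    proof (cases "G z0 w0 = 0")
      case False
      have "c * G z0 w0 = of_real ((cmod (G z0 w0))\<^sup>2) / of_real (cmod (G z0 w0))"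
        unfolding complex_norm_square by (simp add: c_def sgn_eq mult.commute)
      also have "\<dots> = of_real ((cmod (G z0 w0))\<^sup>2 / cmod (G z0 w0))" by (rule of_real_divide[symmetric])
      finally show ?thesis using False by (simp add: power2_eq_square)
    qed (simp add: c_def)
  qed
  \<comment> \<open>The last summand has as real part \<open>n\<close> times the linear part of
    \<open>\<epsilon> * |z|^2\<close> at \<open>z0\<close>. It cancels that part in the maximality
    assumption and leaves \<open>- \<epsilon> * |z - z0|^2\<close>, so \<open>Re T\<close> has a
    strict maximum at \<open>z0\<close>.\<close>
  define T where "T z = c * S G z + 2 * \<epsilon> * cnj z0 * (z - z0) * of_int n" for z
  have ReT: "Re (T z) \<le> n * (cmod (G z0 w0) - \<epsilon> * (cmod (z - z0))\<^sup>2)" if z: "z \<in> ball z0 r" for z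
  proof -
    have nz: "(\<Sum>w\<in>Z z. zorder (F z) w) = n"
      using N0[OF z] Neq[OF z] N0n by (metis of_int_eq_iff)
    let ?M = "cmod (G z0 w0) + \<epsilon> * (cmod z0)\<^sup>2 - \<epsilon> * (cmod z)\<^sup>2"
    have "Re (c * S G z) \<le> cmod (c * S G z)" by (rule complex_Re_le_cmod)
    also have "\<dots> \<le> cmod (S G z)" using c by (simp add: norm_mult mult_left_le_one_le)
    also have "\<dots> \<le> (\<Sum>w\<in>Z z. cmod (G z w * of_int (zorder (F z) w)))"
      unfolding Seq[OF GW z] by (rule norm_sum)
    also have "\<dots> \<le> (\<Sum>w\<in>Z z. ?M * zorder (F z) w)"
    proof (rule sum_mono)
      fix w assume w: "w \<in> Z z"
      then have "w \<in> ball w0 a" "F z w = 0" using s by (auto simp: Z_def)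
      then have W: "(z, w) \<in> W" using sub z by auto
      then have "cmod (G z w) \<le> ?M" using max[of z w] \<open>F z w = 0\<close> by (auto simp: W_def)
      moreover have "zorder (F z) w \<ge> 1"
      proof (rule zorder_ge_1)
        show "F z holomorphic_on ball w0 a"
          by (rule hol2_holomorphic_snd[OF FW]) (use sub z in auto)
        show "w0 + s \<in> ball w0 a" using s by (simp add: dist_norm)
        have "(z, w0 + s) \<in> ball z0 r \<times> sphere w0 s" using z s by (simp add: dist_norm)
        then have "(z, w0 + s) \<in> W'" using r(3) by blast
        then show "F z (w0 + s) \<noteq> 0" by (simp add: W'_def)
      qed (use w s in \<open>auto simp: Z_def\<close>)
      ultimately show "cmod (G z w * of_int (zorder (F z) w)) \<le> ?M * zorder (F z) w"
        by (simp add: norm_mult mult_right_mono)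
    qed
    also have "\<dots> = ?M * n" by (simp add: nz[symmetric] sum_distrib_left)
    finally have 1: "Re (c * S G z) \<le> ?M * n" .
    have "(cmod z)\<^sup>2 = (cmod z0)\<^sup>2 + 2 * Re (cnj z0 * (z - z0)) + (cmod (z - z0))\<^sup>2"
      unfolding cmod_power2 by (simp add: algebra_simps power2_eq_square)
    then have 2: "?M + 2 * \<epsilon> * Re (cnj z0 * (z - z0)) = cmod (G z0 w0) - \<epsilon> * (cmod (z - z0))\<^sup>2"
      by (simp only:) (simp only: distrib_left)
    have "Re (2 * \<epsilon> * cnj z0 * (z - z0) * n) = (2 * \<epsilon> * n) * Re (cnj z0 * (z - z0))"
      by (simp add: algebra_simps)
    then have "Re (T z) = Re (c * S G z) + (2 * \<epsilon> * n) * Re (cnj z0 * (z - z0))"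
      unfolding T_def by (simp only: plus_complex.sel)
    also have "\<dots> \<le> (?M + 2 * \<epsilon> * Re (cnj z0 * (z - z0))) * n" using 1 by (simp add: algebra_simps)
    finally show ?thesis unfolding 2 by (simp add: mult.commute)
  qed
  have Tz0: "T z0 = of_int n * of_real (cmod (G z0 w0))" using c(2) by (simp add: T_def SG mult.left_commute)
  have Thol: "(\<lambda>z. exp (T z)) holomorphic_on ball z0 r"
    unfolding T_def by (intro holomorphic_intros Shol GW)
  have le: "Re (T z) \<le> Re (T z0)" if "z \<in> ball z0 r" for z
  proof -
    have "0 \<le> n * (\<epsilon> * (cmod (z - z0))\<^sup>2)" using n1 \<epsilon> by simp
    then show ?thesis using ReT[OF that] by (simp add: Tz0 algebra_simps)
  qed
  \<comment> \<open>The modulus of \<open>exp (T z)\<close> is \<open>exp (Re (T z))\<close>, so the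
    maximum modulus principle speaks about \<open>Re T\<close>; the strictness of the maximum is
    then contradicted at \<open>z1\<close>.\<close>
  have "(\<lambda>z. exp (T z)) constant_on ball z0 r"
    by (rule maximum_modulus_principle[OF Thol open_ball connected_ball open_ball subset_refl z0r])
       (use le in simp)
  then obtain k where k: "\<And>z. z \<in> ball z0 r \<Longrightarrow> exp (T z) = k" by (auto simp: constant_on_def)
  define z1 where "z1 = z0 + r / 2"
  have z1: "z1 \<in> ball z0 r" using r by (simp add: z1_def dist_norm)
  have "exp (Re (T z1)) = exp (Re (T z0))" using k[OF z1] k[OF z0r] by (metis norm_exp_eq_Re)
  then have "Re (T z1) = n * cmod (G z0 w0)" by (simp add: Tz0)
  moreover have "0 < n * (\<epsilon> * (cmod (z1 - z0))\<^sup>2)" using n1 \<epsilon> r by (simp add: z1_def)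
  ultimately show False using ReT[OF z1] by (simp add: algebra_simps)
qed

text \<open>A maximum principle on the curve \<open>F = 0\<close>. By \<open>nz\<close> the curve
  does not reach \<open>|w| = s\<close>, so its boundary lies over \<open>|z| = r\<close>. A small
  multiple of \<open>|z|^2\<close> is added to \<open>|G|\<close>, and the maximum of the sum is
  taken over the compact piece of the curve.\<close>

lemma curve_max_on_boundary:
  assumes F: "hol2 (ball 0 R \<times> ball 0 R) F" and r: "r < R" and s: "0 < s" "s < R"
    and nz: "\<And>z w. z \<in> cball 0 r \<Longrightarrow> w \<in> sphere 0 s \<Longrightarrow> F z w \<noteq> 0"
    and G: "hol2 V G" and V: "\<And>z w. z \<in> cball 0 r \<Longrightarrow> w \<in> cball 0 s \<Longrightarrow> F z w = 0 \<Longrightarrow> (z, w) \<in> V"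
    and M: "\<And>z w. z \<in> sphere 0 r \<Longrightarrow> w \<in> cball 0 s \<Longrightarrow> F z w = 0 \<Longrightarrow> cmod (G z w) \<le> M"
    and zw: "z1 \<in> cball 0 r" "w1 \<in> cball 0 s" "F z1 w1 = 0"
  shows "cmod (G z1 w1) \<le> M"
proof (rule ccontr)
  assume "\<not> ?thesis"
  then have less: "M < cmod (G z1 w1)" by simp
  \<comment> \<open>Small enough that \<open>M + \<epsilon> * r^2\<close>, the largest value of the
    perturbed function over the boundary, stays below \<open>cmod (G z1 w1)\<close>; the summand 1
    keeps the denominator positive.\<close>
  define \<epsilon> where "\<epsilon> = (cmod (G z1 w1) - M) / (2 * (r\<^sup>2 + 1))"
  have \<epsilon>: "\<epsilon> > 0" using less by (auto simp: \<epsilon>_def intro!: divide_pos_pos add_nonneg_pos)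
  have "\<epsilon> * r\<^sup>2 < \<epsilon> * (2 * (r\<^sup>2 + 1))" using \<epsilon> by (intro mult_strict_left_mono) (auto intro: add_nonneg_pos)
  also have "\<dots> = cmod (G z1 w1) - M"
  proof -
    have "2 * (r\<^sup>2 + 1) > 0" by (auto intro: add_nonneg_pos)
    then show ?thesis by (simp add: \<epsilon>_def)
  qed
  finally have \<epsilon>r: "M + \<epsilon> * r\<^sup>2 < cmod (G z1 w1)" by simp
  define K where "K = (cball 0 r \<times> cball 0 s) \<inter> (\<lambda>(z, w). F z w) -` {0}"
  have sub: "cball 0 r \<times> cball 0 s \<subseteq> ball 0 R \<times> (ball 0 R :: complex set)" using r s by auto
  have "continuous_on (cball 0 r \<times> cball 0 s) (\<lambda>(z, w). F z w)"
    by (rule continuous_on_subset[OF _ sub]) (use F in \<open>simp add: hol2_def\<close>)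
  then have "closed K" unfolding K_def by (intro continuous_closed_preimage) (auto intro: closed_Times)
  then have "compact K"
    using compact_Int_closed[of "cball 0 r \<times> cball 0 s" K] by (simp add: K_def compact_Times Int_absorb1)
  moreover have KV: "K \<subseteq> V" using V by (auto simp: K_def)
  moreover have "(z1, w1) \<in> K" using zw by (simp add: K_def)
  moreover have "continuous_on K (\<lambda>p. cmod (G (fst p) (snd p)) + \<epsilon> * (cmod (fst p))\<^sup>2)"
    using continuous_on_subset[OF _ KV, of "\<lambda>(z, w). G z w"] G
    by (auto simp: hol2_def case_prod_unfold intro!: continuous_intros)
  ultimately have "\<exists>p\<in>K. \<forall>q\<in>K. cmod (G (fst q) (snd q)) + \<epsilon> * (cmod (fst q))\<^sup>2 \<le> cmod (G (fst p) (snd p)) + \<epsilon> * (cmod (fst p))\<^sup>2"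
    by (intro continuous_attains_sup) auto
  then obtain p where p: "p \<in> K"
    "\<And>q. q \<in> K \<Longrightarrow> cmod (G (fst q) (snd q)) + \<epsilon> * (cmod (fst q))\<^sup>2 \<le> cmod (G (fst p) (snd p)) + \<epsilon> * (cmod (fst p))\<^sup>2"
    by blast
  obtain z0 w0 where zw0: "p = (z0, w0)" by (cases p)
  have K0: "z0 \<in> cball 0 r" "w0 \<in> cball 0 s" "F z0 w0 = 0" using p(1) by (auto simp: K_def zw0)
  have big: "cmod (G z1 w1) \<le> cmod (G z0 w0) + \<epsilon> * (cmod z0)\<^sup>2"
  proof -
    have "0 \<le> \<epsilon> * (cmod z1)\<^sup>2" using \<epsilon> by simp
    then show ?thesis using p(2)[OF \<open>(z1, w1) \<in> K\<close>] by (simp add: zw0)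
  qed
  have z0: "cmod z0 < r"
  proof (rule ccontr)
    assume "\<not> ?thesis"
    then have "cmod z0 = r" using K0 by simp
    then have "cmod (G z0 w0) + \<epsilon> * (cmod z0)\<^sup>2 \<le> M + \<epsilon> * r\<^sup>2" using M[of z0 w0] K0 by simp
    then show False using big \<epsilon>r by simp
  qed
  have w0: "cmod w0 < s" using K0 nz[of z0 w0] by (cases "cmod w0 = s") auto
  show False
  proof (rule curve_no_interior_max[OF F, of z0 w0 "of_real s" V G "ball 0 r \<times> ball 0 s" \<epsilon>])
    show "F z0 (of_real s) \<noteq> 0" using nz[of z0 "of_real s"] K0 s by simp
    show "(z0, w0) \<in> V" using KV p zw0 by auto
    show "cmod (G z w) + \<epsilon> * (cmod z)\<^sup>2 \<le> cmod (G z0 w0) + \<epsilon> * (cmod z0)\<^sup>2"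
      if "(z, w) \<in> ball 0 r \<times> ball 0 s" "F z w = 0" for z w
      using p(2)[of "(z, w)"] that by (auto simp: K_def zw0)
  qed (use K0 r s z0 w0 G \<epsilon> in \<open>auto intro: open_Times\<close>)
qed


lemma hol2_continuous_snd:
  assumes "hol2 U F" "\<And>w. w \<in> S \<Longrightarrow> (z, w) \<in> U"
  shows "continuous_on S (F z)"
  using holomorphic_on_imp_continuous_on[OF hol2_holomorphic_snd[OF assms]] by simp

text \<open>If \<open>H\<close> and \<open>H2\<close> had no common zero, \<open>1 / H2\<close>
  would be holomorphic along the curve \<open>H = 0\<close>. Over \<open>|z| = r\<close> it is
  bounded by \<open>2 / b1\<close>, since \<open>F\<close> and \<open>F2\<close> are not both small
  there. But the curve has a point on the axis \<open>z = 0\<close> close to the origin, where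
  \<open>H2\<close> is too small for this bound, against the maximum principle.\<close>

lemma isolated_common_zero_stable_aux:
  assumes F: "hol2 (ball 0 R \<times> ball 0 R) F" and F2: "hol2 (ball 0 R \<times> ball 0 R) F2"
    and zero: "F 0 0 = 0" "F2 0 0 = 0"
    and isolated: "\<And>z w. z \<in> ball 0 R \<Longrightarrow> w \<in> ball 0 R \<Longrightarrow> F z w = 0 \<Longrightarrow> F2 z w = 0 \<Longrightarrow> z = 0 \<and> w = 0"
    and nz: "v \<in> ball 0 R" "F 0 v \<noteq> 0"
  obtains \<delta> t where "\<delta> > 0" "0 < t" "t < R"
    "\<And>H H2. hol2 (ball 0 R \<times> ball 0 R) H \<Longrightarrow> hol2 (ball 0 R \<times> ball 0 R) H2 \<Longrightarrow>
      (\<And>z w. z \<in> cball 0 t \<Longrightarrow> w \<in> cball 0 t \<Longrightarrow> cmod (H z w - F z w) < \<delta>) \<Longrightarrow>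
      (\<And>z w. z \<in> cball 0 t \<Longrightarrow> w \<in> cball 0 t \<Longrightarrow> cmod (H2 z w - F2 z w) < \<delta>) \<Longrightarrow>
      \<exists>z w. z \<in> cball 0 t \<and> w \<in> cball 0 t \<and> H z w = 0 \<and> H2 z w = 0"
proof -
  define B :: "(complex \<times> complex) set" where "B = ball 0 R \<times> ball 0 R"
  have oB: "open B" by (simp add: B_def open_Times)
  have R: "R > 0" using nz by (auto simp: order.strict_trans1[OF norm_ge_zero])
  have cF: "continuous_on B (\<lambda>(z, w). F z w)" and cF2: "continuous_on B (\<lambda>(z, w). F2 z w)"
    using F F2 by (auto simp: hol2_def B_def)
  have zero_R: "(0 :: complex) \<in> ball 0 R" using R by simp
  have hF0: "F 0 holomorphic_on ball 0 R" by (rule hol2_holomorphic_snd[OF F]) (use R in auto)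
  obtain b where b: "b > 0" "\<And>w. w \<in> ball 0 b - {0} \<Longrightarrow> F 0 w \<noteq> 0"
    using isolated_zeros[OF hF0 open_ball connected_ball zero_R zero(1) nz] by metis
  define s where "s = min b R / 2"
  have s: "0 < s" "s < b" "s < R" using b R by (auto simp: s_def)
  define W where "W = {p \<in> B. F (fst p) (snd p) \<noteq> 0}"
  have oW: "open W" unfolding W_def by (rule open_nonzero_hol2) (use F in \<open>simp add: B_def\<close>)
  have "{0} \<times> sphere 0 s \<subseteq> W" using s b(2) R by (auto simp: W_def B_def)
  with oW obtain r0 where r0: "r0 > 0" "ball 0 r0 \<times> sphere 0 s \<subseteq> W"
    using open_tube_sphere by (metis compact_sphere)
  define r where "r = min r0 R / 2"
  have r: "0 < r" "r < R" "r < r0" using r0 R by (auto simp: r_def)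
  have nzW: "F z w \<noteq> 0" if "z \<in> cball 0 r" "w \<in> sphere 0 s" for z w
  proof -
    have "(z, w) \<in> W" using that r r0(2) by (intro subsetD[OF r0(2)]) auto
    then show ?thesis by (simp add: W_def)
  qed
  have lower: "\<exists>a>0. \<forall>p\<in>K. a \<le> f p"
    if K: "compact K" "continuous_on K f" "\<And>p. p \<in> K \<Longrightarrow> f p > 0" for K :: "(complex \<times> complex) set" and f :: "_ \<Rightarrow> real"
  proof (cases "K = {}")
    case False
    then obtain p where "p \<in> K" "\<forall>q\<in>K. f p \<le> f q" using continuous_attains_inf[OF K(1) False K(2)] by blast
    then show ?thesis using K(3) by (intro exI[of _ "f p"]) auto
  qed (auto intro: exI[of _ 1])
  have sub1: "cball 0 r \<times> sphere 0 s \<subseteq> B" and sub2: "sphere 0 r \<times> cball 0 s \<subseteq> B" using r s by (auto simp: B_def)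
  have "\<exists>a>0. \<forall>p\<in>cball 0 r \<times> sphere 0 s. a \<le> cmod (F (fst p) (snd p))"
  proof (rule lower)
    show "continuous_on (cball 0 r \<times> sphere 0 s) (\<lambda>p. cmod (F (fst p) (snd p)))"
      using continuous_on_subset[OF cF sub1] by (simp add: case_prod_unfold continuous_on_norm)
    show "0 < cmod (F (fst p) (snd p))" if "p \<in> cball 0 r \<times> sphere 0 s" for p
      using nzW[of "fst p" "snd p"] that by (auto simp: mem_Times_iff)
  qed (simp add: compact_Times)
  then obtain a where a: "a > 0" "\<And>z w. z \<in> cball 0 r \<Longrightarrow> w \<in> sphere 0 s \<Longrightarrow> a \<le> cmod (F z w)" by fastforce
  have "\<exists>a>0. \<forall>p\<in>sphere 0 r \<times> cball 0 s. a \<le> cmod (F (fst p) (snd p)) + cmod (F2 (fst p) (snd p))"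
  proof (rule lower)
    fix p :: "complex \<times> complex" assume p: "p \<in> sphere 0 r \<times> cball 0 s"
    then have "fst p \<in> ball 0 R" "snd p \<in> ball 0 R" "fst p \<noteq> 0" using r s by auto
    then have "F (fst p) (snd p) \<noteq> 0 \<or> F2 (fst p) (snd p) \<noteq> 0" using isolated by blast
    then show "0 < cmod (F (fst p) (snd p)) + cmod (F2 (fst p) (snd p))"
      by (auto intro: add_pos_nonneg add_nonneg_pos)
  next
    show "continuous_on (sphere 0 r \<times> cball 0 s) (\<lambda>p. cmod (F (fst p) (snd p)) + cmod (F2 (fst p) (snd p)))"
      using continuous_on_subset[OF cF sub2] continuous_on_subset[OF cF2 sub2]
      by (simp add: case_prod_unfold continuous_on_norm continuous_on_add)
  qed (simp add: compact_Times)
  then obtain b1 where b1: "b1 > 0"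
    "\<And>z w. z \<in> sphere 0 r \<Longrightarrow> w \<in> cball 0 s \<Longrightarrow> b1 \<le> cmod (F z w) + cmod (F2 z w)" by fastforce
  have "continuous_on (ball 0 R) (F2 0)" by (rule hol2_continuous_snd[OF F2]) (use R in auto)
  then have "isCont (F2 0) 0" using R by (simp add: continuous_on_eq_continuous_at)
  then have "\<forall>\<^sub>F w in at 0. dist (F2 0 w) (F2 0 0) < b1 / 8"
    unfolding isCont_def by (rule tendstoD) (use b1 in simp)
  then obtain d where d: "d > 0" "\<And>w. w \<noteq> 0 \<Longrightarrow> dist w 0 < d \<Longrightarrow> dist (F2 0 w) (F2 0 0) < b1 / 8"
    unfolding eventually_at by auto
  \<comment> \<open>In this smaller disc on the axis \<open>F2\<close> stays below
    \<open>b1 / 8\<close>; the point of the curve \<open>H = 0\<close> will be sought here.\<close>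
  define s' where "s' = min d s / 2"
  have s': "0 < s'" "s' < d" "s' < s" using d s by (auto simp: s'_def)
  have F2small: "cmod (F2 0 w) < b1 / 8" if "w \<in> ball 0 s'" for w
    using d(2)[of w] that s' zero(2) b1 by (cases "w = 0") auto
  have c0: "continuous_on (sphere 0 s') (F 0)" by (rule hol2_continuous_snd[OF F]) (use s s' R in auto)
  have "\<exists>a>0. \<forall>p\<in>{0 :: complex} \<times> sphere 0 s'. a \<le> cmod (F 0 (snd p))"
  proof (rule lower)
    show "continuous_on ({0} \<times> sphere 0 s') (\<lambda>p. cmod (F 0 (snd p)))"
      by (intro continuous_intros continuous_on_compose2[OF c0]) auto
  qed (use b(2) s s' in \<open>auto simp: compact_Times\<close>)
  then obtain a' where a': "a' > 0" "\<And>w. w \<in> sphere 0 s' \<Longrightarrow> a' \<le> cmod (F 0 w)" by fastforce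
  \<comment> \<open>\<open>a / 2\<close> keeps \<open>H\<close> free of zeros on
    \<open>|w| = s\<close>; \<open>b1 / 4\<close> gives \<open>|H2| \<ge> b1 / 2\<close> on the
    curve over \<open>|z| = r\<close> and \<open>|H2| < b1 / 2\<close> near the origin of the axis;
    \<open>a' / 2\<close> forces a zero of \<open>H 0\<close> in the disc of radius
    \<open>s'\<close>.\<close>
  define \<delta> where "\<delta> = Min {a / 2, b1 / 4, a' / 2}"
  have \<delta>: "\<delta> > 0" "\<delta> \<le> a / 2" "\<delta> \<le> b1 / 4" "\<delta> \<le> a' / 2" using a a' b1 by (auto simp: \<delta>_def)
  define t where "t = max r s"
  have t: "0 < t" "t < R" "r \<le> t" "s \<le> t" using r s by (auto simp: t_def)
  show ?thesis
  proof (rule that[OF \<delta>(1) t(1,2)], rule ccontr)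
    fix H H2
    assume H: "hol2 (ball 0 R \<times> ball 0 R) H" and H2: "hol2 (ball 0 R \<times> ball 0 R) H2"
      and near: "\<And>z w. z \<in> cball 0 t \<Longrightarrow> w \<in> cball 0 t \<Longrightarrow> cmod (H z w - F z w) < \<delta>"
      and near2: "\<And>z w. z \<in> cball 0 t \<Longrightarrow> w \<in> cball 0 t \<Longrightarrow> cmod (H2 z w - F2 z w) < \<delta>"
      and none: "\<not> (\<exists>z w. z \<in> cball 0 t \<and> w \<in> cball 0 t \<and> H z w = 0 \<and> H2 z w = 0)"
    have 1: "cmod (H z w) > cmod (F z w) - \<delta>" "cmod (F z w) > cmod (H z w) - \<delta>"
      "cmod (H2 z w) > cmod (F2 z w) - \<delta>" "cmod (F2 z w) > cmod (H2 z w) - \<delta>"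
      if "z \<in> cball 0 t" "w \<in> cball 0 t" for z w
      using near[OF that] near2[OF that] norm_triangle_ineq2[of "F z w" "H z w"] norm_triangle_ineq2[of "H z w" "F z w"]
        norm_triangle_ineq2[of "F2 z w" "H2 z w"] norm_triangle_ineq2[of "H2 z w" "F2 z w"]
      by (auto simp: norm_minus_commute)
    \<comment> \<open>The modulus of \<open>H 0\<close> is smaller at the centre than on the circle,
      so it must vanish in between.\<close>
    have "\<exists>w\<in>ball 0 s'. H 0 w = 0"
    proof -
      have hH: "H 0 holomorphic_on cball 0 s'" by (rule hol2_holomorphic_snd[OF H]) (use s s' R in auto)
      have "cmod (H 0 0) < cmod (H 0 w)" if "cmod (0 - w) = s'" for w
        using 1(2)[of 0 0] 1(1)[of 0 w] a'(2)[of w] \<delta> t s' that zero near[of 0 0] by auto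
      then show ?thesis
        using holomorphic_contract_to_zero[of 0 s' "H 0"] hH s'
        by (metis holomorphic_on_imp_continuous_on holomorphic_on_subset ball_subset_cball)
    qed
    then obtain w0 where w0: "w0 \<in> ball 0 s'" "H 0 w0 = 0" by blast
    define V where "V = {p \<in> B. H2 (fst p) (snd p) \<noteq> 0}"
    have oV: "open V" unfolding V_def by (rule open_nonzero_hol2) (use H2 in \<open>simp add: B_def\<close>)
    have VB: "V \<subseteq> ball 0 R \<times> ball 0 R" by (auto simp: V_def B_def)
    have G: "hol2 V (\<lambda>z w. 1 / H2 z w)"
      by (intro hol2_divide hol2_const oV hol2_subset[OF H2 oV VB]) (auto simp: V_def)
    have inV: "(z, w) \<in> V" if "z \<in> cball 0 r" "w \<in> cball 0 s" "H z w = 0" for z w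
    proof -
      have "z \<in> cball 0 t" "w \<in> cball 0 t" using that t by auto
      then show ?thesis using none that r s by (auto simp: V_def B_def)
    qed
    have "cmod (1 / H2 0 w0) \<le> 2 / b1"
    proof (rule curve_max_on_boundary[OF H r(2) s(1,3) _ G inV])
      fix z w :: complex assume zw: "z \<in> cball 0 r" "w \<in> sphere 0 s"
      then have "z \<in> cball 0 t" "w \<in> cball 0 t" using t by auto
      then show "H z w \<noteq> 0" using 1(1)[of z w] a(2)[OF zw] \<delta> a(1) by auto
    next
      fix z w :: complex assume zw: "z \<in> sphere 0 r" "w \<in> cball 0 s" "H z w = 0"
      then have t': "z \<in> cball 0 t" "w \<in> cball 0 t" using t by auto
      then have "cmod (F z w) < \<delta>" using near[OF t'] zw by simp
      then have "b1 / 2 \<le> cmod (H2 z w)" using b1(2)[OF zw(1,2)] 1(3)[OF t'] \<delta> by linarith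
      then have "1 / cmod (H2 z w) \<le> 1 / (b1 / 2)" using b1 \<open>b1 / 2 \<le> cmod (H2 z w)\<close>
        by (intro divide_left_mono mult_pos_pos) linarith+
      then show "cmod (1 / H2 z w) \<le> 2 / b1" by (simp add: norm_divide)
    qed (use w0 s' r in auto)
    moreover have "cmod (H2 0 w0) < b1 / 2"
      using F2small[OF w0(1)] near2[of 0 w0] 1(4)[of 0 w0] \<delta> t w0 s' by auto
    moreover have "H2 0 w0 \<noteq> 0" using none w0 t s' by fastforce
    ultimately show False using b1 by (simp add: norm_divide field_simps)
  qed
qed

text \<open>The auxiliary version asks that \<open>F\<close> not vanish identically on the axis
  \<open>z = 0\<close>. As the common zero is isolated, this holds for \<open>F\<close> or for
  \<open>F2\<close>, and the conclusion is symmetric in the two.\<close>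

lemma isolated_common_zero_stable:
  assumes F: "hol2 (ball 0 R \<times> ball 0 R) F" and F2: "hol2 (ball 0 R \<times> ball 0 R) F2"
    and zero: "F 0 0 = 0" "F2 0 0 = 0" and R: "R > 0"
    and isolated: "\<And>z w. z \<in> ball 0 R \<Longrightarrow> w \<in> ball 0 R \<Longrightarrow> F z w = 0 \<Longrightarrow> F2 z w = 0 \<Longrightarrow> z = 0 \<and> w = 0"
  obtains \<delta> t where "\<delta> > 0" "0 < t" "t < R"
    "\<And>H H2. hol2 (ball 0 R \<times> ball 0 R) H \<Longrightarrow> hol2 (ball 0 R \<times> ball 0 R) H2 \<Longrightarrow>
      (\<And>z w. z \<in> cball 0 t \<Longrightarrow> w \<in> cball 0 t \<Longrightarrow> cmod (H z w - F z w) < \<delta>) \<Longrightarrow>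
      (\<And>z w. z \<in> cball 0 t \<Longrightarrow> w \<in> cball 0 t \<Longrightarrow> cmod (H2 z w - F2 z w) < \<delta>) \<Longrightarrow>
      \<exists>z w. z \<in> cball 0 t \<and> w \<in> cball 0 t \<and> H z w = 0 \<and> H2 z w = 0"
proof -
  define v where "v = complex_of_real (R / 2)"
  have v: "v \<in> ball 0 R" "v \<noteq> 0" using R by (auto simp: v_def)
  then consider "F 0 v \<noteq> 0" | "F2 0 v \<noteq> 0" using isolated[of 0 v] R by auto
  then show ?thesis
  proof cases
    case 1
    show ?thesis
    proof (rule isolated_common_zero_stable_aux[OF F F2 zero isolated v(1) 1], assumption+, goal_cases)
      case (1 \<delta> t)
      then show ?case using that[of \<delta> t] by blast
    qed
  next
    case 2
    obtain \<delta> t where *: "\<delta> > 0" "0 < t" "t < R"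
      "\<And>H2 H. hol2 (ball 0 R \<times> ball 0 R) H2 \<Longrightarrow> hol2 (ball 0 R \<times> ball 0 R) H \<Longrightarrow>
      (\<And>z w. z \<in> cball 0 t \<Longrightarrow> w \<in> cball 0 t \<Longrightarrow> cmod (H2 z w - F2 z w) < \<delta>) \<Longrightarrow>
      (\<And>z w. z \<in> cball 0 t \<Longrightarrow> w \<in> cball 0 t \<Longrightarrow> cmod (H z w - F z w) < \<delta>) \<Longrightarrow>
      \<exists>z w. z \<in> cball 0 t \<and> w \<in> cball 0 t \<and> H2 z w = 0 \<and> H z w = 0"
      by (rule isolated_common_zero_stable_aux[OF F2 F zero(2,1) _ v(1) 2]) (use isolated in blast)+
    show ?thesis by (rule that[OF *(1,2,3)]) (use *(4) in blast)
  qed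
qed

section \<open>Bivariate polynomials and rational functions\<close>

text \<open>Polynomials in \<open>w\<close> with coefficients in \<open>z\<close>: the outer
  variable is \<open>w\<close>. Evaluating at the constant \<open>[:w:]\<close> first leaves a
  polynomial in \<open>z\<close>.\<close>

definition poly2 :: "complex poly poly \<Rightarrow> complex \<Rightarrow> complex \<Rightarrow> complex" where
  "poly2 G z w = poly (poly G [:w:]) z"

lemma poly2_simps [simp]:
  "poly2 0 z w = 0" "poly2 1 z w = 1" "poly2 (p + q) z w = poly2 p z w + poly2 q z w"
  "poly2 (p - q) z w = poly2 p z w - poly2 q z w" "poly2 (p * q) z w = poly2 p z w * poly2 q z w"
  "poly2 [:c:] z w = poly c z"
  by (simp_all add: poly2_def)

lemma poly2_fibre: "poly2 G z w = poly (map_poly (\<lambda>c. poly c z) G) w"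
  by (induction G) (simp_all add: poly2_def map_poly_pCons)

lemma poly2_sum: "poly2 (\<Sum>i\<in>I. f i) z w = (\<Sum>i\<in>I. poly2 (f i) z w)"
  by (simp add: poly2_def poly_sum)

lemma poly2_monom: "poly2 (monom c j) z w = poly c z * w ^ j"
  by (simp add: poly2_def poly_monom poly_power)

lemma poly2_expand: "poly2 G z w = (\<Sum>j\<le>degree G. poly (coeff G j) z * w ^ j)"
  by (subst poly_as_sum_of_monoms[symmetric]) (simp add: poly2_sum poly2_monom)

lemma continuous_on_poly2 [continuous_intros]:
  fixes f g :: "'a::topological_space \<Rightarrow> complex"
  assumes "continuous_on S f" "continuous_on S g"
  shows "continuous_on S (\<lambda>x. poly2 G (f x) (g x))"
  unfolding poly2_expand by (intro continuous_intros assms)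

lemma finite_zero_fibres:
  fixes G :: "complex poly poly"
  assumes "G \<noteq> 0"
  shows "finite {z. map_poly (\<lambda>c. poly c z) G = 0}"
proof (rule finite_subset)
  show "{z. map_poly (\<lambda>c. poly c z) G = 0} \<subseteq> {z. poly (lead_coeff G) z = 0}"
  proof safe
    fix z assume "map_poly (\<lambda>c. poly c z) G = 0"
    then have "coeff (map_poly (\<lambda>c. poly c z) G) (degree G) = 0" by simp
    then show "poly (lead_coeff G) z = 0" by (simp add: coeff_map_poly)
  qed
  show "finite {z. poly (lead_coeff G) z = 0}"
    by (rule poly_roots_finite) (use assms in simp)
qed

lemma poly2_eq_0_if_zero_on_product:
  assumes "infinite Z" "infinite W" "\<And>z w. z \<in> Z \<Longrightarrow> w \<in> W \<Longrightarrow> poly2 G z w = 0"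
  shows "G = 0"
proof (rule ccontr)
  assume "G \<noteq> 0"
  then have "infinite (Z - {z. map_poly (\<lambda>c. poly c z) G = 0})"
    using Diff_infinite_finite[OF finite_zero_fibres assms(1)] by simp
  from infinite_imp_nonempty[OF this]
  obtain z where z: "z \<in> Z" "map_poly (\<lambda>c. poly c z) G \<noteq> 0" by auto
  then have "finite {w. poly (map_poly (\<lambda>c. poly c z) G) w = 0}" by (intro poly_roots_finite)
  moreover have "W \<subseteq> {w. poly (map_poly (\<lambda>c. poly c z) G) w = 0}"
    using assms(3)[OF z(1)] by (auto simp: poly2_fibre)
  ultimately show False using assms(2) by (metis finite_subset)
qed

lemma zero_fibre_imp_dvd:
  fixes G :: "complex poly poly"
  assumes "map_poly (\<lambda>c. poly c z) G = 0"
  shows "[:[:- z, 1:]:] dvd G"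
  unfolding const_poly_dvd_iff
proof
  fix n
  have "coeff (map_poly (\<lambda>c. poly c z) G) n = 0" using assms by simp
  then show "[:- z, 1:] dvd coeff G n" by (simp add: coeff_map_poly poly_eq_0_iff_dvd)
qed

text \<open>The degree is that in the outer variable. If all prime factors had degree 0, so would
  their product, which is associated to \<open>m\<close>.\<close>

lemma prime_factor_of_positive_degree:
  fixes m :: "complex poly poly"
  assumes "degree m > 0"
  obtains \<pi> where "prime \<pi>" "\<pi> dvd m" "degree \<pi> > 0"
proof -
  have m0: "m \<noteq> 0" using assms by auto
  have "\<exists>\<pi>\<in>#prime_factorization m. degree \<pi> > 0"
  proof (rule ccontr)
    assume no: "\<not> ?thesis"
    have "degree (prod_mset M) = 0" if "\<forall>\<pi>\<in>#M. degree \<pi> = 0" for M :: "complex poly poly multiset"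
      using that
    proof (induction M)
      case (add x M)
      have "degree (x * prod_mset M) \<le> degree x + degree (prod_mset M)" by (rule degree_mult_le)
      then show ?case using add by simp
    qed simp
    then have "degree (prod_mset (prime_factorization m)) = 0" using no by simp
    moreover have eq: "normalize (prod_mset (prime_factorization m)) = normalize m"
      by (rule prod_mset_prime_factorization_weak[OF m0])
    then have "m dvd prod_mset (prime_factorization m)" by (metis associatedD1)
    moreover have "prod_mset (prime_factorization m) \<noteq> 0" using eq m0 by (metis normalize_eq_0_iff)
    ultimately have "degree m = 0" using dvd_imp_degree_le[of m "prod_mset (prime_factorization m)"] by simp
    then show False using assms by simp
  qed
  then obtain \<pi> where "\<pi> \<in># prime_factorization m" "degree \<pi> > 0" by blast
  then show ?thesis using that[of \<pi>] by (auto simp: in_prime_factors_imp_prime prime_factors_dvd)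
qed

text \<open>Elimination of \<open>w\<close>, as by the resultant. Take a nonzero combination
  \<open>m\<close> of least degree in \<open>w\<close>. Pseudo-division shows that \<open>m\<close>
  divides \<open>p\<close> and \<open>q\<close> up to nonzero factors from the coefficient ring; a
  prime factor of \<open>m\<close> of positive degree cannot divide those factors, so it would
  divide both \<open>p\<close> and \<open>q\<close>.\<close>

lemma coprime_combination:
  fixes p q :: "complex poly poly"
  assumes cop: "coprime p q"
  obtains a b r where "r \<noteq> 0" "a * p + b * q = [:r:]"
proof -
  define J where "J m \<longleftrightarrow> m \<noteq> 0 \<and> (\<exists>a b. m = a * p + b * q)" for m
  have "p \<noteq> 0 \<or> q \<noteq> 0" using cop by auto
  moreover have "p = 1 * p + 0 * q" "q = 0 * p + 1 * q" by simp_all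
  ultimately have "\<exists>m. J m" unfolding J_def by metis
  then obtain m where m: "J m" "\<And>m'. degree m' < degree m \<Longrightarrow> \<not> J m'"
    using exists_least_iff[of "\<lambda>n. \<exists>m. J m \<and> degree m = n"] by metis
  obtain a b where ab: "m = a * p + b * q" "m \<noteq> 0" using m(1) by (auto simp: J_def)
  have dvd: "\<exists>c. c \<noteq> 0 \<and> m dvd smult c f" if f: "f = x * p + y * q" for f x y
  proof -
    obtain u v where uv: "pseudo_divmod f m = (u, v)" by fastforce
    define c where "c = lead_coeff m ^ (Suc (degree f) - degree m)"
    have c: "smult c f = m * u + v" "v = 0 \<or> degree v < degree m"
      using pseudo_divmod[OF ab(2) uv] by (simp_all add: c_def)
    have "v = smult c f - m * u" using c by simp
    also have "\<dots> = ([:c:] * x - u * a) * p + ([:c:] * y - u * b) * q"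
      unfolding ab(1) f by (simp add: algebra_simps smult_add_right)
    finally have "v = 0" using c(2) m(2)[of v] unfolding J_def by blast
    then show ?thesis using c(1) ab(2) by (intro exI[of _ c]) (simp add: c_def)
  qed
  obtain c1 where c1: "c1 \<noteq> 0" "m dvd smult c1 p" using dvd[of p 1 0] by auto
  obtain c2 where c2: "c2 \<noteq> 0" "m dvd smult c2 q" using dvd[of q 0 1] by auto
  have "degree m = 0"
  proof (rule ccontr)
    assume "degree m \<noteq> 0"
    then have "degree m > 0" by simp
    then obtain \<pi> where \<pi>: "prime \<pi>" "\<pi> dvd m" "degree \<pi> > 0" by (rule prime_factor_of_positive_degree)
    have *: "\<pi> dvd f" if "m dvd smult c f" "c \<noteq> 0" for f c
    proof -
      have "\<pi> dvd [:c:] * f" using that \<pi>(2) dvd_trans by auto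
      moreover have "\<not> \<pi> dvd [:c:]"
        using dvd_imp_degree_le[of \<pi> "[:c:]"] \<pi>(3) that(2) by auto
      ultimately show ?thesis using prime_dvd_multD[OF \<pi>(1)] by blast
    qed
    have "\<pi> dvd p" "\<pi> dvd q" using *[OF c1(2,1)] *[OF c2(2,1)] .
    then have "is_unit \<pi>" using cop coprime_common_divisor by blast
    then show False using \<pi>(1) by auto
  qed
  then obtain r where "m = [:r:]" by (rule degree_eq_zeroE)
  then show ?thesis using that[of r a b] ab by auto
qed

text \<open>The first coordinate is a root of the eliminant \<open>r\<close>. Above a given
  \<open>z\<close> the two fibres do not both vanish identically, since otherwise the linear
  polynomial with root \<open>z\<close> would be a common factor.\<close>

lemma finite_common_zeros:
  assumes cop: "coprime p q"
  shows "finite {(z, w). poly2 p z w = 0 \<and> poly2 q z w = 0}"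
proof -
  obtain a b r where r: "r \<noteq> 0" "a * p + b * q = [:r:]" using coprime_combination[OF cop] .
  define X where "X z = {w. poly2 p z w = 0 \<and> poly2 q z w = 0}" for z
  have "poly r z = 0" if "poly2 p z w = 0" "poly2 q z w = 0" for z w
  proof -
    have "poly2 (a * p + b * q) z w = 0" using that by simp
    then show ?thesis unfolding r(2) by simp
  qed
  then have "{(z, w). poly2 p z w = 0 \<and> poly2 q z w = 0} \<subseteq> (SIGMA z:{z. poly r z = 0}. X z)"
    by (auto simp: X_def)
  moreover have "finite (X z)" for z
  proof -
    have "map_poly (\<lambda>c. poly c z) p \<noteq> 0 \<or> map_poly (\<lambda>c. poly c z) q \<noteq> 0"
    proof (rule ccontr)
      assume "\<not> ?thesis"
      then have "[:[:- z, 1:]:] dvd p" "[:[:- z, 1:]:] dvd q" by (auto intro: zero_fibre_imp_dvd)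
      then have "is_unit [:[:- z, 1:]:]" using cop coprime_common_divisor by blast
      then show False by (simp add: is_unit_const_poly_iff is_unit_pCons_iff)
    qed
    then obtain f where "f \<noteq> 0" "X z \<subseteq> {w. poly f w = 0}" by (auto simp: X_def poly2_fibre)
    from finite_subset[OF this(2) poly_roots_finite[OF this(1)]] show ?thesis .
  qed
  ultimately show ?thesis by (rule finite_subset[OF _ finite_SigmaI[OF poly_roots_finite[OF r(1)]]])
qed

lemma gcd_decomposition3:
  fixes p q r :: "complex poly poly"
  assumes "p \<noteq> 0 \<or> q \<noteq> 0 \<or> r \<noteq> 0"
  obtains d p' q' r' where "d \<noteq> 0" "p = d * p'" "q = d * q'" "r = d * r'"
    "finite {(z, w). poly2 p' z w = 0 \<and> poly2 q' z w = 0 \<and> poly2 r' z w = 0}"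
proof -
  define d where "d = gcd p (gcd q r)"
  have d0: "d \<noteq> 0" using assms by (auto simp: d_def)
  have "d dvd p" "d dvd q" "d dvd r" by (auto simp: d_def intro: dvd_trans)
  then obtain p' q' r' where eq: "p = d * p'" "q = d * q'" "r = d * r'" by (auto elim!: dvdE)
  have unit: "is_unit x" if "x dvd p'" "x dvd q'" "x dvd r'" for x
  proof -
    have "d * x dvd gcd p (gcd q r)" by (intro gcd_greatest) (use that in \<open>simp_all add: eq\<close>)
    then have "d * x dvd d" unfolding d_def[symmetric] .
    then show ?thesis using d0 by (metis dvd_times_left_cancel_iff mult.right_neutral)
  qed
  \<comment> \<open>Three polynomials without a common factor need not be pairwise coprime. Their
    common zeros lie among those of \<open>p'\<close> and \<open>e\<close>, or of the cofactors of
    \<open>e\<close> in \<open>q'\<close> and \<open>r'\<close>; both pairs are coprime.\<close>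
  define e where "e = gcd q' r'"
  have "finite {(z, w). poly2 p' z w = 0 \<and> poly2 q' z w = 0 \<and> poly2 r' z w = 0}"
  proof -
    have "coprime p' e" by (rule coprimeI) (use unit in \<open>auto simp: e_def\<close>)
    then have f1: "finite {(z, w). poly2 p' z w = 0 \<and> poly2 e z w = 0}" by (rule finite_common_zeros)
    show ?thesis
    proof (cases "e = 0")
      case True
      then have "q' = 0" "r' = 0" by (auto simp: e_def)
      then show ?thesis using f1 True by (auto elim!: rev_finite_subset)
    next
      case False
      then obtain q'' r'' where *: "q' = q'' * e" "r' = r'' * e" "coprime q'' r''"
        unfolding e_def using gcd_coprime_exists by metis
      show ?thesis
        by (rule finite_subset[OF _ finite_UnI[OF f1 finite_common_zeros[OF *(3)]]]) (auto simp: *)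
    qed
  qed
  then show ?thesis using that[OF d0 eq] by blast
qed

section \<open>Hurwitz's theorem on separately rational functions\<close>

lemma homogeneous_system_solution:
  fixes M :: "'a \<Rightarrow> 'b \<Rightarrow> 'c::field"
  assumes "finite A" "finite B" "card A < card B"
  obtains x where "\<exists>b\<in>B. x b \<noteq> 0" "\<And>a. a \<in> A \<Longrightarrow> (\<Sum>b\<in>B. M a b * x b) = 0"
proof -
  have "\<exists>x. (\<exists>b\<in>B. x b \<noteq> 0) \<and> (\<forall>a\<in>A. (\<Sum>b\<in>B. M a b * x b) = 0)"
    using assms
  proof (induction A arbitrary: B M rule: finite_induct)
    case empty
    then obtain b where "b \<in> B" by (metis card.empty card_gt_0_iff equals0I)
    then show ?case by (intro exI[of _ "\<lambda>_. 1"]) auto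
  next
    case (insert a A)
    show ?case
    proof (cases "\<forall>b\<in>B. M a b = 0")
      case True
      then show ?thesis using insert.IH[of B M] insert by auto
    next
      case False
      then obtain b0 where b0: "b0 \<in> B" "M a b0 \<noteq> 0" by blast
      define B' where "B' = B - {b0}"
      have B': "finite B'" "card A < card B'" "B = insert b0 B'" "b0 \<notin> B'"
        using insert b0 by (auto simp: B'_def)
      \<comment> \<open>Gaussian elimination: equation \<open>a\<close> is solved for the unknown
        \<open>b0\<close>, and the result is inserted into the other equations.\<close>
      define M' where "M' a' b = M a' b - M a' b0 * M a b / M a b0" for a' b
      obtain x where x: "\<exists>b\<in>B'. x b \<noteq> 0" "\<And>a'. a' \<in> A \<Longrightarrow> (\<Sum>b\<in>B'. M' a' b * x b) = 0"
        using insert.IH[OF B'(1,2), of M'] by blast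
      define y where "y = x(b0 := - (\<Sum>b\<in>B'. M a b * x b) / M a b0)"
      have y: "y b = x b" if "b \<in> B'" for b using that B'(4) by (auto simp: y_def)
      have sum: "(\<Sum>b\<in>B. M a' b * y b) = M a' b0 * y b0 + (\<Sum>b\<in>B'. M a' b * x b)" for a'
        unfolding B'(3) using B'(1,4) y by simp
      have "(\<Sum>b\<in>B. M a' b * y b) = (\<Sum>b\<in>B'. M' a' b * x b)" for a'
        unfolding sum by (simp add: y_def M'_def sum_subtractf left_diff_distrib sum_distrib_left sum_divide_distrib
            algebra_simps)
      moreover have "(\<Sum>b\<in>B. M a b * y b) = 0" unfolding sum using b0 by (simp add: y_def)
      moreover have "\<exists>b\<in>B. y b \<noteq> 0" using x(1) y B'(3) by auto
      ultimately show ?thesis using x(2) by (intro exI[of _ y]) auto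
    qed
  qed
  then show ?thesis using that by blast
qed

text \<open>Degree at most \<open>a\<close> in each variable separately: every slice in either
  direction has degree at most \<open>a\<close>, while there are (a + 1)^2 free
  coefficients.\<close>

definition grid_poly :: "nat \<Rightarrow> (nat \<Rightarrow> nat \<Rightarrow> complex) \<Rightarrow> complex poly poly" where
  "grid_poly a c = (\<Sum>j\<le>a. monom (\<Sum>i\<le>a. monom (c i j) i) j)"

lemma poly2_grid_poly: "poly2 (grid_poly a c) z w = (\<Sum>j\<le>a. \<Sum>i\<le>a. c i j * z ^ i * w ^ j)"
  by (simp add: grid_poly_def poly2_sum poly2_monom poly_sum poly_monom sum_distrib_right)

lemma coeff_grid_poly: "i \<le> a \<Longrightarrow> j \<le> a \<Longrightarrow> coeff (coeff (grid_poly a c) j) i = c i j"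
  by (simp add: grid_poly_def coeff_sum)

lemma grid_poly_slices:
  obtains P Q where "\<And>z. poly P z = poly2 (grid_poly a c) z w0" "degree P \<le> a"
    "\<And>w. poly Q w = poly2 (grid_poly a c) z0 w" "degree Q \<le> a"
proof (rule that)
  show "poly (\<Sum>i\<le>a. monom (\<Sum>j\<le>a. c i j * w0 ^ j) i) z = poly2 (grid_poly a c) z w0" for z
    by (simp add: poly2_grid_poly poly_sum poly_monom sum_distrib_right, subst sum.swap, simp add: mult_ac)
  show "poly (\<Sum>j\<le>a. monom (\<Sum>i\<le>a. c i j * z0 ^ i) j) w = poly2 (grid_poly a c) z0 w" for w
    by (simp add: poly2_grid_poly poly_sum poly_monom sum_distrib_right)
qed (auto intro!: degree_sum_le order_trans[OF degree_monom_le])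

lemma poly_eq_0_if_many_roots:
  fixes p :: "complex poly"
  assumes "finite S" "degree p < card S" "\<And>z. z \<in> S \<Longrightarrow> poly p z = 0"
  shows "p = 0"
proof (rule ccontr)
  assume "p \<noteq> 0"
  then have "card {x. poly p x = 0} \<le> degree p" "finite {x. poly p x = 0}"
    by (simp_all add: card_poly_roots_bound poly_roots_finite)
  moreover have "card S \<le> card {x. poly p x = 0}" using assms(3) calculation(2) by (intro card_mono) auto
  ultimately show False using assms(2) by simp
qed

text \<open>The disc is uncountable and is the union of countably many sets, one for each bound on
  the degrees, so one of these sets is infinite. The sets grow with the bound, which later permits a
  common bound for both variables.\<close>

lemma bounded_degree_rational_infinite:
  fixes h :: "complex \<Rightarrow> complex \<Rightarrow> complex"
  assumes r: "r > 0"
    and rat: "\<And>w. w \<in> ball 0 r \<Longrightarrow> \<exists>p q. q \<noteq> 0 \<and> (\<forall>z\<in>ball 0 r. poly q z * h z w = poly p z)"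
  obtains \<delta> where "\<And>d. \<delta> \<le> d \<Longrightarrow> infinite {w \<in> ball 0 r. \<exists>p q. q \<noteq> 0 \<and> degree p \<le> d \<and> degree q \<le> d \<and>
      (\<forall>z\<in>ball 0 r. poly q z * h z w = poly p z)}"
proof -
  define W where "W d = {w \<in> ball 0 r. \<exists>p q. q \<noteq> 0 \<and> degree p \<le> d \<and> degree q \<le> d \<and>
      (\<forall>z\<in>ball 0 r. poly q z * h z w = poly p z)}" for d
  have "ball 0 r \<subseteq> (\<Union>d. W d)"
  proof
    fix w :: complex assume w: "w \<in> ball 0 r"
    obtain p q where "q \<noteq> 0" "\<forall>z\<in>ball 0 r. poly q z * h z w = poly p z" using rat[OF w] by blast
    then have "w \<in> W (max (degree p) (degree q))"
      unfolding W_def using w by (intro CollectI conjI exI[of _ p] exI[of _ q]) auto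
    then show "w \<in> (\<Union>d. W d)" by blast
  qed
  moreover have "uncountable (ball (0 :: complex) r)" using r by (rule uncountable_ball)
  ultimately have "\<exists>d. infinite (W d)"
    using countable_UN[of UNIV W] countable_finite countable_subset by blast
  then obtain \<delta> where "infinite (W \<delta>)" by blast
  moreover have mono: "W \<delta> \<subseteq> W d" if "\<delta> \<le> d" for d
    unfolding W_def using that by (auto intro: order_trans)
  ultimately have "infinite (W d)" if "\<delta> \<le> d" for d using infinite_super[OF mono[OF that]] by simp
  then show ?thesis using that[of \<delta>] unfolding W_def by simp
qed

text \<open>The set where \<open>f\<close> and \<open>g\<close> differ is open, so it is empty or
  infinite, and it lies among the roots of \<open>q\<close>.\<close>

lemma eq_if_poly_multiple_eq:
  fixes f g :: "complex \<Rightarrow> complex"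
  assumes q: "q \<noteq> 0" and f: "continuous_on (ball 0 r) f" and g: "continuous_on (ball 0 r) g"
    and eq: "\<And>z. z \<in> ball 0 r \<Longrightarrow> poly q z * f z = poly q z * g z" and z: "z \<in> ball 0 r"
  shows "f z = g z"
proof (rule ccontr)
  assume ne: "f z \<noteq> g z"
  have "open (ball 0 r \<inter> (\<lambda>z. f z - g z) -` (- {0}))"
    using f g by (intro continuous_open_preimage continuous_intros) auto
  moreover have "z \<in> ball 0 r \<inter> (\<lambda>z. f z - g z) -` (- {0})" using z ne by auto
  ultimately obtain e where "e > 0" "ball z e \<subseteq> ball 0 r \<inter> (\<lambda>z. f z - g z) -` (- {0})"
    by (meson open_contains_ball)
  then have "infinite (ball 0 r \<inter> (\<lambda>z. f z - g z) -` (- {0}))"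
    using uncountable_infinite[OF uncountable_ball] finite_subset by metis
  moreover have "poly q x = 0" if "x \<in> ball 0 r" "f x \<noteq> g x" for x using eq[OF that(1)] that(2) by simp
  then have "ball 0 r \<inter> (\<lambda>z. f z - g z) -` (- {0}) \<subseteq> {z. poly q z = 0}" by auto
  ultimately show False using finite_subset[OF _ poly_roots_finite[OF q]] by metis
qed

text \<open>Hurwitz's theorem. As in Siegel's lemma, counting coefficients gives \<open>A\<close>, \<open>B\<close> with
  \<open>A = h B\<close> on a finite grid, which propagates to lines because infinitely many slices have degrees
  bounded by a common \<open>d\<close>.\<close>

lemma rational_if_separately_rational:
  fixes h :: "complex \<Rightarrow> complex \<Rightarrow> complex"
  assumes r: "r > 0"
    and rat1: "\<And>w. w \<in> ball 0 r \<Longrightarrow> \<exists>p q. q \<noteq> 0 \<and> (\<forall>z\<in>ball 0 r. poly q z * h z w = poly p z)"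
    and rat2: "\<And>z. z \<in> ball 0 r \<Longrightarrow> \<exists>p q. q \<noteq> 0 \<and> (\<forall>w\<in>ball 0 r. poly q w * h z w = poly p w)"
    and cont1: "\<And>w. w \<in> ball 0 r \<Longrightarrow> continuous_on (ball 0 r) (\<lambda>z. h z w)"
    and cont2: "\<And>z. z \<in> ball 0 r \<Longrightarrow> continuous_on (ball 0 r) (h z)"
  obtains A B where "B \<noteq> 0" "\<And>z w. z \<in> ball 0 r \<Longrightarrow> w \<in> ball 0 r \<Longrightarrow> poly2 B z w * h z w = poly2 A z w"
proof -
  obtain d1 where d1: "\<And>d. d1 \<le> d \<Longrightarrow> infinite {w \<in> ball 0 r. \<exists>p q. q \<noteq> 0 \<and> degree p \<le> d \<and> degree q \<le> d \<and>
      (\<forall>z\<in>ball 0 r. poly q z * h z w = poly p z)}"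
    using bounded_degree_rational_infinite[of r h, OF r rat1] by blast
  obtain d2 where d2: "\<And>d. d2 \<le> d \<Longrightarrow> infinite {z \<in> ball 0 r. \<exists>p q. q \<noteq> 0 \<and> degree p \<le> d \<and> degree q \<le> d \<and>
      (\<forall>w\<in>ball 0 r. poly q w * h z w = poly p w)}"
    using bounded_degree_rational_infinite[OF r, of "\<lambda>w z. h z w"] rat2 by blast
  define d where "d = max d1 d2"
  define W where "W = {w \<in> ball 0 r. \<exists>p q. q \<noteq> 0 \<and> degree p \<le> d \<and> degree q \<le> d \<and>
      (\<forall>z\<in>ball 0 r. poly q z * h z w = poly p z)}"
  define Z where "Z = {z \<in> ball 0 r. \<exists>p q. q \<noteq> 0 \<and> degree p \<le> d \<and> degree q \<le> d \<and>
      (\<forall>w\<in>ball 0 r. poly q w * h z w = poly p w)}"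
  have infW: "infinite W" and infZ: "infinite Z" using d1[of d] d2[of d] by (auto simp: W_def Z_def d_def)
  \<comment> \<open>Two requirements meet here. With \<open>N = a + d + 1 = 4 * d + 4\<close> the
    unknowns outnumber the equations, 2 * (a + 1)^2 > N^2, and \<open>N\<close> exceeds the degree
    \<open>a + d\<close> of \<open>q * P - p * Q\<close> on a slice.\<close>
  define a where "a = 3 * d + 3"
  define N where "N = a + d + 1"
  obtain W0 where W0: "finite W0" "card W0 = N" "W0 \<subseteq> W" using infinite_arbitrarily_large[OF infW] by blast
  obtain Z0 where Z0: "finite Z0" "card Z0 = N" "Z0 \<subseteq> Z" using infinite_arbitrarily_large[OF infZ] by blast
  have sub: "W0 \<subseteq> ball 0 r" "Z0 \<subseteq> ball 0 r" using W0 Z0 by (auto simp: W_def Z_def)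
  define I :: "(bool \<times> nat \<times> nat) set" where "I = UNIV \<times> {..a} \<times> {..a}"
  \<comment> \<open>The linear system expressing \<open>A - h * B = 0\<close> at the grid points;
    the flag tells the coefficients of \<open>A\<close> from those of \<open>B\<close>.\<close>
  define M where "M = (\<lambda>(z, w) (b, i, j). (if b then 1 else - h z w) * z ^ i * w ^ j)"
  have "card (Z0 \<times> W0) < card I"
    using W0 Z0 by (simp add: I_def card_cartesian_product N_def a_def algebra_simps)
  moreover have "finite (Z0 \<times> W0)" "finite I" using W0 Z0 by (simp_all add: I_def)
  ultimately obtain x where x: "\<exists>b\<in>I. x b \<noteq> 0" "\<And>p. p \<in> Z0 \<times> W0 \<Longrightarrow> (\<Sum>b\<in>I. M p b * x b) = 0"
    using homogeneous_system_solution[of "Z0 \<times> W0" I M] by blast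
  define A where "A = grid_poly a (\<lambda>i j. x (True, i, j))"
  define B where "B = grid_poly a (\<lambda>i j. x (False, i, j))"
  have AB0: "A \<noteq> 0 \<or> B \<noteq> 0"
  proof -
    obtain b i j where "x (b, i, j) \<noteq> 0" "i \<le> a" "j \<le> a" using x(1) by (auto simp: I_def)
    then have "coeff (coeff (if b then A else B) j) i \<noteq> 0" by (cases b) (simp_all add: A_def B_def coeff_grid_poly)
    then show ?thesis by (cases b) auto
  qed
  have grid: "poly2 A z w = h z w * poly2 B z w" if "z \<in> Z0" "w \<in> W0" for z w
  proof -
    have "(\<Sum>b\<in>I. M (z, w) b * x b) = (\<Sum>b\<in>(UNIV :: bool set). \<Sum>i\<le>a. \<Sum>j\<le>a. M (z, w) (b, i, j) * x (b, i, j))"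
      by (simp add: I_def sum.cartesian_product case_prod_unfold)
    also have "\<dots> = poly2 A z w - h z w * poly2 B z w"
      by (simp add: UNIV_bool M_def A_def B_def poly2_grid_poly sum_distrib_left sum_negf mult_ac)
         (subst (1 2) sum.swap, simp)
    finally show ?thesis using x(2)[of "(z, w)"] that by simp
  qed
  \<comment> \<open>On a grid line \<open>h\<close> is \<open>p / q\<close> of bounded degree, so
    \<open>q * P - p * Q\<close> has more zeros than its degree allows and the identity holds on the
    whole line.\<close>
  have step1: "poly2 A z w = h z w * poly2 B z w" if w: "w \<in> W0" and z: "z \<in> ball 0 r" for z w
  proof -
    have "w \<in> W" using w W0 by blast
    then obtain p q where pq: "q \<noteq> 0" "degree p \<le> d" "degree q \<le> d" "\<forall>z\<in>ball 0 r. poly q z * h z w = poly p z"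
      by (auto simp: W_def)
    obtain P where P: "\<And>z. poly P z = poly2 A z w" "degree P \<le> a"
      unfolding A_def by (rule grid_poly_slices) blast
    obtain Q where Q: "\<And>z. poly Q z = poly2 B z w" "degree Q \<le> a"
      unfolding B_def by (rule grid_poly_slices) blast
    have "q * P - p * Q = 0"
    proof (rule poly_eq_0_if_many_roots[OF Z0(1)])
      have "degree (q * P) \<le> a + d" "degree (p * Q) \<le> a + d"
        using degree_mult_le[of q P] degree_mult_le[of p Q] pq P Q by linarith+
      then show "degree (q * P - p * Q) < card Z0"
        using degree_diff_le[of "q * P" "a + d" "p * Q"] by (simp add: Z0 N_def)
      show "poly (q * P - p * Q) z = 0" if "z \<in> Z0" for z
        using grid[OF that w] pq(4) that sub by (auto simp: P Q mult_ac)
    qed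
    then have eq: "poly q z * poly P z = poly p z * poly Q z" for z
      by (metis eq_iff_diff_eq_0 poly_mult)
    have "poly P z = h z w * poly Q z"
    proof (rule eq_if_poly_multiple_eq[OF pq(1) _ _ _ z])
      show "continuous_on (ball 0 r) (\<lambda>z. h z w * poly Q z)"
        using cont1 w sub by (auto intro!: continuous_intros)
      show "poly q z * poly P z = poly q z * (h z w * poly Q z)" if "z \<in> ball 0 r" for z
        using eq[of z] pq(4) that by (auto simp: mult_ac)
    qed (auto intro!: continuous_intros)
    then show ?thesis by (simp add: P Q)
  qed
  \<comment> \<open>The same in the other direction: any line over \<open>Z\<close> meets the
    \<open>N\<close> lines that are already settled.\<close>
  have step2: "poly2 A z w = h z w * poly2 B z w" if z: "z \<in> Z" and w: "w \<in> ball 0 r" for z w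
  proof -
    obtain p q where pq: "z \<in> ball 0 r" "q \<noteq> 0" "degree p \<le> d" "degree q \<le> d" "\<forall>w\<in>ball 0 r. poly q w * h z w = poly p w"
      using z by (auto simp: Z_def)
    obtain P where P: "\<And>w. poly P w = poly2 A z w" "degree P \<le> a"
      unfolding A_def by (rule grid_poly_slices) blast
    obtain Q where Q: "\<And>w. poly Q w = poly2 B z w" "degree Q \<le> a"
      unfolding B_def by (rule grid_poly_slices) blast
    have "q * P - p * Q = 0"
    proof (rule poly_eq_0_if_many_roots[OF W0(1)])
      have "degree (q * P) \<le> a + d" "degree (p * Q) \<le> a + d"
        using degree_mult_le[of q P] degree_mult_le[of p Q] pq P Q by linarith+
      then show "degree (q * P - p * Q) < card W0"
        using degree_diff_le[of "q * P" "a + d" "p * Q"] by (simp add: W0 N_def)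
      show "poly (q * P - p * Q) w = 0" if "w \<in> W0" for w
        using step1[OF that pq(1)] pq(5) that sub by (auto simp: P Q mult_ac)
    qed
    then have eq: "poly q w * poly P w = poly p w * poly Q w" for w
      by (metis eq_iff_diff_eq_0 poly_mult)
    have "poly P w = h z w * poly Q w"
    proof (rule eq_if_poly_multiple_eq[OF pq(2) _ _ _ w])
      show "continuous_on (ball 0 r) (\<lambda>w. h z w * poly Q w)"
        using cont2 pq(1) by (auto intro!: continuous_intros)
      show "poly q w * poly P w = poly q w * (h z w * poly Q w)" if "w \<in> ball 0 r" for w
        using eq[of w] pq(5) that by (auto simp: mult_ac)
    qed (auto intro!: continuous_intros)
    then show ?thesis by (simp add: P Q)
  qed
  \<comment> \<open>For an arbitrary \<open>w\<close> the degrees of \<open>p\<close> and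
    \<open>q\<close> are not controlled, but now the zeros fill the infinite set
    \<open>Z\<close>.\<close>
  have step3: "poly2 B z w * h z w = poly2 A z w" if w: "w \<in> ball 0 r" and z: "z \<in> ball 0 r" for z w
  proof -
    obtain p q where pq: "q \<noteq> 0" "\<forall>z\<in>ball 0 r. poly q z * h z w = poly p z" using rat1[OF w] by blast
    obtain P where P: "\<And>z. poly P z = poly2 A z w" unfolding A_def by (rule grid_poly_slices) blast
    obtain Q where Q: "\<And>z. poly Q z = poly2 B z w" unfolding B_def by (rule grid_poly_slices) blast
    have "q * P - p * Q = 0"
    proof (rule ccontr)
      assume "q * P - p * Q \<noteq> 0"
      then have "finite {z. poly (q * P - p * Q) z = 0}" by (rule poly_roots_finite)
      moreover have "poly (q * P - p * Q) z = 0" if "z \<in> Z" for z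
        using step2[OF that w] pq(2) that by (auto simp: P Q Z_def mult_ac)
      ultimately show False using infZ finite_subset[of Z "{z. poly (q * P - p * Q) z = 0}"] by blast
    qed
    then have eq: "poly q z * poly P z = poly p z * poly Q z" for z
      by (metis eq_iff_diff_eq_0 poly_mult)
    have "poly P z = h z w * poly Q z"
    proof (rule eq_if_poly_multiple_eq[OF pq(1) _ _ _ z])
      show "continuous_on (ball 0 r) (\<lambda>z. h z w * poly Q z)"
        using cont1 w by (auto intro!: continuous_intros)
      show "poly q z * poly P z = poly q z * (h z w * poly Q z)" if "z \<in> ball 0 r" for z
        using eq[of z] pq(2) that by (auto simp: mult_ac)
    qed (auto intro!: continuous_intros)
    then show ?thesis by (simp add: P Q mult.commute)
  qed
  have "B \<noteq> 0"
  proof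
    assume B: "B = 0"
    have inf: "infinite (ball (0 :: complex) r)" using r uncountable_ball uncountable_infinite by blast
    have "A = 0"
      by (rule poly2_eq_0_if_zero_on_product[OF inf inf]) (use step3 B in auto)
    with B AB0 show False by simp
  qed
  then show ?thesis using that step3 by blast
qed

section \<open>Homogeneous coordinates of a meromorphic map\<close>

lemma rep_cp2_nonzero [simp]: "rep_cp2 q \<noteq> 0"
  using Quotient3_rep_reflp[OF Quotient3_cp2, of q] by (auto simp: proportional_def)

lemma proj_rep_cp2 [simp]: "proj (rep_cp2 q) = q"
  by (rule Quotient3_abs_rep[OF Quotient3_cp2])

lemma rep_cp2_proj:
  assumes "x \<noteq> 0"
  obtains c where "c \<noteq> 0" "rep_cp2 (proj x) = c *s x"
proof -
  have "proj x = proj (rep_cp2 (proj x))" by simp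
  then obtain c where c: "rep_cp2 (proj x) = c *s x" using assms by (subst (asm) proj_eq_iff) auto
  then have "c \<noteq> 0" using rep_cp2_nonzero[of "proj x"] by auto
  then show ?thesis using that c by blast
qed

lemma proj_scale: "x \<noteq> 0 \<Longrightarrow> c \<noteq> 0 \<Longrightarrow> proj (c *s x) = proj x"
  by (subst proj_eq_iff) (auto simp: vector_smult_assoc intro!: exI[of _ "inverse c"])

definition nz :: "3 \<Rightarrow> cp2 \<Rightarrow> bool" where
  "nz k q \<longleftrightarrow> rep_cp2 q $ k \<noteq> 0"

text \<open>The affine coordinate \<open>x_j / x_k\<close> of the chart
  \<open>x_k \<noteq> 0\<close>; as a ratio it does not depend on the representative. It is
  meaningful where \<open>nz k\<close> holds.\<close>

definition rat :: "3 \<Rightarrow> 3 \<Rightarrow> cp2 \<Rightarrow> complex" where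
  "rat j k q = rep_cp2 q $ j / rep_cp2 q $ k"

lemma nth_nonzero: "(x :: complex^3) $ k \<noteq> 0 \<Longrightarrow> x \<noteq> 0"
  by auto

lemma nz_proj: "x \<noteq> 0 \<Longrightarrow> nz k (proj x) \<longleftrightarrow> x $ k \<noteq> 0"
  by (rule rep_cp2_proj[of x]) (auto simp: nz_def)

lemma rat_proj: "x \<noteq> 0 \<Longrightarrow> rat j k (proj x) = x $ j / x $ k"
  by (rule rep_cp2_proj[of x]) (auto simp: rat_def)

lemma rat_self: "nz k q \<Longrightarrow> rat k k q = 1"
  by (simp add: nz_def rat_def)

lemma nz_exists: obtains k where "nz k q"
  using rep_cp2_nonzero[of q] unfolding nz_def vec_eq_iff by auto

lemma nz_iff_rat: "nz k q \<Longrightarrow> nz j q \<longleftrightarrow> rat j k q \<noteq> 0"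
  by (auto simp: nz_def rat_def)

lemma proj_rat: "nz k q \<Longrightarrow> proj (\<chi> j. rat j k q) = q"
proof -
  assume k: "nz k q"
  have "(\<chi> j. rat j k q) = inverse (rep_cp2 q $ k) *s rep_cp2 q"
    by (simp add: vec_eq_iff rat_def field_simps)
  then show ?thesis using k by (simp add: nz_def proj_scale)
qed

lemma eq_if_rat_eq: "nz k p \<Longrightarrow> nz k q \<Longrightarrow> (\<And>j. j \<noteq> k \<Longrightarrow> rat j k p = rat j k q) \<Longrightarrow> p = q"
proof -
  assume a: "nz k p" "nz k q" "\<And>j. j \<noteq> k \<Longrightarrow> rat j k p = rat j k q"
  have "rat j k p = rat j k q" for j
    using a(3)[of j] rat_self[OF a(1)] rat_self[OF a(2)] by (cases "j = k") auto
  then have "(\<chi> j. rat j k p) = (\<chi> j. rat j k q)" by simp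
  then have "proj (\<chi> j. rat j k p) = proj (\<chi> j. rat j k q)" by (rule arg_cong)
  then show ?thesis unfolding proj_rat[OF a(1)] proj_rat[OF a(2)] .
qed

text \<open>The two indices different from \<open>k\<close>, in the order used by the charts.\<close>

definition other :: "3 \<Rightarrow> 2 \<Rightarrow> 3" where
  "other k l = (if k = 1 then (if l = 1 then 2 else 3) else if k = 2 then (if l = 1 then 1 else 3)
     else (if l = 1 then 1 else 2))"

lemma other_neq [simp]: "other k l \<noteq> k" "k \<noteq> other k l"
  using exhaust_3[of k] exhaust_2[of l] by (auto simp: other_def)

lemma other_exists:
  assumes "j \<noteq> k" obtains l where "j = other k l"
proof -
  have "j = other k 1 \<or> j = other k 2" using assms exhaust_3[of k] exhaust_3[of j] by (auto simp: other_def)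
  then show ?thesis using that by blast
qed

lemma other_neq_other [simp]: "other k 1 \<noteq> other k 2" "other k 2 \<noteq> other k 1"
  using exhaust_3[of k] by (auto simp: other_def)

lemma hom_coords_other [simp]: "hom_coords k z $ other k l = z $ l"
  using exhaust_3[of k] exhaust_2[of l] by (auto simp: other_def hom_coords_nth)

lemma nz_aff [simp]: "nz k (aff k z)"
  by (simp add: aff_def nz_proj)

lemma rat_aff [simp]: "rat j k (aff k z) = hom_coords k z $ j"
  by (simp add: aff_def rat_proj)

lemma rat_aff': "rat j k (aff i z) = hom_coords i z $ j / hom_coords i z $ k"
  by (simp add: aff_def rat_proj)

lemma aff_rat: "nz k q \<Longrightarrow> aff k (\<chi> l. rat (other k l) k q) = q"
  by (rule eq_if_rat_eq[of k]) (auto elim!: other_exists)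

lemma range_aff: "range (aff k) = {q. nz k q}"
proof (intro equalityI subsetI)
  fix q assume "q \<in> {q. nz k q}"
  then show "q \<in> range (aff k)" using aff_rat by (metis mem_Collect_eq rangeI)
qed auto

lemma inv_aff_nth: "nz k q \<Longrightarrow> inv (aff k) q $ l = rat (other k l) k q"
proof -
  assume "nz k q"
  then have "inv (aff k) q = (\<chi> l. rat (other k l) k q)"
    by (intro inv_f_eq[OF inj_aff] aff_rat)
  then show ?thesis by simp
qed

text \<open>The representative of \<open>q\<close> is scaled to the norm of \<open>x\<close> and
  rotated so that its Hermitian product with \<open>x\<close> is real and nonnegative. Then |x -
  y|^2 = 2 |x|^2 (1 - cos t), where \<open>t\<close> is the Fubini-Study distance. It follows that
  \<open>proj\<close> is an open map.\<close>

lemma proj_near: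
  assumes x: "x \<noteq> 0" and e: "e > 0"
  obtains d where "d > 0" "\<And>q. dist (proj x) q < d \<Longrightarrow> \<exists>y. y \<noteq> 0 \<and> proj y = q \<and> dist x y < e"
proof -
  have "isCont (\<lambda>t. 2 * (norm x)\<^sup>2 * (1 - cos t)) 0" by (intro continuous_intros)
  then have "\<forall>\<^sub>F t in at 0. dist (2 * (norm x)\<^sup>2 * (1 - cos t)) (2 * (norm x)\<^sup>2 * (1 - cos 0)) < e\<^sup>2"
    unfolding isCont_def by (rule tendstoD) (use e in simp)
  then obtain d where d: "d > 0" "\<And>t. t \<noteq> 0 \<Longrightarrow> dist t 0 < d \<Longrightarrow>
      dist (2 * (norm x)\<^sup>2 * (1 - cos t)) (2 * (norm x)\<^sup>2 * (1 - cos 0)) < e\<^sup>2"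
    unfolding eventually_at by auto
  show ?thesis
  proof (rule that[OF d(1)])
    fix q assume q: "dist (proj x) q < d"
    define y0 where "y0 = rep_cp2 q"
    define y1 where "y1 = complex_of_real (norm x / norm y0) *s y0"
    have y0: "y0 \<noteq> 0" "proj y0 = q" by (simp_all add: y0_def)
    have n1: "norm y1 = norm x" using y0 x by (simp add: y1_def norm_scale norm_divide)
    have y1: "y1 \<noteq> 0" "proj y1 = q" using n1 x y0 by (auto simp: y1_def proj_scale)
    obtain c where c: "cmod c = 1" "(c *s y1) \<bullet> x = cmod (herm y1 x)" by (rule herm_phase)
    define y where "y = c *s y1"
    have c0: "c \<noteq> 0" using c by auto
    have y: "y \<noteq> 0" "proj y = q" "norm y = norm x"
      using y1 c0 c n1 by (simp_all add: y_def proj_scale norm_scale)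
    define t where "t = dist (proj x) q"
    have t: "t = arccos (cos_angle x y1)" using dist_proj[OF x y1(1)] y1 by (simp add: t_def)
    have "cos t = cos_angle x y1"
      unfolding t using cos_angle_le_1[of x y1] cos_angle_ge_0[of x y1] by (intro cos_arccos) linarith+
    then have yx: "y \<bullet> x = (norm x)\<^sup>2 * cos t"
      using c n1 x cos_angle_commute[of x y1] by (simp add: y_def cos_angle_def power2_eq_square)
    have "(dist x y)\<^sup>2 = 2 * (norm x)\<^sup>2 * (1 - cos t)"
    proof -
      have "(dist x y)\<^sup>2 = (x - y) \<bullet> (x - y)" by (simp add: dist_norm power2_norm_eq_inner)
      also have "\<dots> = x \<bullet> x - 2 * (y \<bullet> x) + y \<bullet> y" by (simp add: inner_diff inner_commute[of x y])
      finally show ?thesis using yx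
        by (simp add: dot_square_norm y(3) algebra_simps)
    qed
    moreover have "2 * (norm x)\<^sup>2 * (1 - cos t) < e\<^sup>2"
    proof (cases "t = 0")
      case False
      have "0 \<le> 2 * (norm x)\<^sup>2 * (1 - cos t)" by (intro mult_nonneg_nonneg) auto
      then show ?thesis using d(2)[OF False] q t_def by (simp add: dist_real_def)
    qed (use e in simp)
    ultimately have "(dist x y)\<^sup>2 < e\<^sup>2" by simp
    then have "dist x y < e" using e by (simp add: power2_less_imp_less)
    then show "\<exists>y. y \<noteq> 0 \<and> proj y = q \<and> dist x y < e" using y by blast
  qed
qed

lemma open_proj_image:
  assumes "open U" "0 \<notin> U"
  shows "open (proj ` U)"
  unfolding open_dist
proof
  fix p assume "p \<in> proj ` U"
  then obtain x where x: "x \<in> U" "p = proj x" by blast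
  obtain e where e: "e > 0" "ball x e \<subseteq> U" using assms(1) x open_contains_ball by blast
  have "x \<noteq> 0" using x assms by auto
  then obtain d where d: "d > 0" "\<And>q. dist (proj x) q < d \<Longrightarrow> \<exists>y. y \<noteq> 0 \<and> proj y = q \<and> dist x y < e"
    using proj_near e(1) by blast
  have "q \<in> proj ` U" if "dist q p < d" for q
    using d(2)[of q] that e(2) by (auto simp: x(2) dist_commute subset_iff)
  then show "\<exists>e>0. \<forall>y. dist y p < e \<longrightarrow> y \<in> proj ` U" using d(1) by blast
qed

lemma open_proj_vimage: "open S \<Longrightarrow> open {x. x \<noteq> 0 \<and> proj x \<in> S}"
proof -
  assume "open S"
  then have "open (- {0} \<inter> proj -` S)" by (intro continuous_open_preimage continuous_on_proj) auto
  then show ?thesis by (simp add: vimage_def Int_def)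
qed

lemma open_iff_open_cone: "open S \<longleftrightarrow> open {x. x \<noteq> 0 \<and> proj x \<in> S}"
proof
  assume "open {x. x \<noteq> 0 \<and> proj x \<in> S}"
  then have "open (proj ` {x. x \<noteq> 0 \<and> proj x \<in> S})" by (rule open_proj_image) simp
  moreover have "proj ` {x. x \<noteq> 0 \<and> proj x \<in> S} = S"
    by (auto intro!: image_eqI[of _ _ "rep_cp2 _"])
  ultimately show "open S" by simp
qed (rule open_proj_vimage)

text \<open>\<open>proj\<close> being continuous and open, \<open>cp2\<close> carries the quotient
  topology, and continuity may be tested on the cone over \<open>S\<close>.\<close>

lemma continuous_on_descend:
  fixes \<psi> :: "cp2 \<Rightarrow> 'b::topological_space"
  assumes S: "open S" and c: "continuous_on {x. x \<noteq> 0 \<and> proj x \<in> S} (\<lambda>x. \<psi> (proj x))"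
  shows "continuous_on S \<psi>"
  unfolding continuous_on_open_vimage[OF S]
proof (intro allI impI)
  fix B :: "'b set" assume B: "open B"
  have "open ((\<lambda>x. \<psi> (proj x)) -` B \<inter> {x. x \<noteq> 0 \<and> proj x \<in> S})"
    using c B continuous_on_open_vimage[OF open_proj_vimage[OF S]] by blast
  also have "(\<lambda>x. \<psi> (proj x)) -` B \<inter> {x. x \<noteq> 0 \<and> proj x \<in> S} = {x. x \<noteq> 0 \<and> proj x \<in> \<psi> -` B \<inter> S}" by auto
  finally show "open (\<psi> -` B \<inter> S)" by (simp add: open_iff_open_cone[of "\<psi> -` B \<inter> S"])
qed

lemma open_nz: "open {q. nz k q}"
proof -
  have "{x. x \<noteq> 0 \<and> proj x \<in> {q. nz k q}} = {x. x $ k \<noteq> 0}" using nth_nonzero by (auto simp: nz_proj)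
  moreover have "open {x :: complex^3. x $ k \<noteq> 0}"
    by (intro open_Collect_neq continuous_intros)
  ultimately show ?thesis by (simp only: open_iff_open_cone)
qed

lemma continuous_on_rat: "continuous_on {q. nz k q} (rat j k)"
proof (rule continuous_on_descend[OF open_nz])
  have "continuous_on {x. x \<noteq> 0 \<and> proj x \<in> {q. nz k q}} (\<lambda>x. x $ j / x $ k)"
    by (intro continuous_intros) (auto simp: nz_proj)
  then show "continuous_on {x. x \<noteq> 0 \<and> proj x \<in> {q. nz k q}} (\<lambda>x. rat j k (proj x))"
    by (rule continuous_on_eq) (simp add: rat_proj)
qed

section \<open>Coordinate functions of a meromorphic map on the cone over its domain\<close>

abbreviation mdom :: "mero_map \<Rightarrow> cp2 set" where
  "mdom f \<equiv> dom (partial_map f)"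

definition app :: "mero_map \<Rightarrow> cp2 \<Rightarrow> cp2" where
  "app f p = the (partial_map f p)"

lemma partial_map_app: "p \<in> mdom f \<Longrightarrow> partial_map f p = Some (app f p)"
  by (auto simp: app_def)

lemma fixed_point_iff: "fixed_point f p \<longleftrightarrow> p \<in> mdom f \<and> app f p = p"
  by (auto simp: fixed_point_def app_def)

lemma holomorphic_map_app: "holomorphic_map (mdom f) (app f)"
  using holomorphic_off_finite_partial_map[of f]
  unfolding holomorphic_off_finite_def app_def[abs_def] by simp

lemma finite_indeterminacy: "finite (- mdom f)"
  using holomorphic_off_finite_partial_map[of f] by (simp add: holomorphic_off_finite_def)

lemma open_mdom: "open (mdom f)"
  using holomorphic_map_app by (simp add: holomorphic_map_def)

lemma continuous_on_app: "continuous_on (mdom f) (app f)"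
  using holomorphic_map_app by (simp add: holomorphic_map_def)

definition lift_dom :: "mero_map \<Rightarrow> 3 \<Rightarrow> (complex^3) set" where
  "lift_dom f k = {x. x \<noteq> 0 \<and> proj x \<in> mdom f \<and> nz k (app f (proj x))}"

text \<open>The coordinates of the value are read in the chart \<open>k\<close>, but the argument is
  a vector of homogeneous coordinates. Complex lines and planes are then affine subspaces, whatever
  chart of the source they cross.\<close>

definition lift :: "mero_map \<Rightarrow> 3 \<Rightarrow> 3 \<Rightarrow> complex^3 \<Rightarrow> complex" where
  "lift f j k x = rat j k (app f (proj x))"

lemma open_lift_dom: "open (lift_dom f k)"
proof -
  have "open (app f -` {q. nz k q} \<inter> mdom f)"
    using continuous_on_open_vimage[OF open_mdom] continuous_on_app open_nz by blast
  then have "open {x. x \<noteq> 0 \<and> proj x \<in> app f -` {q. nz k q} \<inter> mdom f}" by (rule open_proj_vimage)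
  also have "{x. x \<noteq> 0 \<and> proj x \<in> app f -` {q. nz k q} \<inter> mdom f} = lift_dom f k"
    by (auto simp: lift_dom_def)
  finally show ?thesis .
qed

lemma continuous_on_lift: "continuous_on (lift_dom f k) (lift f j k)"
proof -
  have 1: "continuous_on (lift_dom f k) proj"
    by (rule continuous_on_subset[OF continuous_on_proj]) (auto simp: lift_dom_def)
  have 2: "continuous_on (lift_dom f k) (\<lambda>x. app f (proj x))"
    by (rule continuous_on_compose2[OF continuous_on_app 1]) (auto simp: lift_dom_def)
  show ?thesis unfolding lift_def[abs_def]
    by (rule continuous_on_compose2[OF continuous_on_rat 2]) (auto simp: lift_dom_def)
qed

text \<open>The line is written in a chart of the source around the given point, and the chain rule
  is applied to the chart expression of \<open>f\<close>. Complex linearity of its derivative is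
  what makes the composite complex differentiable.\<close>

lemma lift_line_differentiable:
  assumes "x + t0 *s u \<in> lift_dom f k"
  shows "(\<lambda>t. lift f j k (x + t *s u)) field_differentiable at t0"
proof -
  define y where "y = x + t0 *s u"
  have y: "y \<noteq> 0" "proj y \<in> mdom f" "nz k (app f (proj y))"
    using assms by (auto simp: lift_dom_def y_def)
  obtain i where i: "y $ i \<noteq> 0" using y(1) by (auto simp: vec_eq_iff)
  \<comment> \<open>The coordinates of the moving point in the chart \<open>i\<close>, rational
    functions of \<open>t\<close>.\<close>
  define \<zeta> where "\<zeta> t = (\<chi> l. (x + t *s u) $ other i l / (x + t *s u) $ i)" for t
  have aff: "aff i (\<zeta> t) = proj (x + t *s u)" if "(x + t *s u) $ i \<noteq> 0" for t
  proof -
    have "x + t *s u \<noteq> 0" by (rule nth_nonzero[OF that])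
    then show ?thesis
      using that by (intro eq_if_rat_eq[of i]) (auto simp: nz_proj rat_proj \<zeta>_def elim!: other_exists)
  qed
  let ?F = "\<lambda>w. inv (aff k) (app f (aff i w))"
  have a0: "aff i (\<zeta> t0) = proj y" using aff[of t0] i by (simp add: y_def)
  have "complex_differentiable ?F (\<zeta> t0)"
    using holomorphic_map_app[of f] y unfolding holomorphic_map_def range_aff a0[symmetric] by auto
  then obtain F' where F': "(?F has_derivative F') (at (\<zeta> t0))" "\<And>c v. F' (c *s v) = c *s F' v"
    by (auto simp: complex_differentiable_def)
  have "\<exists>d. ((\<lambda>t. \<zeta> t $ l) has_field_derivative d) (at t0)" for l
    unfolding \<zeta>_def vec_lambda_beta
    by (rule exI, (rule derivative_eq_intros refl | use i in \<open>simp add: y_def\<close>)+)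
  then obtain v where v: "\<And>l. ((\<lambda>t. \<zeta> t $ l) has_field_derivative v l) (at t0)" by metis
  have "(\<zeta> has_derivative (\<lambda>s. s *s (\<chi> l. v l))) (at t0)"
  proof (subst has_derivative_componentwise_within, intro ballI)
    fix b :: "complex^2" assume "b \<in> Basis"
    then obtain l c where b: "b = axis l c" "c \<in> Basis" by (auto simp: Basis_vec_def)
    have "((\<lambda>t. \<zeta> t $ l) has_derivative (\<lambda>s. s * v l)) (at t0)"
      using v[of l] by (simp add: has_field_derivative_def mult_commute_abs)
    then show "((\<lambda>t. \<zeta> t \<bullet> b) has_derivative (\<lambda>s. (s *s (\<chi> l. v l)) \<bullet> b)) (at t0)"
      by (simp add: b inner_axis has_derivative_inner_left)
  qed
  from has_derivative_compose[OF this F'(1)]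
  have Fd: "((\<lambda>t. ?F (\<zeta> t)) has_derivative (\<lambda>s. s *s F' (\<chi> l. v l))) (at t0)" by (simp add: F'(2))
  have D: "((\<lambda>t. ?F (\<zeta> t) $ l) has_field_derivative F' (\<chi> l. v l) $ l) (at t0)" for l
  proof -
    have "((\<lambda>t. ?F (\<zeta> t) $ l) has_derivative (\<lambda>s. (s *s F' (\<chi> l. v l)) $ l)) (at t0)"
      by (rule bounded_linear.has_derivative[OF bounded_linear_vec_nth Fd])
    then show ?thesis by (simp add: has_field_derivative_def mult_commute_abs)
  qed
  have oT: "open {t. x + t *s u \<in> lift_dom f k \<inter> {x. x $ i \<noteq> 0}}"
  proof -
    have "continuous_on UNIV (\<lambda>t. x + t *s u)"
      unfolding vector_scalar_mult_def by (intro continuous_intros)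
    moreover have "open (lift_dom f k \<inter> {x. x $ i \<noteq> 0})"
      by (intro open_Int open_lift_dom open_Collect_neq continuous_intros)
    ultimately have "open ((\<lambda>t. x + t *s u) -` (lift_dom f k \<inter> {x. x $ i \<noteq> 0}))"
      by (rule open_vimage[rotated])
    then show ?thesis by (simp add: vimage_def)
  qed
  have t0: "t0 \<in> {t. x + t *s u \<in> lift_dom f k \<inter> {x. x $ i \<noteq> 0}}" using assms i by (simp add: y_def)
  show ?thesis
  proof (cases "j = k")
    case True
    have "((\<lambda>t. lift f j k (x + t *s u)) has_field_derivative 0) (at t0)"
      by (rule has_field_derivative_transform_within_open[OF _ oT t0, of "\<lambda>_. 1"])
         (auto simp: True lift_def lift_dom_def rat_self)
    then show ?thesis by (auto simp: field_differentiable_def)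
  next
    case False
    then obtain l where l: "j = other k l" by (rule other_exists)
    have "((\<lambda>t. lift f j k (x + t *s u)) has_field_derivative F' (\<chi> l. v l) $ l) (at t0)"
      by (rule has_field_derivative_transform_within_open[OF D[of l] oT t0])
         (auto simp: l lift_def lift_dom_def aff inv_aff_nth)
    then show ?thesis by (auto simp: field_differentiable_def)
  qed
qed

lemma continuous_on_affine_plane:
  fixes x u v :: "complex^3"
  shows "continuous_on S (\<lambda>(z, w). x + z *s u + w *s v)"
  unfolding case_prod_unfold vector_scalar_mult_def by (intro continuous_intros)

lemma hol2_lift:
  "hol2 {(z, w). x + z *s u + w *s v \<in> lift_dom f k} (\<lambda>z w. lift f j k (x + z *s u + w *s v))"
  unfolding hol2_def
proof (intro conjI allI impI)
  have "open ((\<lambda>(z, w). x + z *s u + w *s v) -` lift_dom f k)"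
    by (intro open_vimage open_lift_dom continuous_on_affine_plane)
  then show "open {(z, w). x + z *s u + w *s v \<in> lift_dom f k}" by (simp add: vimage_def case_prod_unfold)
  have "continuous_on {(z, w). x + z *s u + w *s v \<in> lift_dom f k}
      (\<lambda>p. lift f j k ((\<lambda>(z, w). x + z *s u + w *s v) p))"
    by (rule continuous_on_compose2[OF continuous_on_lift continuous_on_affine_plane]) auto
  then show "continuous_on {(z, w). x + z *s u + w *s v \<in> lift_dom f k}
      (\<lambda>(z, w). lift f j k (x + z *s u + w *s v))"
    by (simp add: case_prod_unfold)
  fix z w assume zw: "(z, w) \<in> {(z, w). x + z *s u + w *s v \<in> lift_dom f k}"
  show "(\<lambda>z. lift f j k (x + z *s u + w *s v)) field_differentiable at z"
    using lift_line_differentiable[of "x + w *s v" z u f k j] zw by (simp add: add_ac)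
  show "(\<lambda>w. lift f j k (x + z *s u + w *s v)) field_differentiable at w"
    using lift_line_differentiable[of "x + z *s u" w v f k j] zw by simp
qed

section \<open>Isolated indeterminacy and uniform convergence\<close>

definition cdiff :: "(complex^2 \<Rightarrow> complex) \<Rightarrow> complex^2 \<Rightarrow> bool" where
  "cdiff F z \<longleftrightarrow> (\<exists>F'. (F has_derivative F') (at z) \<and> (\<forall>c v. F' (c *s v) = c * F' v))"

lemma cdiff_const [intro]: "cdiff (\<lambda>_. c) z"
  by (auto simp: cdiff_def intro!: exI[of _ "\<lambda>_. 0"])

lemma cdiff_nth [intro]: "cdiff (\<lambda>z. z $ l) z"
  unfolding cdiff_def
  by (rule exI[of _ "\<lambda>v. v $ l"]) (auto intro: bounded_linear_imp_has_derivative bounded_linear_vec_nth)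

lemma cdiff_hom_coords [intro]: "cdiff (\<lambda>z. hom_coords i z $ j) z"
proof (cases "j = i")
  case False
  then obtain l where "j = other i l" by (rule other_exists)
  then show ?thesis by (simp add: cdiff_nth)
qed (simp add: cdiff_const)

lemma cdiff_hol2:
  assumes g: "hol2 U g" "(A z, B z) \<in> U" and A: "cdiff A z" and B: "cdiff B z"
  shows "cdiff (\<lambda>w. g (A w) (B w)) z"
proof -
  obtain A' where A': "(A has_derivative A') (at z)" "\<And>c v. A' (c *s v) = c * A' v"
    using A by (auto simp: cdiff_def)
  obtain B' where B': "(B has_derivative B') (at z)" "\<And>c v. B' (c *s v) = c * B' v"
    using B by (auto simp: cdiff_def)
  from has_derivative_compose[OF has_derivative_Pair[OF A'(1) B'(1)] hol2_has_derivative[OF g]]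
  have D: "((\<lambda>w. g (A w) (B w)) has_derivative
      (\<lambda>v. deriv (\<lambda>a. g a (B z)) (A z) * A' v + deriv (g (A z)) (B z) * B' v)) (at z)"
    by simp
  show ?thesis
    unfolding cdiff_def
    by (rule exI, rule conjI, rule D) (simp add: A' B' algebra_simps)
qed

lemma cdiff_divide:
  assumes "cdiff A z" "cdiff B z" "B z \<noteq> 0"
  shows "cdiff (\<lambda>w. A w / B w) z"
proof -
  let ?U = "UNIV \<times> (- {0 :: complex})"
  have "hol2 ?U (\<lambda>a b. a / b)"
    unfolding hol2_def
    by (auto simp: case_prod_unfold intro!: open_Times open_Compl continuous_intros derivative_intros)
  then show ?thesis by (rule cdiff_hol2) (use assms in auto)
qed

lemma cdiff_transform:
  assumes "cdiff F z" "open S" "z \<in> S" "\<And>w. w \<in> S \<Longrightarrow> F w = G w"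
  shows "cdiff G z"
  using assms has_derivative_transform_within_open unfolding cdiff_def by blast

lemma complex_differentiable_if_cdiff:
  fixes F :: "complex^2 \<Rightarrow> complex^2"
  assumes "\<And>l. cdiff (\<lambda>w. F w $ l) z"
  shows "complex_differentiable F z"
proof -
  obtain F' where F': "\<And>l. ((\<lambda>w. F w $ l) has_derivative F' l) (at z)" "\<And>l c v. F' l (c *s v) = c * F' l v"
    using assms unfolding cdiff_def by metis
  have "(F has_derivative (\<lambda>v. \<chi> l. F' l v)) (at z)"
  proof (subst has_derivative_componentwise_within, intro ballI)
    fix b :: "complex^2" assume "b \<in> Basis"
    then obtain l c where b: "b = axis l c" "c \<in> Basis" by (auto simp: Basis_vec_def)
    show "((\<lambda>t. F t \<bullet> b) has_derivative (\<lambda>v. (\<chi> l. F' l v) \<bullet> b)) (at z)"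
      using F'(1)[of l] by (simp add: b inner_axis has_derivative_inner_left)
  qed
  moreover have "\<forall>c v. (\<chi> l. F' l (c *s v)) = c *s (\<chi> l. F' l v)" by (simp add: vec_eq_iff F'(2))
  ultimately show ?thesis unfolding complex_differentiable_def by blast
qed

definition vec2 :: "complex \<Rightarrow> complex \<Rightarrow> complex^2" where
  "vec2 a b = (\<chi> l. if l = 1 then a else b)"

lemma vec2_nth [simp]: "vec2 a b $ 1 = a" "vec2 a b $ 2 = b"
  by (simp_all add: vec2_def)

lemma hom_coords_affine: "hom_coords i (vec2 a b) = axis i 1 + a *s axis (other i 1) 1 + b *s axis (other i 2) 1"
  using exhaust_3[of i] by (auto simp: vec_eq_iff forall_3 hom_coords_nth other_def axis_def)

lemma aff_eqI:
  "nz k q \<Longrightarrow> rat (other k 1) k q = a \<Longrightarrow> rat (other k 2) k q = b \<Longrightarrow> q = aff k (vec2 a b)"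
  by (rule eq_if_rat_eq[of k]) (auto elim!: other_exists, metis exhaust_2 vec2_nth)

text \<open>The map is given from the chart \<open>i\<close> to the chart \<open>k\<close>, while
  \<open>holomorphic_map\<close> tests every pair of charts. Passing through homogeneous coordinates
  \<open>H\<close> of the value reduces the other pairs to quotients of complex differentiable
  functions.\<close>

lemma holomorphic_map_in_coordinates:
  assumes G1: "hol2 B G1" and G2: "hol2 B G2"
  shows "holomorphic_map {q. nz i q \<and> (rat (other i 1) i q, rat (other i 2) i q) \<in> B}
    (\<lambda>q. aff k (vec2 (G1 (rat (other i 1) i q) (rat (other i 2) i q)) (G2 (rat (other i 1) i q) (rat (other i 2) i q))))"
    (is "holomorphic_map ?V ?h")
proof -
  let ?a = "\<lambda>q. (rat (other i 1) i q, rat (other i 2) i q)"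
  have oB: "open B" using G1 by (simp add: hol2_def)
  have ca: "continuous_on {q. nz i q} ?a" by (intro continuous_intros continuous_on_rat)
  have oV: "open ?V"
  proof -
    have "open (?a -` B \<inter> {q. nz i q})"
      using continuous_on_open_vimage[OF open_nz] ca oB by blast
    also have "?a -` B \<inter> {q. nz i q} = ?V" by auto
    finally show ?thesis .
  qed
  have caV: "continuous_on ?V ?a" by (rule continuous_on_subset[OF ca]) auto
  have cG: "continuous_on ?V (\<lambda>q. G (fst (?a q)) (snd (?a q)))" if "hol2 B G" for G
  proof -
    have "continuous_on ?V (\<lambda>q. (\<lambda>(z, w). G z w) (?a q))"
      by (rule continuous_on_compose2[OF _ caV]) (use that in \<open>auto simp: hol2_def\<close>)
    then show ?thesis by (simp add: case_prod_unfold)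
  qed
  have "continuous_on ?V (\<lambda>q. vec2 (G1 (fst (?a q)) (snd (?a q))) (G2 (fst (?a q)) (snd (?a q))))"
    unfolding vec2_def
  proof (rule continuous_on_vec_lambda)
    fix l :: 2
    show "continuous_on ?V (\<lambda>q. if l = 1 then G1 (fst (?a q)) (snd (?a q)) else G2 (fst (?a q)) (snd (?a q)))"
      using cG[OF G1] cG[OF G2] by (cases "l = 1") auto
  qed
  then have ch: "continuous_on ?V ?h"
    by (intro continuous_on_compose2[OF continuous_on_aff]) auto
  show ?thesis
    unfolding holomorphic_map_def range_aff
  proof (intro conjI allI impI)
    fix i' j' z assume "aff i' z \<in> ?V \<and> ?h (aff i' z) \<in> {q. nz j' q}"
    then have z: "aff i' z \<in> ?V" and zj: "nz j' (?h (aff i' z))" by auto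
    define A where "A l w = hom_coords i' w $ other i l / hom_coords i' w $ i" for l w
    have hz: "hom_coords i' z $ i \<noteq> 0" using z by (auto simp: aff_def nz_proj)
    have A: "cdiff (A l) z" for l unfolding A_def[abs_def] by (intro cdiff_divide cdiff_hom_coords hz)
    have Aeq: "rat (other i l) i (aff i' w) = A l w" for l w by (simp add: A_def rat_aff')
    have AB: "(A 1 z, A 2 z) \<in> B" using z by (simp add: Aeq)
    define H where "H w = hom_coords k (vec2 (G1 (A 1 w) (A 2 w)) (G2 (A 1 w) (A 2 w)))" for w
    have H: "cdiff (\<lambda>w. H w $ m) z" for m
    proof (cases "m = k")
      case False
      then obtain l where "m = other k l" by (rule other_exists)
      then show ?thesis
        using exhaust_2[of l] cdiff_hol2[of B G1, OF G1 AB A A] cdiff_hol2[of B G2, OF G2 AB A A]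
        by (auto simp: H_def)
    qed (simp add: H_def cdiff_const)
    have hH: "?h (aff i' w) = proj (H w)" for w unfolding Aeq H_def aff_def[of k] by (rule refl)
    have H0: "H w \<noteq> 0" for w by (simp add: H_def)
    have Hj: "H z $ j' \<noteq> 0" using zj unfolding hH by (simp add: nz_proj H0)
    have oS: "open {w. aff i' w \<in> ?V \<and> nz j' (?h (aff i' w))}"
    proof -
      have "open (?h -` {q. nz j' q} \<inter> ?V)"
        using continuous_on_open_vimage[OF oV] ch open_nz by blast
      then have "open (aff i' -` (?h -` {q. nz j' q} \<inter> ?V))"
        by (rule open_vimage[OF _ continuous_on_aff])
      then show ?thesis by (simp add: vimage_def Int_def conj_ac)
    qed
    show "complex_differentiable (\<lambda>w. inv (aff j') (?h (aff i' w))) z"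
    proof (rule complex_differentiable_if_cdiff)
      fix l
      have "cdiff (\<lambda>w. H w $ other j' l / H w $ j') z" by (intro cdiff_divide H Hj)
      then show "cdiff (\<lambda>w. inv (aff j') (?h (aff i' w)) $ l) z"
      proof (rule cdiff_transform[OF _ oS])
        fix w assume "w \<in> {w. aff i' w \<in> ?V \<and> nz j' (?h (aff i' w))}"
        then have "nz j' (?h (aff i' w))" by blast
        then show "H w $ other j' l / H w $ j' = inv (aff j') (?h (aff i' w)) $ l"
          by (subst inv_aff_nth) (simp_all only: hH rat_proj[OF H0])
      qed (use z zj in blast)
    qed
  qed (use oV ch in auto)
qed

text \<open>Hartogs' theorem extends \<open>f\<close> across \<open>p\<close>, so \<open>p\<close> lies in the domain, which is maximal.\<close>

lemma mdom_if_punctured: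
  assumes V: "open V" "p \<in> V" "V - {p} \<subseteq> mdom f" and k: "\<And>q. q \<in> V - {p} \<Longrightarrow> nz k (app f q)"
  shows "p \<in> mdom f"
proof (rule ccontr)
  assume p: "p \<notin> mdom f"
  obtain i where i: "nz i p" by (rule nz_exists)
  define a0 b0 where "a0 = rat (other i 1) i p" and "b0 = rat (other i 2) i p"
  have p_eq: "p = aff i (vec2 a0 b0)" by (rule aff_eqI[OF i]) (simp_all add: a0_def b0_def)
  define \<Psi> where "\<Psi> a b = axis i 1 + a *s axis (other i 1) 1 + b *s axis (other i 2) (1 :: complex)" for a b
  have \<Psi>: "\<Psi> a b = hom_coords i (vec2 a b)" for a b by (simp add: \<Psi>_def hom_coords_affine)
  have pr: "proj (\<Psi> a b) = aff i (vec2 a b)" for a b by (simp add: \<Psi> aff_def)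
  have "open ((\<lambda>(a, b). aff i (vec2 a b)) -` V)"
  proof (rule open_vimage[OF V(1)])
    have "continuous_on UNIV (\<lambda>(a, b). \<Psi> a b)"
      unfolding \<Psi>_def by (rule continuous_on_affine_plane)
    then have "continuous_on UNIV (\<lambda>x. proj ((\<lambda>(a, b). \<Psi> a b) x))"
      by (rule continuous_on_compose2[OF continuous_on_proj]) (auto simp: \<Psi>)
    then show "continuous_on UNIV (\<lambda>(a, b). aff i (vec2 a b))" by (simp add: case_prod_unfold pr)
  qed
  moreover have "(a0, b0) \<in> (\<lambda>(a, b). aff i (vec2 a b)) -` V" using V p_eq by simp
  ultimately obtain R where R: "R > 0" "cball a0 R \<times> cball b0 R \<subseteq> (\<lambda>(a, b). aff i (vec2 a b)) -` V"
    by (rule open_prod_cball)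
  have ne: "aff i (vec2 a b) \<noteq> p" if "(a, b) \<noteq> (a0, b0)" for a b
  proof
    assume "aff i (vec2 a b) = p"
    then have "vec2 a b = vec2 a0 b0" using inj_aff unfolding p_eq by (rule injD[rotated])
    then show False using that by (metis vec2_nth)
  qed
  have sub: "ball a0 R \<times> ball b0 R - {(a0, b0)} \<subseteq>
      {(a, b). axis i 1 + a *s axis (other i 1) 1 + b *s axis (other i 2) 1 \<in> lift_dom f k}"
  proof
    fix x assume "x \<in> ball a0 R \<times> ball b0 R - {(a0, b0)}"
    then obtain a b where x: "x = (a, b)" and ab: "a \<in> ball a0 R" "b \<in> ball b0 R"
      and n: "(a, b) \<noteq> (a0, b0)" by (cases x) auto
    have "(a, b) \<in> (\<lambda>(a, b). aff i (vec2 a b)) -` V" by (rule subsetD[OF R(2)]) (use ab in auto)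
    then have "aff i (vec2 a b) \<in> V - {p}" using n ne[of a b] by auto
    then have "\<Psi> a b \<in> lift_dom f k"
      using V(3) k[of "aff i (vec2 a b)"] unfolding lift_dom_def mem_Collect_eq pr
      by (auto simp: \<Psi>)
    then show "x \<in> {(a, b). axis i 1 + a *s axis (other i 1) 1 + b *s axis (other i 2) 1 \<in> lift_dom f k}"
      by (simp add: x \<Psi>_def)
  qed
  define g where "g l a b = lift f (other k l) k (\<Psi> a b)" for l a b
  have hol: "hol2 (ball a0 R \<times> ball b0 R - {(a0, b0)}) (g l)" for l
    unfolding g_def[abs_def] \<Psi>_def
    by (rule hol2_subset[OF hol2_lift _ sub]) (intro open_Diff open_Times open_ball closed_singleton)
  define r where "r = R / 2"
  have r: "0 < r" "r < R" using R by (auto simp: r_def)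
  have "\<exists>G. hol2 (ball a0 r \<times> ball b0 r) G \<and>
      (\<forall>a b. (a, b) \<in> ball a0 r \<times> ball b0 r - {(a0, b0)} \<longrightarrow> G a b = g l a b)" for l
    by (rule hol2_extend_point[OF hol r]) blast
  then obtain G where G: "\<And>l. hol2 (ball a0 r \<times> ball b0 r) (G l)"
      "\<And>l a b. (a, b) \<in> ball a0 r \<times> ball b0 r - {(a0, b0)} \<Longrightarrow> G l a b = g l a b" by metis
  define B where "B = ball a0 r \<times> ball b0 r"
  define V' where "V' = {q. nz i q \<and> (rat (other i 1) i q, rat (other i 2) i q) \<in> B}"
  define h where "h q = aff k (vec2 (G 1 (rat (other i 1) i q) (rat (other i 2) i q))
      (G 2 (rat (other i 1) i q) (rat (other i 2) i q)))" for q
  have holh: "holomorphic_map V' h"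
    unfolding V'_def h_def[abs_def] by (rule holomorphic_map_in_coordinates) (simp_all add: G B_def)
  have pV': "p \<in> V'" using i r by (simp add: V'_def B_def a0_def b0_def)
  have V'V: "V' \<subseteq> V"
  proof
    fix q assume "q \<in> V'"
    then have q: "nz i q" "(rat (other i 1) i q, rat (other i 2) i q) \<in> B" by (auto simp: V'_def)
    have "(rat (other i 1) i q, rat (other i 2) i q) \<in> (\<lambda>(a, b). aff i (vec2 a b)) -` V"
      by (rule subsetD[OF R(2)]) (use q(2) r in \<open>auto simp: B_def\<close>)
    then have "aff i (vec2 (rat (other i 1) i q) (rat (other i 2) i q)) \<in> V" by simp
    also have "aff i (vec2 (rat (other i 1) i q) (rat (other i 2) i q)) = q"
      by (rule aff_eqI[OF q(1) refl refl, symmetric])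
    finally show "q \<in> V" .
  qed
  have hf: "h q = app f q" if q: "q \<in> V'" "q \<noteq> p" for q
  proof -
    define a b where "a = rat (other i 1) i q" and "b = rat (other i 2) i q"
    have nq: "nz i q" and ab: "(a, b) \<in> B" using q by (auto simp: V'_def a_def b_def)
    have qeq: "q = aff i (vec2 a b)" by (rule aff_eqI[OF nq]) (simp_all add: a_def b_def)
    have "(a, b) \<noteq> (a0, b0)" using q(2) qeq p_eq by auto
    then have gg: "G l a b = g l a b" for l using G(2) ab by (simp add: B_def)
    have "nz k (app f q)" using k V'V q by blast
    then have "app f q = aff k (vec2 (g 1 a b) (g 2 a b))"
      by (rule aff_eqI) (simp_all add: g_def lift_def pr qeq)
    then show ?thesis by (simp add: h_def a_def[symmetric] b_def[symmetric] gg)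
  qed
  \<comment> \<open>Only the value at \<open>p\<close> is new, since \<open>h\<close> agrees with
    \<open>f\<close> on the rest of \<open>V'\<close>. If \<open>p\<close> were outside the domain,
    \<open>pm\<close> would be a proper holomorphic extension of \<open>f\<close>.\<close>
  define pm where "pm = (partial_map f)(p \<mapsto> h p)"
  have dom_pm: "dom pm = mdom f \<union> V'" using V(3) V'V pV' by (auto simp: pm_def)
  have "holomorphic_map (mdom f) (\<lambda>q. the (pm q))"
    by (rule holomorphic_map_cong[OF holomorphic_map_app open_mdom subset_refl])
       (use p in \<open>auto simp: pm_def app_def\<close>)
  moreover have "holomorphic_map V' (\<lambda>q. the (pm q))"
  proof (rule holomorphic_map_cong[OF holh _ subset_refl])
    show "open V'" using holh by (simp add: holomorphic_map_def)
    show "the (pm q) = h q" if "q \<in> V'" for q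
      using hf[OF that] by (auto simp: pm_def app_def)
  qed
  ultimately have "holomorphic_map (dom pm) (\<lambda>q. the (pm q))"
    unfolding dom_pm by (rule holomorphic_map_Un)
  moreover have "finite (- dom pm)"
    by (rule finite_subset[OF _ finite_indeterminacy[of f]]) (auto simp: pm_def)
  ultimately have "holomorphic_off_finite pm" by (simp add: holomorphic_off_finite_def)
  moreover have "partial_map f \<subseteq>\<^sub>m pm" using p by (auto simp: pm_def map_le_def)
  ultimately have "pm = partial_map f" by (rule partial_map_maximal)
  then have "partial_map f p = Some (h p)" by (metis fun_upd_same pm_def)
  then show False using p by (simp add: domIff)
qed

section \<open>From Hausdorff closeness of graphs to uniform closeness\<close>

lemma app_in_graph: "p \<in> mdom f \<Longrightarrow> (p, app f p) \<in> graph_of f"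
  unfolding graph_of_def by (rule subsetD[OF closure_subset]) (simp add: Map.graph_def partial_map_app)

lemma app_if_in_graph: "p \<in> mdom f \<Longrightarrow> (p, q) \<in> graph_of f \<Longrightarrow> q = app f p"
  using graph_of_on_dom[of p f q] partial_map_app[of p f] by simp

lemma graph_near:
  assumes "dist g f < e" "p \<in> mdom g"
  obtains p' q' where "(p', q') \<in> graph_of f" "dist p p' < e" "dist (app g p) q' < e"
proof -
  have "infdist (p, app g p) (graph_of f) < e"
    using infdist_le_hausdorff_dist[OF bounded_cp2_prod graph_of_nonempty app_in_graph[OF assms(2)], of f] assms(1)
    by (simp add: dist_mero_map_def)
  then obtain x where "x \<in> graph_of f" "dist (p, app g p) x < e"
    unfolding infdist_notempty[OF graph_of_nonempty]
    by (subst (asm) cINF_less_iff) (auto simp: graph_of_nonempty)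
  then show ?thesis
    using that[of "fst x" "snd x"] dist_fst_le[of "(p, app g p)" x] dist_snd_le[of "(p, app g p)" x] by simp
qed

text \<open>Otherwise bad points converge to some \<open>q0\<close>. Near \<open>q0\<close> the
  graph of \<open>f\<close> lies over a small ball around \<open>app f q0\<close>, so a close map
  has its values in the same chart wherever it is defined, and \<open>mdom_if_punctured\<close> puts
  the bad point into its domain. Continuity of \<open>f\<close> at \<open>q0\<close> then compares
  the two values at the same point.\<close>

lemma uniformly_near_on_compact:
  assumes K: "compact K" "K \<subseteq> mdom f" and \<epsilon>: "\<epsilon> > 0"
  obtains e where "e > 0" "\<And>g. dist g f < e \<Longrightarrow> K \<subseteq> mdom g \<and> (\<forall>q\<in>K. dist (app g q) (app f q) < \<epsilon>)"
proof -
  have "\<exists>e>0. \<forall>g. dist g f < e \<longrightarrow> (\<forall>q\<in>K. q \<in> mdom g \<and> dist (app g q) (app f q) < \<epsilon>)"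
  proof (rule ccontr)
    assume "\<not> ?thesis"
    then have "\<exists>g q. dist g f < inverse (real (Suc n)) \<and> q \<in> K \<and> \<not> (q \<in> mdom g \<and> dist (app g q) (app f q) < \<epsilon>)" for n
      by (metis inverse_positive_iff_positive of_nat_0_less_iff zero_less_Suc)
    then obtain g q where gq: "\<And>n. dist (g n) f < inverse (real (Suc n))" "\<And>n. q n \<in> K"
      "\<And>n. \<not> (q n \<in> mdom (g n) \<and> dist (app (g n) (q n)) (app f (q n)) < \<epsilon>)" by metis
    obtain q0 \<sigma> where q0: "q0 \<in> K" "strict_mono \<sigma>" "(q \<circ> \<sigma>) \<longlonglongrightarrow> q0"
      using K(1) gq(2) unfolding compact_def by blast
    have q0f: "q0 \<in> mdom f" using q0 K by blast
    obtain k where k: "nz k (app f q0)" by (rule nz_exists)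
    obtain \<eta>' where \<eta>': "\<eta>' > 0" "ball (app f q0) \<eta>' \<subseteq> {q. nz k q}"
      using open_nz k open_contains_ball by blast
    \<comment> \<open>Values of the close map come within \<open>2 * \<eta>\<close> of
      \<open>app f q0\<close>, hence into the chart, and within \<open>3 * \<eta>\<close> of the
      value of \<open>f\<close> at the same point.\<close>
    define \<eta> where "\<eta> = min \<eta>' \<epsilon> / 4"
    have \<eta>: "\<eta> > 0" "2 * \<eta> < \<eta>'" "3 * \<eta> < \<epsilon>" using \<eta>' \<epsilon> by (auto simp: \<eta>_def)
    have "open (app f -` ball (app f q0) \<eta> \<inter> mdom f)"
      using continuous_on_open_vimage[OF open_mdom] continuous_on_app open_ball by blast
    moreover have "q0 \<in> app f -` ball (app f q0) \<eta> \<inter> mdom f" using \<eta> q0f by simp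
    ultimately obtain \<rho>' where \<rho>': "\<rho>' > 0" "ball q0 \<rho>' \<subseteq> app f -` ball (app f q0) \<eta> \<inter> mdom f"
      by (meson open_contains_ball)
    \<comment> \<open>Half the radius leaves room for the shift from a point to the nearby base
      point of the graph of \<open>f\<close>.\<close>
    define \<rho> where "\<rho> = \<rho>' / 2"
    have \<rho>: "\<rho> > 0" using \<rho>' by (simp add: \<rho>_def)
    have "\<forall>\<^sub>F n in sequentially. dist ((q \<circ> \<sigma>) n) q0 < \<rho>" using q0(3) \<rho> by (rule tendstoD)
    moreover have "\<forall>\<^sub>F n in sequentially. inverse (real (Suc n)) < min \<rho> \<eta>"
      by (rule order_tendstoD[OF LIMSEQ_inverse_real_of_nat]) (use \<rho> \<eta> in simp)
    ultimately have "\<forall>\<^sub>F n in sequentially. dist ((q \<circ> \<sigma>) n) q0 < \<rho> \<and> inverse (real (Suc n)) < min \<rho> \<eta>"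
      by (rule eventually_conj)
    then obtain n where n: "dist (q (\<sigma> n)) q0 < \<rho>" "inverse (real (Suc n)) < min \<rho> \<eta>"
      by (auto simp: eventually_sequentially)
    define G where "G = g (\<sigma> n)"
    define x where "x = q (\<sigma> n)"
    have "inverse (real (Suc (\<sigma> n))) \<le> inverse (real (Suc n))"
      using seq_suble[OF q0(2), of n] by (intro le_imp_inverse_le) auto
    then have G: "dist G f < min \<rho> \<eta>" using gq(1)[of "\<sigma> n"] n(2) unfolding G_def by linarith
    have near: "dist (app G r) (app f q0) < 2 * \<eta>" if r: "r \<in> ball q0 \<rho>" "r \<in> mdom G" for r
    proof -
      obtain p' q' where pq: "(p', q') \<in> graph_of f" "dist r p' < min \<rho> \<eta>" "dist (app G r) q' < min \<rho> \<eta>"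
        using graph_near[OF G r(2)] .
      have "dist q0 p' < \<rho>'"
        using r(1) pq(2) dist_triangle[of q0 p' r] by (simp add: \<rho>_def)
      then have p': "p' \<in> mdom f" "dist (app f q0) (app f p') < \<eta>" using \<rho>'(2) by (auto simp: subset_iff)
      have "q' = app f p'" by (rule app_if_in_graph[OF p'(1) pq(1)])
      then show ?thesis
        using pq(3) p'(2) dist_triangle2[of "app G r" "app f q0" "app f p'"] by simp
    qed
    have x: "x \<in> ball q0 \<rho>" using n(1) by (simp add: x_def dist_commute)
    have xG: "x \<in> mdom G"
    proof (rule mdom_if_punctured)
      \<comment> \<open>The other indeterminacy points of \<open>G\<close> are taken out of the
        ball, so that \<open>x\<close> is the only possible puncture.\<close>
      show "open (ball q0 \<rho> - (- mdom G - {x}))"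
        using finite_indeterminacy[of G] by (intro open_Diff open_ball finite_imp_closed finite_Diff)
      show "nz k (app G r)" if "r \<in> ball q0 \<rho> - (- mdom G - {x}) - {x}" for r
      proof -
        have "dist (app G r) (app f q0) < \<eta>'" using near[of r] that \<eta> by fastforce
        then show ?thesis using \<eta>'(2) by (auto simp: subset_iff dist_commute)
      qed
    qed (use x in auto)
    have "dist (app f x) (app f q0) < \<eta>"
    proof -
      have "x \<in> ball q0 \<rho>'" using x \<rho> by (simp add: \<rho>_def)
      then show ?thesis using \<rho>'(2) by (auto simp: subset_iff dist_commute)
    qed
    then have "dist (app G x) (app f x) < \<epsilon>"
      using near[OF x xG] dist_triangle2[of "app G x" "app f x" "app f q0"] \<eta> by linarith
    then show False using gq(3)[of "\<sigma> n"] xG by (simp add: x_def G_def)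
  qed
  then show ?thesis using that by blast
qed

section \<open>Rationality on lines\<close>

text \<open>The identity theorem in the form used for open-closed arguments: the centre
  \<open>c\<close> is only known to be a limit of the open set \<open>T\<close> on which
  \<open>f\<close> vanishes.\<close>

lemma holomorphic_zero_on_ball:
  assumes f: "f holomorphic_on ball c r" and r: "r > 0" and T: "open T" "c \<in> closure T"
    and zero: "\<And>t. t \<in> ball c r \<Longrightarrow> t \<in> T \<Longrightarrow> f t = 0" and t: "t \<in> ball c r"
  shows "f t = 0"
proof -
  have "ball c r \<inter> T \<noteq> {}"
    using T(2) r unfolding closure_approachable by (auto simp: dist_commute disjoint_iff)
  then obtain p where p: "p \<in> ball c r \<inter> T" by blast
  have "p islimpt (ball c r \<inter> T)"
    using p T(1) by (intro interior_limit_point) (auto simp: interior_open open_Int)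
  then show ?thesis
    using analytic_continuation[OF f open_ball connected_ball, of "ball c r \<inter> T" p t] p t zero by auto
qed

lemma UNIV_if_open_closed:
  fixes T :: "complex set"
  assumes "open T" "T \<noteq> {}" "\<And>t. t \<in> closure T \<Longrightarrow> t \<in> T"
  shows "T = UNIV"
proof -
  have "closure T = T" using assms(3) closure_subset by blast
  then have "closed T" by (metis closed_closure)
  then show ?thesis using assms(1,2) connected_clopen[of "UNIV :: complex set"] by auto
qed

text \<open>The point \<open>p\<close> shows that \<open>b\<close> does not vanish identically, so
  near \<open>c\<close> it is a power of \<open>t - c\<close> times a zero-free function, and
  \<open>a / b\<close> has at most a pole of that order.\<close>

lemma quotient_order_bound:
  assumes a: "a holomorphic_on ball c r" and b: "b holomorphic_on ball c r" and p: "p \<in> ball c r" "b p \<noteq> 0"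
  obtains r' m C where "0 < r'" "r' \<le> r" "\<And>t. t \<in> ball c r' - {c} \<Longrightarrow> b t \<noteq> 0"
    "\<And>t. t \<in> ball c r' - {c} \<Longrightarrow> cmod (a t / b t) * cmod (t - c) ^ m \<le> C"
proof -
  have r: "r > 0" using le_less_trans[OF zero_le_dist] p(1) by (auto simp del: zero_le_dist)
  have cr: "c \<in> ball c r" using r by simp
  have "\<exists>g r' n. 0 < r' \<and> r' \<le> r \<and> g holomorphic_on ball c r' \<and>
    (\<forall>w\<in>ball c r'. b w = (w - c) ^ n * g w \<and> g w \<noteq> 0)"
  proof (cases "b c = 0")
    case True
    have "\<not> b constant_on ball c r" using True p cr unfolding constant_on_def by metis
    then obtain g r' n where "0 < r'" "ball c r' \<subseteq> ball c r" "g holomorphic_on ball c r'"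
      "\<And>w. w \<in> ball c r' \<Longrightarrow> b w = (w - c) ^ n * g w" "\<And>w. w \<in> ball c r' \<Longrightarrow> g w \<noteq> 0"
      using holomorphic_factor_zero_nonconstant[OF b open_ball connected_ball cr True] by metis
    then show ?thesis by (intro exI[of _ g] exI[of _ "r'"] exI[of _ n]) (auto simp: ball_subset_ball_iff)
  next
    case False
    have "open (ball c r \<inter> b -` (- {0}))"
      using b by (intro continuous_open_preimage holomorphic_on_imp_continuous_on) auto
    moreover have "c \<in> ball c r \<inter> b -` (- {0})" using False cr by simp
    ultimately obtain r' where "0 < r'" "ball c r' \<subseteq> ball c r \<inter> b -` (- {0})"
      by (meson open_contains_ball)
    then show ?thesis
      by (intro exI[of _ b] exI[of _ "r'"] exI[of _ 0])
         (auto simp: ball_subset_ball_iff intro: holomorphic_on_subset[OF b])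
  qed
  then obtain g r' n where g: "0 < r'" "r' \<le> r" "g holomorphic_on ball c r'"
    "\<And>w. w \<in> ball c r' \<Longrightarrow> b w = (w - c) ^ n * g w" "\<And>w. w \<in> ball c r' \<Longrightarrow> g w \<noteq> 0" by blast
  have "continuous_on (cball c (r' / 2)) (\<lambda>w. a w / g w)"
  proof -
    have "(\<lambda>w. a w / g w) holomorphic_on ball c r'"
      using g by (intro holomorphic_intros holomorphic_on_subset[OF a]) auto
    then show ?thesis
      by (rule continuous_on_subset[OF holomorphic_on_imp_continuous_on]) (use g in auto)
  qed
  then have "compact ((\<lambda>w. a w / g w) ` cball c (r' / 2))" by (intro compact_continuous_image) auto
  then obtain C where C: "\<And>w. w \<in> cball c (r' / 2) \<Longrightarrow> cmod (a w / g w) \<le> C"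
    by (meson bounded_iff compact_imp_bounded imageI)
  show ?thesis
  proof (rule that[of "r' / 2" n C])
    fix t assume t: "t \<in> ball c (r' / 2) - {c}"
    then have t': "t \<in> ball c r'" "t \<in> cball c (r' / 2)" "t \<noteq> c" using g by auto
    then show "b t \<noteq> 0" using g(4,5) by simp
    have "cmod (a t / b t) * cmod (t - c) ^ n = cmod (a t / g t)"
      using g(4)[OF t'(1)] g(5)[OF t'(1)] t'(3) by (simp add: norm_divide norm_mult norm_power)
    then show "cmod (a t / b t) * cmod (t - c) ^ n \<le> C" using C[OF t'(2)] by simp
  qed (use g in auto)
qed

lemma norm_poly_le:
  fixes p :: "complex poly"
  assumes "1 \<le> cmod z"
  shows "cmod (poly p z) \<le> (\<Sum>i\<le>degree p. cmod (coeff p i)) * cmod z ^ degree p"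
proof -
  have "cmod (poly p z) \<le> (\<Sum>i\<le>degree p. cmod (coeff p i * z ^ i))"
    unfolding poly_altdef by (rule norm_sum)
  also have "\<dots> \<le> (\<Sum>i\<le>degree p. cmod (coeff p i) * cmod z ^ degree p)"
    using assms by (intro sum_mono) (auto simp: norm_mult norm_power intro!: mult_left_mono power_increasing)
  finally show ?thesis by (simp add: sum_distrib_right)
qed

text \<open>The set \<open>T\<close> consists of the points of the plane where the meromorphic function \<open>h\<close> is finite.\<close>

lemma rational_if_meromorphic_on_sphere:
  assumes T: "open T" "T \<noteq> {}" and h: "h holomorphic_on T"
    and local: "\<And>c. \<exists>r a b. r > 0 \<and> a holomorphic_on ball c r \<and> b holomorphic_on ball c r \<and>
      (\<forall>t\<in>ball c r. (t \<in> T \<longleftrightarrow> b t \<noteq> 0) \<and> (b t \<noteq> 0 \<longrightarrow> h t = a t / b t))"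
    and infinity: "\<exists>r a b. r > 0 \<and> a holomorphic_on ball 0 r \<and> b holomorphic_on ball 0 r \<and>
      (\<forall>s\<in>ball 0 r - {0}. (inverse s \<in> T \<longleftrightarrow> b s \<noteq> 0) \<and> (b s \<noteq> 0 \<longrightarrow> h (inverse s) = a s / b s))"
  obtains p q where "q \<noteq> 0" "\<And>t. t \<in> T \<Longrightarrow> poly q t * h t = poly p t"
proof -
  \<comment> \<open>Where \<open>- T\<close> accumulates from its interior, the local denominator
    vanishes identically. So the interior of \<open>- T\<close> is also closed, and it is not the
    whole plane because \<open>T\<close> is nonempty.\<close>
  have no_interior: "interior (- T) = {}"
  proof (rule ccontr)
    assume ne: "interior (- T) \<noteq> {}"
    have "interior (- T) = UNIV"
    proof (rule UNIV_if_open_closed[OF open_interior ne])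
      fix c assume c: "c \<in> closure (interior (- T))"
      obtain r a b where rab: "r > 0" "b holomorphic_on ball c r" "\<And>t. t \<in> ball c r \<Longrightarrow> t \<in> T \<longleftrightarrow> b t \<noteq> 0"
        using local[of c] by metis
      have "b t = 0" if "t \<in> ball c r" for t
        by (rule holomorphic_zero_on_ball[OF rab(2,1) open_interior c _ that])
           (use rab(3) interior_subset in blast)
      then have "ball c r \<subseteq> - T" using rab(3) by blast
      then show "c \<in> interior (- T)" using rab(1) by (meson centre_in_ball interior_maximal open_ball subsetD)
    qed
    then show False using T(2) interior_subset[of "- T"] by blast
  qed
  have ball_T: "\<exists>p\<in>ball c r. p \<in> T" if "r > 0" for c r
  proof (rule ccontr)
    assume "\<not> ?thesis"
    then have "ball c r \<subseteq> interior (- T)" by (intro interior_maximal) auto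
    then show False using no_interior that by simp
  qed
  have bound: "\<exists>r m C. r > 0 \<and> (\<forall>t\<in>ball c r - {c}. t \<in> T \<and> cmod (h t) * cmod (t - c) ^ m \<le> C)" for c
  proof -
    obtain r a b where rab: "r > 0" "a holomorphic_on ball c r" "b holomorphic_on ball c r"
      "\<And>t. t \<in> ball c r \<Longrightarrow> (t \<in> T \<longleftrightarrow> b t \<noteq> 0) \<and> (b t \<noteq> 0 \<longrightarrow> h t = a t / b t)"
      using local[of c] by metis
    obtain p where "p \<in> ball c r" "b p \<noteq> 0" using ball_T[OF rab(1), of c] rab(4) by blast
    then obtain r' m C where *: "0 < r'" "r' \<le> r" "\<And>t. t \<in> ball c r' - {c} \<Longrightarrow> b t \<noteq> 0"
      "\<And>t. t \<in> ball c r' - {c} \<Longrightarrow> cmod (a t / b t) * cmod (t - c) ^ m \<le> C"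
      using quotient_order_bound[OF rab(2,3)] by metis
    have "t \<in> T \<and> cmod (h t) * cmod (t - c) ^ m \<le> C" if t: "t \<in> ball c r' - {c}" for t
    proof -
      have "t \<in> ball c r" using t *(2) by auto
      then show ?thesis using rab(4)[of t] *(3,4)[OF t] by auto
    qed
    then show ?thesis using *(1) by blast
  qed
  have "\<exists>R m C. \<forall>t. cmod t > R \<longrightarrow> t \<in> T \<and> cmod (h t) \<le> C * cmod t ^ m"
  proof -
    obtain r a b where rab: "r > 0" "a holomorphic_on ball 0 r" "b holomorphic_on ball 0 r"
      "\<And>s. s \<in> ball 0 r - {0} \<Longrightarrow> (inverse s \<in> T \<longleftrightarrow> b s \<noteq> 0) \<and> (b s \<noteq> 0 \<longrightarrow> h (inverse s) = a s / b s)"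
      using infinity by metis
    \<comment> \<open>Every point of this ball has modulus above \<open>1 / r\<close>, so its
      inverse lies in the disc of radius \<open>r\<close>. A point of \<open>T\<close> in it shows
      that the denominator at infinity is not identically zero.\<close>
    obtain p where p: "p \<in> ball (of_real (2 / r)) (1 / r)" "p \<in> T" using ball_T[of "1 / r" "of_real (2 / r)"] rab(1) by auto
    have "cmod (of_real (2 / r)) - cmod p \<le> cmod (of_real (2 / r) - p)" by (rule norm_triangle_ineq2)
    then have "cmod p > 1 / r" using p(1) rab(1) by (simp add: dist_norm norm_divide)
    moreover have "1 / r > 0" using rab(1) by simp
    ultimately have pn: "p \<noteq> 0" "inverse p \<in> ball 0 r - {0}"
    proof -
      show "p \<noteq> 0" using \<open>cmod p > 1 / r\<close> \<open>1 / r > 0\<close> by auto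
      have "inverse (cmod p) < inverse (1 / r)"
        by (rule less_imp_inverse_less) fact+
      then show "inverse p \<in> ball 0 r - {0}" using \<open>p \<noteq> 0\<close> by (simp add: norm_inverse)
    qed
    then have "b (inverse p) \<noteq> 0" using rab(4)[of "inverse p"] p(2) by simp
    then obtain r' m C where *: "0 < r'" "r' \<le> r" "\<And>t. t \<in> ball 0 r' - {0} \<Longrightarrow> b t \<noteq> 0"
      "\<And>t. t \<in> ball 0 r' - {0} \<Longrightarrow> cmod (a t / b t) * cmod (t - 0) ^ m \<le> C"
      using quotient_order_bound[OF rab(2,3), of "inverse p"] pn(2) by auto
    have "t \<in> T \<and> cmod (h t) \<le> C * cmod t ^ m" if t: "cmod t > 1 / r'" for t
    proof -
      have "cmod t > 0" using t *(1) by (meson less_trans zero_less_divide_1_iff)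
      then have "t \<noteq> 0" by auto
      have "inverse (cmod t) < inverse (1 / r')"
        by (rule less_imp_inverse_less[OF t]) (use *(1) in simp)
      then have t': "inverse t \<in> ball 0 r' - {0}" "t \<noteq> 0" using \<open>t \<noteq> 0\<close> by (simp_all add: norm_inverse)
      then have "inverse t \<in> ball 0 r - {0}" using *(2) by auto
      from rab(4)[OF this] *(3)[OF t'(1)] have h: "t \<in> T" "h t = a (inverse t) / b (inverse t)" by auto
      have "cmod (h t) = (cmod (h t) * inverse (cmod t) ^ m) * cmod t ^ m"
        using t'(2) by (simp add: power_inverse)
      also have "\<dots> \<le> C * cmod t ^ m"
        using *(4)[OF t'(1)] by (intro mult_right_mono) (simp_all add: h(2) norm_inverse)
      finally show ?thesis using h(1) by simp
    qed
    then show ?thesis by blast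
  qed
  then obtain R m C where RmC: "\<And>t. cmod t > R \<Longrightarrow> t \<in> T \<and> cmod (h t) \<le> C * cmod t ^ m" by blast
  have fin: "finite (- T)"
  proof (rule ccontr)
    assume inf: "infinite (- T)"
    have "- T \<subseteq> cball 0 R"
    proof
      fix t assume "t \<in> - T"
      then have "\<not> cmod t > R" using RmC by auto
      then show "t \<in> cball 0 R" by simp
    qed
    then obtain c where "c islimpt - T"
      using compact_cball[of "0 :: complex" R] inf by (metis compact_eq_Bolzano_Weierstrass)
    moreover obtain r where "r > 0" "\<forall>t\<in>ball c r - {c}. t \<in> T" using bound[of c] by blast
    ultimately show False
      unfolding islimpt_approachable by (metis ComplD Diff_iff dist_commute mem_ball singletonD)
  qed
  obtain \<rho> M K where bnd: "\<And>c. \<rho> c > 0" "\<And>c t. t \<in> ball c (\<rho> c) - {c} \<Longrightarrow> cmod (h t) * cmod (t - c) ^ M c \<le> K c"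
    using bound by metis
  \<comment> \<open>The finitely many poles are cleared with their order bounds; the product with
    \<open>h\<close> is then bounded near each of them and extends to an entire function.\<close>
  define Q where "Q = (\<Prod>c\<in>- T. [:- c, 1:] ^ M c)"
  have Q0: "Q \<noteq> 0" using fin by (simp add: Q_def)
  have "\<exists>g. g holomorphic_on UNIV \<and> (\<forall>t\<in>UNIV - (- T). g t = poly Q t * h t)"
  proof (rule removable_singularities[OF fin])
    show "(\<lambda>t. poly Q t * h t) holomorphic_on UNIV - - T"
      using h by (intro holomorphic_intros) (simp add: Compl_eq_Diff_UNIV[symmetric] double_diff)
    fix c assume c: "c \<in> - T"
    define Q' where "Q' = (\<Prod>c\<in>- T - {c}. [:- c, 1:] ^ M c)"
    have QQ': "poly Q t = (t - c) ^ M c * poly Q' t" for t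
      unfolding Q_def Q'_def by (subst prod.remove[OF fin c]) (simp add: poly_power)
    have "compact (poly Q' ` cball c (\<rho> c))" by (intro compact_continuous_image continuous_intros) auto
    then obtain C' where C': "\<And>t. t \<in> cball c (\<rho> c) \<Longrightarrow> cmod (poly Q' t) \<le> C'"
      by (meson bounded_iff compact_imp_bounded imageI)
    show "(\<lambda>t. poly Q t * h t) \<in> O[at c](\<lambda>_. 1)"
    proof (rule bigoI[where c = "K c * C'"])
      have "cmod (poly Q t * h t) \<le> K c * C'" if "t \<in> ball c (\<rho> c) - {c}" for t
      proof -
        have "cmod (poly Q t * h t) = (cmod (h t) * cmod (t - c) ^ M c) * cmod (poly Q' t)"
          by (simp add: QQ' norm_mult norm_power)
        also have "\<dots> \<le> K c * C'"
        proof (rule mult_mono)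
          show "cmod (h t) * cmod (t - c) ^ M c \<le> K c" by (rule bnd(2)[OF that])
          then show "0 \<le> K c" by (rule order_trans[rotated]) simp
        qed (use that C' in auto)
        finally show ?thesis .
      qed
      then show "\<forall>\<^sub>F t in at c. norm (poly Q t * h t) \<le> K c * C' * norm (1 :: complex)"
        unfolding eventually_at using bnd(1)[of c] by (intro exI[of _ "\<rho> c"]) (auto simp: dist_commute)
    qed
  qed auto
  then obtain g where g: "g holomorphic_on UNIV" "\<And>t. t \<in> T \<Longrightarrow> g t = poly Q t * h t" by auto
  define C1 where "C1 = (\<Sum>i\<le>degree Q. cmod (coeff Q i))"
  \<comment> \<open>Polynomial growth, to which Liouville's theorem applies. The radius is at least
    1 for \<open>norm_poly_le\<close> and above \<open>R\<close> for the bound on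
    \<open>h\<close>.\<close>
  have growth: "cmod (g t) \<le> (C1 * C) * cmod t ^ (degree Q + m)" if t: "max 1 (R + 1) \<le> cmod t" for t
  proof -
    have "cmod t > R" using t by linarith
    then have T': "t \<in> T" "cmod (h t) \<le> C * cmod t ^ m" using RmC by auto
    have "cmod (g t) = cmod (poly Q t) * cmod (h t)" using g(2)[OF T'(1)] by (simp add: norm_mult)
    also have "\<dots> \<le> (C1 * cmod t ^ degree Q) * (C * cmod t ^ m)"
      unfolding C1_def using t T'(2) by (intro mult_mono norm_poly_le mult_nonneg_nonneg sum_nonneg) auto
    finally show ?thesis by (simp add: power_add mult_ac)
  qed
  define p where "p = (\<Sum>k\<le>degree Q + m. monom ((deriv ^^ k) g 0 / fact k) k)"
  have "g t = poly p t" for t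
    using Liouville_polynomial[where \<xi> = t and A = "max 1 (R + 1)", OF g(1) growth] by (simp add: p_def poly_sum poly_monom)
  then show ?thesis using that[OF Q0, of p] g(2) by simp
qed

lemma lift_dom_iff_lift_nonzero:
  assumes "y \<in> lift_dom f l"
  shows "y \<in> lift_dom f k \<longleftrightarrow> lift f k l y \<noteq> 0"
  using assms nz_iff_rat[of l "app f (proj y)" k] by (auto simp: lift_dom_def lift_def)

lemma lift_change_chart: "lift f j k y = lift f j l y / lift f k l y" if "y \<in> lift_dom f l"
  using that by (simp add: lift_def rat_def lift_dom_def nz_def)

lemma lift_dom_exists:
  assumes "y \<noteq> 0" "proj y \<in> mdom f" obtains l where "y \<in> lift_dom f l"
  using nz_exists[of "app f (proj y)"] assms that by (auto simp: lift_dom_def)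

lemma lift_line_ball:
  assumes "x + c *s u \<in> lift_dom f l"
  obtains r where "r > 0" "\<And>t. t \<in> ball c r \<Longrightarrow> x + t *s u \<in> lift_dom f l"
    "\<And>j. (\<lambda>t. lift f j l (x + t *s u)) holomorphic_on ball c r"
proof -
  have "continuous_on UNIV (\<lambda>t. x + t *s u)"
    unfolding vector_scalar_mult_def by (intro continuous_intros)
  then have "open ((\<lambda>t. x + t *s u) -` lift_dom f l)" by (rule open_vimage[OF open_lift_dom])
  then obtain r where r: "r > 0" "ball c r \<subseteq> (\<lambda>t. x + t *s u) -` lift_dom f l"
    using assms by (meson open_contains_ball vimageI2)
  then have "x + t *s u \<in> lift_dom f l" if "t \<in> ball c r" for t using that by blast
  moreover from this have "(\<lambda>t. lift f j l (x + t *s u)) holomorphic_on ball c r" for j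
    unfolding holomorphic_on_def by (auto intro!: field_differentiable_at_within lift_line_differentiable)
  ultimately show ?thesis using that[of r] r(1) by blast
qed

text \<open>The complex line closes up with the point \<open>proj u\<close> at \<open>t\<close>
  infinite. Around any of its points the map lies in some chart \<open>l\<close>, and the change of
  charts writes the \<open>j\<close>-th coordinate as a quotient of holomorphic functions, so it is
  meromorphic on the sphere.\<close>

lemma lift_rational_on_line:
  assumes u: "u \<noteq> 0" "proj u \<in> mdom f" and line: "\<And>t. x + t *s u \<noteq> 0 \<and> proj (x + t *s u) \<in> mdom f"
    and k: "x + t1 *s u \<in> lift_dom f k"
  obtains p q where "q \<noteq> 0"
    "\<And>t. x + t *s u \<in> lift_dom f k \<Longrightarrow> poly q t * lift f j k (x + t *s u) = poly p t"
proof -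
  define T where "T = {t. x + t *s u \<in> lift_dom f k}"
  have "continuous_on UNIV (\<lambda>t. x + t *s u)"
    unfolding vector_scalar_mult_def by (intro continuous_intros)
  then have "open ((\<lambda>t. x + t *s u) -` lift_dom f k)" by (rule open_vimage[OF open_lift_dom])
  then have oT: "open T" by (simp add: T_def vimage_def)
  have ne: "T \<noteq> {}" using k by (auto simp: T_def)
  have hol: "(\<lambda>t. lift f j k (x + t *s u)) holomorphic_on T"
    unfolding holomorphic_on_def T_def by (auto intro!: field_differentiable_at_within lift_line_differentiable)
  show ?thesis
  proof (rule rational_if_meromorphic_on_sphere[OF oT ne hol])
    fix c
    obtain l where l: "x + c *s u \<in> lift_dom f l" using line lift_dom_exists by metis
    obtain r where r: "r > 0" "\<And>t. t \<in> ball c r \<Longrightarrow> x + t *s u \<in> lift_dom f l"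
      "\<And>j. (\<lambda>t. lift f j l (x + t *s u)) holomorphic_on ball c r" using lift_line_ball[OF l] by metis
    show "\<exists>r a b. r > 0 \<and> a holomorphic_on ball c r \<and> b holomorphic_on ball c r \<and>
      (\<forall>t\<in>ball c r. (t \<in> T \<longleftrightarrow> b t \<noteq> 0) \<and> (b t \<noteq> 0 \<longrightarrow> lift f j k (x + t *s u) = a t / b t))"
    proof (rule exI[of _ r], rule exI[of _ "\<lambda>t. lift f j l (x + t *s u)"],
        rule exI[of _ "\<lambda>t. lift f k l (x + t *s u)"], intro conjI ballI impI r(1) r(3))
      fix t assume "t \<in> ball c r"
      then have t: "x + t *s u \<in> lift_dom f l" by (rule r(2))
      show "t \<in> T \<longleftrightarrow> lift f k l (x + t *s u) \<noteq> 0"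
        using lift_dom_iff_lift_nonzero[OF t] by (simp add: T_def)
      show "lift f j k (x + t *s u) = lift f j l (x + t *s u) / lift f k l (x + t *s u)"
        by (rule lift_change_chart[OF t])
    qed
  next
    have "u + 0 *s x \<noteq> 0" "proj (u + 0 *s x) \<in> mdom f" using u by simp_all
    then obtain l where l: "u + 0 *s x \<in> lift_dom f l" using lift_dom_exists by metis
    obtain r where r: "r > 0" "\<And>t. t \<in> ball 0 r \<Longrightarrow> u + t *s x \<in> lift_dom f l"
      "\<And>j. (\<lambda>t. lift f j l (u + t *s x)) holomorphic_on ball 0 r" using lift_line_ball[OF l] by metis
    \<comment> \<open>In the parameter \<open>s = 1 / t\<close> at infinity the line becomes
      \<open>u + s x\<close>, up to the scalar \<open>s\<close>.\<close>
    have pe: "proj (x + inverse s *s u) = proj (u + s *s x)" if "s \<noteq> 0" for s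
    proof -
      have "u + s *s x = s *s (x + inverse s *s u)"
        using that by (simp add: vector_add_ldistrib vector_smult_assoc)
      then show ?thesis using proj_scale[of "x + inverse s *s u" s] line that by metis
    qed
    have "(inverse s \<in> T \<longleftrightarrow> lift f k l (u + s *s x) \<noteq> 0) \<and>
        (lift f k l (u + s *s x) \<noteq> 0 \<longrightarrow> lift f j k (x + inverse s *s u) = lift f j l (u + s *s x) / lift f k l (u + s *s x))"
      if s: "s \<in> ball 0 r - {0}" for s
    proof -
      have s': "s \<noteq> 0" "u + s *s x \<in> lift_dom f l" using s r(2) by auto
      have "inverse s \<in> T \<longleftrightarrow> u + s *s x \<in> lift_dom f k"
        using line[of "inverse s"] pe[OF s'(1)] s'(2) by (auto simp: T_def lift_dom_def)
      moreover have "lift f j k (x + inverse s *s u) = lift f j k (u + s *s x)"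
        by (simp add: lift_def pe[OF s'(1)])
      ultimately show ?thesis
        using lift_dom_iff_lift_nonzero[OF s'(2)] lift_change_chart[OF s'(2), of j k] by metis
    qed
    then show "\<exists>r a b. r > 0 \<and> a holomorphic_on ball 0 r \<and> b holomorphic_on ball 0 r \<and>
      (\<forall>s\<in>ball 0 r - {0}. (inverse s \<in> T \<longleftrightarrow> b s \<noteq> 0) \<and>
        (b s \<noteq> 0 \<longrightarrow> lift f j k (x + inverse s *s u) = a s / b s))"
      using r(1,3) by blast
  next
    fix p q assume "q \<noteq> 0" "\<And>t. t \<in> T \<Longrightarrow> poly q t * lift f j k (x + t *s u) = poly p t"
    then show thesis using that[of q p] by (simp add: T_def)
  qed
qed

section \<open>Polynomial lifts\<close>

text \<open>Bilinear and without conjugation, unlike \<open>herm\<close>: the first argument plays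
  the role of a linear form, holomorphic in \<open>x\<close>.\<close>

definition pairing :: "complex^3 \<Rightarrow> complex^3 \<Rightarrow> complex" where
  "pairing c x = (\<Sum>k\<in>UNIV. c $ k * x $ k)"

lemma pairing_linear [simp]:
  "pairing c (x + y) = pairing c x + pairing c y" "pairing c (a *s x) = a * pairing c x"
  "pairing c (x - y) = pairing c x - pairing c y" "pairing c 0 = 0"
  "pairing (c + d) x = pairing c x + pairing d x" "pairing (a *s c) x = a * pairing c x"
  "pairing (c - d) x = pairing c x - pairing d x"
  by (simp_all add: pairing_def sum.distrib sum_subtractf algebra_simps sum_distrib_left)

lemma pairing_axis [simp]: "pairing (axis k 1) x = x $ k"
  by (simp add: pairing_def axis_def if_distrib[of "\<lambda>a. a * _"] cong: if_cong)

lemma continuous_on_pairing [continuous_intros]: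
  "continuous_on S f \<Longrightarrow> continuous_on S (\<lambda>x. pairing c (f x))"
  unfolding pairing_def by (intro continuous_intros)

text \<open>A basis of \<open>\<complex>\<^sup>3\<close> with its dual basis; the affine plane \<open>x0 + z u + w v\<close> parametrizes the complement
  of the line through \<open>proj u\<close> and \<open>proj v\<close>.\<close>

locale frame =
  fixes x0 u v \<alpha> \<beta> \<gamma> :: "complex^3"
  assumes expand: "\<And>x. x = pairing \<gamma> x *s x0 + pairing \<alpha> x *s u + pairing \<beta> x *s v"
    and dual: "pairing \<gamma> x0 = 1" "pairing \<gamma> u = 0" "pairing \<gamma> v = 0" "pairing \<alpha> x0 = 0" "pairing \<alpha> u = 1"
      "pairing \<alpha> v = 0" "pairing \<beta> x0 = 0" "pairing \<beta> u = 0" "pairing \<beta> v = 1"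
begin

definition pt :: "complex \<Rightarrow> complex \<Rightarrow> complex^3" where
  "pt z w = x0 + z *s u + w *s v"

lemma pairing_pt [simp]: "pairing \<gamma> (pt z w) = 1" "pairing \<alpha> (pt z w) = z" "pairing \<beta> (pt z w) = w"
  by (simp_all add: pt_def dual)

lemma pt_nonzero [simp]: "pt z w \<noteq> 0"
  using pairing_pt(1)[of z w] by force

lemma proj_pt_inject: "proj (pt z w) = proj (pt z' w') \<longleftrightarrow> z = z' \<and> w = w'"
proof
  assume "proj (pt z w) = proj (pt z' w')"
  then obtain c where c: "pt z' w' = c *s pt z w" by (auto simp: proj_eq_iff)
  then have "pairing \<gamma> (pt z' w') = c * pairing \<gamma> (pt z w)" "pairing \<alpha> (pt z' w') = c * pairing \<alpha> (pt z w)"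
    "pairing \<beta> (pt z' w') = c * pairing \<beta> (pt z w)" by simp_all
  then show "z = z' \<and> w = w'" by simp
qed auto

lemma proj_eq_pt: "pairing \<gamma> x \<noteq> 0 \<Longrightarrow> proj x = proj (pt (pairing \<alpha> x / pairing \<gamma> x) (pairing \<beta> x / pairing \<gamma> x))"
proof -
  assume g: "pairing \<gamma> x \<noteq> 0"
  have "pairing \<gamma> x *s pt (pairing \<alpha> x / pairing \<gamma> x) (pairing \<beta> x / pairing \<gamma> x) = x"
    using g expand[of x] by (simp add: pt_def vector_add_ldistrib vector_smult_assoc)
  then show ?thesis using proj_scale[OF pt_nonzero g] by metis
qed

lemma finite_bad_points: "finite {p. proj (pt (fst p) (snd p)) \<notin> mdom f}"
proof (rule finite_imageD)
  show "finite ((\<lambda>p. proj (pt (fst p) (snd p))) ` {p. proj (pt (fst p) (snd p)) \<notin> mdom f})"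
    by (rule finite_subset[OF _ finite_indeterminacy[of f]]) auto
  show "inj_on (\<lambda>p. proj (pt (fst p) (snd p))) {p. proj (pt (fst p) (snd p)) \<notin> mdom f}"
    by (rule inj_onI) (auto simp: proj_pt_inject prod_eq_iff)
qed

text \<open>Moving the origin inside the affine plane preserves the line at infinity, hence
  \<open>u\<close>, \<open>v\<close> and \<open>\<gamma>\<close>.\<close>

lemma frame_shift: "frame (pt z0 w0) u v (\<alpha> - z0 *s \<gamma>) (\<beta> - w0 *s \<gamma>) \<gamma>"
proof
  fix x
  have "pairing \<gamma> x *s pt z0 w0 + pairing (\<alpha> - z0 *s \<gamma>) x *s u + pairing (\<beta> - w0 *s \<gamma>) x *s v
    = pairing \<gamma> x *s x0 + pairing \<alpha> x *s u + pairing \<beta> x *s v"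
    by (simp add: pt_def vec_eq_iff algebra_simps)
  then show "x = pairing \<gamma> x *s pt z0 w0 + pairing (\<alpha> - z0 *s \<gamma>) x *s u + pairing (\<beta> - w0 *s \<gamma>) x *s v"
    using expand[of x] by simp
qed (simp_all add: dual)

lemma pt_line: "pt (z + t * a) (w + t * b) = pt z w + t *s (a *s u + b *s v)"
  by (simp add: pt_def vec_eq_iff algebra_simps)

lemma nonzero [simp]: "u \<noteq> 0" "v \<noteq> 0"
  using dual by auto

end

text \<open>Start from the two coordinate vectors that complete \<open>y\<close> to a basis and add
  multiples of \<open>y\<close>. Different multiples give different points of the projective plane,
  so some avoid the finite set \<open>I\<close>. The forms \<open>A l\<close> vanish at
  \<open>y\<close> and are unaffected by this change.\<close>

lemma frame_exists:
  assumes y: "y \<noteq> 0" and I: "finite I"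
  obtains u v \<alpha> \<beta> \<gamma> where "frame y u v \<alpha> \<beta> \<gamma>" "proj u \<notin> I" "proj v \<notin> I"
proof -
  obtain i where i: "y $ i \<noteq> 0" using y by (auto simp: vec_eq_iff)
  define A where "A l = axis (other i l) (1 :: complex) - (y $ other i l / y $ i) *s axis i 1" for l
  have A: "pairing (A l) x = x $ other i l - y $ other i l / y $ i * x $ i" for l x
    by (simp add: A_def)
  have "\<exists>s. proj (axis (other i l) 1 + s *s y) \<notin> I" for l
  proof (rule ccontr)
    assume "\<not> ?thesis"
    then have "(\<lambda>s. proj (axis (other i l) 1 + s *s y)) ` UNIV \<subseteq> I" by auto
    then have "finite ((\<lambda>s. proj (axis (other i l) 1 + s *s y)) ` UNIV)" using I finite_subset by blast
    moreover have "inj (\<lambda>s. proj (axis (other i l) 1 + s *s y))"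
    proof (rule injI)
      fix s s' assume eq: "proj (axis (other i l) 1 + s *s y) = proj (axis (other i l) 1 + s' *s y)"
      have A1: "pairing (A l) (axis (other i l) 1 + s *s y) = 1" for s
        using i by (simp add: A axis_def)
      then have "axis (other i l) 1 + s *s y \<noteq> 0" for s by (metis pairing_linear(4) zero_neq_one)
      then obtain c where c: "axis (other i l) 1 + s' *s y = c *s (axis (other i l) 1 + s *s y)"
        using eq by (auto simp: proj_eq_iff)
      then have "pairing (A l) (axis (other i l) 1 + s' *s y) = c * pairing (A l) (axis (other i l) 1 + s *s y)"
        by (simp only: pairing_linear)
      then have "c = 1" unfolding A1 by simp
      with c have "(axis (other i l) 1 + s' *s y) $ i = (axis (other i l) 1 + s *s y) $ i"
        by (simp only: vector_smult_lid)
      then show "s = s'" using i by (auto simp: axis_def)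
    qed
    ultimately have "finite (UNIV :: complex set)" by (rule finite_imageD)
    then show False using infinite_UNIV_char_0 by blast
  qed
  then obtain S where S: "\<And>l. proj (axis (other i l) 1 + S l *s y) \<notin> I" by metis
  define U where "U l = axis (other i l) 1 + S l *s y" for l
  define g where "g = (1 / y $ i) *s axis i 1 - S 1 *s A 1 - S 2 *s A 2"
  have pg: "pairing g x = x $ i / y $ i - S 1 * pairing (A 1) x - S 2 * pairing (A 2) x" for x
    by (simp add: g_def)
  have "frame y (U 1) (U 2) (A 1) (A 2) g"
  proof
    fix x
    show "x = pairing g x *s y + pairing (A 1) x *s U 1 + pairing (A 2) x *s U 2"
    proof (subst vec_eq_iff, intro allI)
      fix k
      consider "k = i" | "k = other i 1" | "k = other i 2"
        using other_exists[of k i] exhaust_2 by metis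
      then show "x $ k = (pairing g x *s y + pairing (A 1) x *s U 1 + pairing (A 2) x *s U 2) $ k"
        using i by cases (simp_all add: pg A U_def axis_def field_simps)
    qed
  qed (use i in \<open>simp_all add: pg A U_def axis_def field_simps\<close>)
  then show ?thesis using that S by (simp add: U_def)
qed

text \<open>The vanishing of a cross product: \<open>P\<close> is proportional to homogeneous
  coordinates of the value. Where \<open>P\<close> vanishes it says nothing, and it is given by
  equations, so the identity theorem can spread it.\<close>

definition cross :: "mero_map \<Rightarrow> (3 \<Rightarrow> complex) \<Rightarrow> complex^3 \<Rightarrow> bool" where
  "cross f P x \<longleftrightarrow> (\<forall>a b. P a * rep_cp2 (app f (proj x)) $ b = P b * rep_cp2 (app f (proj x)) $ a)"

lemma cross_iff_lift:
  assumes "x \<in> lift_dom f l"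
  shows "cross f P x \<longleftrightarrow> (\<forall>a b. P a * lift f b l x = P b * lift f a l x)"
  using assms by (simp add: cross_def lift_def rat_def lift_dom_def nz_def)

lemma holomorphic_on_poly2 [holomorphic_intros]:
  assumes "f holomorphic_on S" "g holomorphic_on S"
  shows "(\<lambda>x. poly2 G (f x) (g x)) holomorphic_on S"
proof -
  have "(\<lambda>x. poly p (f x)) holomorphic_on S" for p
    unfolding poly_altdef by (intro holomorphic_intros assms)
  then show ?thesis unfolding poly2_expand by (intro holomorphic_intros assms)
qed

context frame begin

text \<open>The relation spreads from an open set along complex lines that avoid the indeterminacy points.\<close>

lemma cross_everywhere:
  assumes E: "open E" "E \<noteq> {}"
    and cross: "\<And>z w. (z, w) \<in> E \<Longrightarrow> proj (pt z w) \<in> mdom f \<and> cross f (\<lambda>j. poly2 (P j) z w) (pt z w)"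
    and d: "proj (pt z1 w1) \<in> mdom f"
  shows "cross f (\<lambda>j. poly2 (P j) z1 w1) (pt z1 w1)"
proof -
  define Bad where "Bad = {p. proj (pt (fst p) (snd p)) \<notin> mdom f}"
  have fin: "finite Bad" unfolding Bad_def by (rule finite_bad_points)
  obtain z' w' where "(z', w') \<in> E" using E(2) by auto
  then obtain \<rho> where \<rho>: "\<rho> > 0" "cball z' \<rho> \<times> cball w' \<rho> \<subseteq> E" using open_prod_cball[OF E(1)] by metis
  \<comment> \<open>A first coordinate different from \<open>z1\<close>, so that the line to be
    drawn is not parallel to the \<open>w\<close>-axis.\<close>
  define z2 where "z2 = (if z' = z1 then z' + of_real \<rho> else z')"
  have z2: "z2 \<in> cball z' \<rho>" "z2 \<noteq> z1" using \<rho>(1) by (auto simp: z2_def dist_norm)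
  \<comment> \<open>For a bad point \<open>b\<close>, the height at which the line from
    \<open>(z1, w1)\<close> through \<open>b\<close> crosses \<open>z = z2\<close>. Any other height
    gives a line without bad points.\<close>
  define badw where "badw = (\<lambda>b. w1 + (snd b - w1) / (fst b - z1) * (z2 - z1)) ` Bad"
  have "infinite (ball w' \<rho> - badw)"
    using fin \<rho>(1) uncountable_infinite[OF uncountable_ball] by (intro Diff_infinite_finite) (auto simp: badw_def)
  from infinite_imp_nonempty[OF this] obtain w2 where w2: "w2 \<in> ball w' \<rho>" "w2 \<notin> badw" by blast
  define a b where "a = z2 - z1" and "b = w2 - w1"
  define y where "y = a *s u + b *s v"
  have pt_t: "pt (z1 + t * a) (w1 + t * b) = pt z1 w1 + t *s y" for t by (simp add: pt_line y_def)
  have dom: "proj (pt z1 w1 + t *s y) \<in> mdom f" for t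
  proof (rule ccontr)
    assume no: "\<not> ?thesis"
    then have "(z1 + t * a, w1 + t * b) \<in> Bad" by (simp add: Bad_def pt_t)
    then have in_badw: "w1 + (t * b) / (t * a) * (z2 - z1) \<in> badw"
      unfolding badw_def by (rule rev_image_eqI) simp
    have "t \<noteq> 0" using no d by auto
    then have "w1 + (t * b) / (t * a) * (z2 - z1) = w2" using z2(2) by (simp add: a_def b_def)
    then show False using in_badw w2(2) by simp
  qed
  have nonz: "pt z1 w1 + t *s y \<noteq> 0" for t unfolding pt_t[symmetric] by simp
  define C where "C t \<longleftrightarrow> cross f (\<lambda>j. poly2 (P j) (z1 + t * a) (w1 + t * b)) (pt z1 w1 + t *s y)" for t
  define T where "T = interior {t. C t}"
  have "T = UNIV"
  proof (rule UNIV_if_open_closed)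
    show "open T" by (simp add: T_def)
    have "open ((\<lambda>t. (z1 + t * a, w1 + t * b)) -` E)"
      by (intro open_vimage E continuous_intros)
    moreover have "(\<lambda>t. (z1 + t * a, w1 + t * b)) -` E \<subseteq> {t. C t}"
      using cross by (auto simp: C_def pt_t[symmetric])
    moreover have "1 \<in> (\<lambda>t. (z1 + t * a, w1 + t * b)) -` E"
      using \<rho>(2) z2(1) w2(1) by (auto simp: a_def b_def)
    ultimately show "T \<noteq> {}" unfolding T_def using interior_maximal by blast
    fix t0 assume t0: "t0 \<in> closure T"
    obtain l where "pt z1 w1 + t0 *s y \<in> lift_dom f l" using lift_dom_exists dom nonz by metis
    then obtain r where r: "r > 0" "\<And>t. t \<in> ball t0 r \<Longrightarrow> pt z1 w1 + t *s y \<in> lift_dom f l"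
      "\<And>j. (\<lambda>t. lift f j l (pt z1 w1 + t *s y)) holomorphic_on ball t0 r" using lift_line_ball by metis
    define \<phi> where "\<phi> i j t = poly2 (P i) (z1 + t * a) (w1 + t * b) * lift f j l (pt z1 w1 + t *s y)
        - poly2 (P j) (z1 + t * a) (w1 + t * b) * lift f i l (pt z1 w1 + t *s y)" for i j t
    have C_iff: "C t \<longleftrightarrow> (\<forall>i j. \<phi> i j t = 0)" if "t \<in> ball t0 r" for t
      unfolding C_def \<phi>_def cross_iff_lift[OF r(2)[OF that]] by simp
    have "\<phi> i j t = 0" if "t \<in> ball t0 r" for i j t
    proof (rule holomorphic_zero_on_ball[OF _ r(1) _ t0 _ that])
      show "\<phi> i j holomorphic_on ball t0 r"
        unfolding \<phi>_def[abs_def] by (intro holomorphic_intros r(3))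
      show "\<phi> i j t = 0" if "t \<in> ball t0 r" "t \<in> T" for t
        using C_iff[OF that(1)] that(2) interior_subset[of "{t. C t}"] by (auto simp: T_def)
    qed (simp add: T_def)
    then have "ball t0 r \<subseteq> {t. C t}" using C_iff by auto
    then show "t0 \<in> T" unfolding T_def using r(1) by (meson centre_in_ball interior_maximal open_ball subsetD)
  qed
  then have "C 0" using interior_subset[of "{t. C t}"] by (auto simp: T_def)
  then show ?thesis by (simp add: C_def)
qed

end

lemma poly2_nonzero_near:
  assumes "D \<noteq> 0" "r > 0"
  obtains E where "open E" "E \<noteq> {}" "E \<subseteq> ball 0 r \<times> ball 0 r" "\<And>z w. (z, w) \<in> E \<Longrightarrow> poly2 D z w \<noteq> 0"
proof -
  define E where "E = (ball 0 r \<times> ball 0 r) \<inter> (\<lambda>p. poly2 D (fst p) (snd p)) -` (- {0})"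
  have inf: "infinite (ball (0 :: complex) r)" using assms(2) uncountable_ball uncountable_infinite by blast
  have "open E" unfolding E_def by (intro continuous_open_preimage continuous_intros) (auto intro: open_Times)
  moreover have "E \<noteq> {}"
  proof
    assume "E = {}"
    then have "(z, w) \<notin> E" for z w by simp
    then have "poly2 D z w = 0" if "z \<in> ball 0 r" "w \<in> ball 0 r" for z w using that by (simp add: E_def)
    then show False using poly2_eq_0_if_zero_on_product[OF inf inf] assms(1) by blast
  qed
  ultimately show ?thesis using that[of E] by (auto simp: E_def)
qed

text \<open>The position in which Hurwitz's theorem can be applied: near the origin the map lies in
  one chart, and every line parallel to an axis through the bidisc, including its point at infinity
  \<open>proj u\<close> or \<open>proj v\<close>, avoids the indeterminacy points.\<close>

locale mero_frame = frame +
  fixes f :: mero_map and k :: 3 and r :: real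
  assumes r: "r > 0"
    and u_dom: "proj u \<in> mdom f" and v_dom: "proj v \<in> mdom f"
    and lines_u: "\<And>(w :: complex) t. w \<in> ball 0 r \<Longrightarrow> proj (pt t w) \<in> mdom f"
    and lines_v: "\<And>(z :: complex) t. z \<in> ball 0 r \<Longrightarrow> proj (pt z t) \<in> mdom f"
    and near: "\<And>(z :: complex) (w :: complex). z \<in> ball 0 r \<Longrightarrow> w \<in> ball 0 r \<Longrightarrow> pt z w \<in> lift_dom f k"
begin

lemma rational_lift_component:
  obtains A B where "B \<noteq> 0"
    "\<And>(z :: complex) (w :: complex). z \<in> ball 0 r \<Longrightarrow> w \<in> ball 0 r \<Longrightarrow> poly2 B z w * lift f j k (pt z w) = poly2 A z w"
proof (rule rational_if_separately_rational[OF r])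
  have g: "hol2 {(z, w). pt z w \<in> lift_dom f k} (\<lambda>z w. lift f j k (pt z w))"
    unfolding pt_def by (rule hol2_lift)
  have 0: "(0 :: complex) \<in> ball 0 r" using r by simp
  fix w :: complex assume w: "w \<in> ball 0 r"
  show "\<exists>p q. q \<noteq> 0 \<and> (\<forall>z\<in>ball 0 r. poly q z * lift f j k (pt z w) = poly p z)"
  proof (rule lift_rational_on_line[OF nonzero(1) u_dom, of "x0 + w *s v" 0 k j])
    have *: "x0 + w *s v + t *s u = pt t w" for t by (simp add: pt_def add_ac)
    show "x0 + w *s v + t *s u \<noteq> 0 \<and> proj (x0 + w *s v + t *s u) \<in> mdom f" for t
      unfolding * using lines_u[OF w] by simp
    show "x0 + w *s v + 0 *s u \<in> lift_dom f k" unfolding * by (rule near[OF 0 w])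
    fix p q assume "q \<noteq> 0" "\<And>t. x0 + w *s v + t *s u \<in> lift_dom f k \<Longrightarrow>
        poly q t * lift f j k (x0 + w *s v + t *s u) = poly p t"
    then show ?thesis unfolding * using near w by blast
  qed
  show "continuous_on (ball 0 r) (\<lambda>z. lift f j k (pt z w))"
    by (rule holomorphic_on_imp_continuous_on[OF hol2_holomorphic_fst[OF g]]) (use near w in auto)
next
  have g: "hol2 {(z, w). pt z w \<in> lift_dom f k} (\<lambda>z w. lift f j k (pt z w))"
    unfolding pt_def by (rule hol2_lift)
  have 0: "(0 :: complex) \<in> ball 0 r" using r by simp
  fix z :: complex assume z: "z \<in> ball 0 r"
  show "\<exists>p q. q \<noteq> 0 \<and> (\<forall>w\<in>ball 0 r. poly q w * lift f j k (pt z w) = poly p w)"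
  proof (rule lift_rational_on_line[OF nonzero(2) v_dom, of "x0 + z *s u" 0 k j])
    have *: "x0 + z *s u + t *s v = pt z t" for t by (simp add: pt_def)
    show "x0 + z *s u + t *s v \<noteq> 0 \<and> proj (x0 + z *s u + t *s v) \<in> mdom f" for t
      unfolding * using lines_v[OF z] by simp
    show "x0 + z *s u + 0 *s v \<in> lift_dom f k" unfolding * by (rule near[OF z 0])
    fix p q assume "q \<noteq> 0" "\<And>t. x0 + z *s u + t *s v \<in> lift_dom f k \<Longrightarrow>
        poly q t * lift f j k (x0 + z *s u + t *s v) = poly p t"
    then show ?thesis unfolding * using near z by blast
  qed
  show "continuous_on (ball 0 r) (\<lambda>w. lift f j k (pt z w))"
    by (rule holomorphic_on_imp_continuous_on[OF hol2_holomorphic_snd[OF g]]) (use near z in auto)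
qed (rule that)

text \<open>The three rational coordinates are brought to a common denominator and divided by their
  greatest common divisor \<open>d\<close>, which leaves finitely many common zeros. Where
  \<open>d\<close> does not vanish near the origin, the result is proportional to the value of
  \<open>f\<close>, and \<open>cross_everywhere\<close> carries this to the whole affine part of the
  domain.\<close>

lemma polynomial_lift:
  obtains P where "finite {(z, w). \<forall>j. poly2 (P j) z w = 0}"
    "\<And>z w. proj (pt z w) \<in> mdom f \<Longrightarrow> cross f (\<lambda>j. poly2 (P j) z w) (pt z w)"
proof -
  have "\<exists>A B. B \<noteq> 0 \<and> (\<forall>z\<in>ball 0 r. \<forall>w\<in>ball 0 r. poly2 B z w * lift f j k (pt z w) = poly2 A z w)" for j
    by (rule rational_lift_component[of j]) blast
  then obtain A B where AB: "\<And>j. B j \<noteq> 0"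
    "\<And>j z w. z \<in> ball 0 r \<Longrightarrow> w \<in> ball 0 r \<Longrightarrow> poly2 (B j) z w * lift f j k (pt z w) = poly2 (A j) z w"
    by metis
  define D where "D = B 1 * B 2 * B 3"
  define N where "N j = A j * (if j = 1 then B 2 * B 3 else if j = 2 then B 1 * B 3 else B 1 * B 2)" for j
  have D0: "D \<noteq> 0" using AB(1) by (simp add: D_def)
  have N: "poly2 (N j) z w = poly2 D z w * lift f j k (pt z w)" if "z \<in> ball 0 r" "w \<in> ball 0 r" for j and z w :: complex
    using exhaust_3[of j] by (auto simp: N_def D_def AB(2)[OF that, symmetric])
  obtain E0 where E0: "open E0" "E0 \<noteq> {}" "E0 \<subseteq> ball 0 r \<times> ball 0 r"
    "\<And>z w. (z, w) \<in> E0 \<Longrightarrow> poly2 D z w \<noteq> 0" using poly2_nonzero_near[OF D0 r] by blast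
  \<comment> \<open>The \<open>k\<close>-th coordinate in the chart \<open>k\<close> is 1, so
    \<open>N k\<close> agrees with \<open>D\<close> on the bidisc.\<close>
  have "N k \<noteq> 0"
  proof
    assume "N k = 0"
    obtain z w where zw: "(z, w) \<in> E0" using E0(2) by auto
    then have b: "z \<in> ball 0 r" "w \<in> ball 0 r" using E0(3) by auto
    have "lift f k k (pt z w) = 1" using near[OF b] by (simp add: lift_def lift_dom_def rat_self)
    then show False using N[OF b, of k] E0(4)[OF zw] \<open>N k = 0\<close> by simp
  qed
  then have "N 1 \<noteq> 0 \<or> N 2 \<noteq> 0 \<or> N 3 \<noteq> 0" using exhaust_3[of k] by auto
  then obtain d p1 p2 p3 where d: "d \<noteq> 0" "N 1 = d * p1" "N 2 = d * p2" "N 3 = d * p3"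
    "finite {(z, w). poly2 p1 z w = 0 \<and> poly2 p2 z w = 0 \<and> poly2 p3 z w = 0}"
    by (rule gcd_decomposition3)
  define P where "P j = (if j = 1 then p1 else if j = 2 then p2 else p3)" for j :: 3
  have NP: "N j = d * P j" for j using exhaust_3[of j] d by (auto simp: P_def)
  obtain E where E: "open E" "E \<noteq> {}" "E \<subseteq> ball 0 r \<times> ball 0 r"
    "\<And>z w. (z, w) \<in> E \<Longrightarrow> poly2 d z w \<noteq> 0" using poly2_nonzero_near[OF d(1) r] by blast
  show ?thesis
  proof (rule that[of P])
    have "(\<forall>j. poly2 (P j) z w = 0) \<longleftrightarrow> poly2 p1 z w = 0 \<and> poly2 p2 z w = 0 \<and> poly2 p3 z w = 0" for z w
      by (simp add: forall_3 P_def)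
    then show "finite {(z, w). \<forall>j. poly2 (P j) z w = 0}" using d(5) by simp
    fix z w assume dom: "proj (pt z w) \<in> mdom f"
    show "cross f (\<lambda>j. poly2 (P j) z w) (pt z w)"
    proof (rule cross_everywhere[OF E(1,2) _ dom])
      fix z w assume zw: "(z, w) \<in> E"
      then have b: "z \<in> ball 0 r" "w \<in> ball 0 r" using E(3) by auto
      have "poly2 d z w * poly2 (P j) z w = poly2 D z w * lift f j k (pt z w)" for j
        using N[OF b, of j] by (simp add: NP)
      then have "poly2 d z w * (poly2 (P a) z w * lift f b k (pt z w)) =
          poly2 d z w * (poly2 (P b) z w * lift f a k (pt z w))" for a b
        by (simp add: mult.assoc[symmetric])
      then have "poly2 (P a) z w * lift f b k (pt z w) = poly2 (P b) z w * lift f a k (pt z w)" for a b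
        using E(4)[OF zw] by simp
      then show "proj (pt z w) \<in> mdom f \<and> cross f (\<lambda>j. poly2 (P j) z w) (pt z w)"
        using cross_iff_lift[OF near[OF b]] near[OF b] by (auto simp: lift_dom_def)
    qed
  qed
qed

end

section \<open>The fixed point set\<close>

definition is_form :: "nat \<Rightarrow> (complex^3 \<Rightarrow> complex) \<Rightarrow> bool" where
  "is_form d F \<longleftrightarrow> (\<exists>a. \<forall>x. F x = form d a x)"

lemma is_form_0 [intro]: "is_form d (\<lambda>x. 0)"
  unfolding is_form_def by (rule exI[of _ "\<lambda>_ _. 0"]) (simp add: form_def)

lemma is_form_add: "is_form d F \<Longrightarrow> is_form d G \<Longrightarrow> is_form d (\<lambda>x. F x + G x)"
proof -
  assume "is_form d F" "is_form d G"
  then obtain a b where "\<forall>x. F x = form d a x" "\<forall>x. G x = form d b x" by (auto simp: is_form_def)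
  then show ?thesis unfolding is_form_def
    by (intro exI[of _ "\<lambda>i j. a i j + b i j"]) (simp add: form_def sum.distrib distrib_right)
qed

lemma is_form_sum: "(\<And>i. i \<in> S \<Longrightarrow> is_form d (F i)) \<Longrightarrow> is_form d (\<lambda>x. \<Sum>i\<in>S. F i x)"
  by (induction S rule: infinite_finite_induct) (auto intro: is_form_add)

lemma is_form_monom:
  assumes "i + j + l = d"
  shows "is_form d (\<lambda>x. c * (x $ 1) ^ i * (x $ 2) ^ j * (x $ 3) ^ l)"
  unfolding is_form_def
proof (intro exI allI)
  fix x :: "complex^3"
  define a where "a = (\<lambda>i' j'. if i' = i then (if j' = j then c else 0) else 0)"
  let ?T = "c * (x $ 1) ^ i * (x $ 2) ^ j * (x $ 3) ^ l"
  have "(\<Sum>j'\<le>d - i'. a i' j' * (x $ 1) ^ i' * (x $ 2) ^ j' * (x $ 3) ^ (d - i' - j')) = (if i' = i then ?T else 0)"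
    for i'
  proof (cases "i' = i")
    case True
    have "(\<Sum>j'\<le>d - i'. a i' j' * (x $ 1) ^ i' * (x $ 2) ^ j' * (x $ 3) ^ (d - i' - j')) =
        (\<Sum>j'\<le>d - i'. if j' = j then ?T else 0)"
      by (rule sum.cong) (use True assms in \<open>auto simp: a_def\<close>)
    also have "\<dots> = ?T" using True assms by (simp add: sum.delta)
    finally show ?thesis using True by simp
  qed (simp add: a_def)
  then have "form d a x = (\<Sum>i'\<le>d. if i' = i then ?T else 0)" by (simp add: form_def)
  also have "\<dots> = ?T" using assms by (simp add: sum.delta)
  finally show "c * (x $ 1) ^ i * (x $ 2) ^ j * (x $ 3) ^ l = form d a x" by simp
qed

lemma is_form_mult_coord:
  assumes "is_form d F"
  shows "is_form (Suc d) (\<lambda>x. c * x $ k * F x)"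
proof -
  obtain a where a: "\<And>x. F x = form d a x" using assms by (auto simp: is_form_def)
  have "is_form (Suc d) (\<lambda>x. \<Sum>i\<le>d. \<Sum>j\<le>d - i.
      c * x $ k * (a i j * (x $ 1) ^ i * (x $ 2) ^ j * (x $ 3) ^ (d - i - j)))"
  proof (intro is_form_sum)
    fix i j assume "i \<in> {..d}" "j \<in> {..d - i}"
    then have e: "Suc i + j + (d - i - j) = Suc d" "i + Suc j + (d - i - j) = Suc d" "i + j + Suc (d - i - j) = Suc d"
      by auto
    show "is_form (Suc d) (\<lambda>x. c * x $ k * (a i j * (x $ 1) ^ i * (x $ 2) ^ j * (x $ 3) ^ (d - i - j)))"
      using is_form_monom[OF e(1), of "c * a i j"] is_form_monom[OF e(2), of "c * a i j"]
        is_form_monom[OF e(3), of "c * a i j"] exhaust_3[of k]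
      by (auto simp: mult_ac)
  qed
  then show ?thesis by (simp add: a form_def sum_distrib_left)
qed

lemma is_form_mult_pairing:
  assumes "is_form d F"
  shows "is_form (d + n) (\<lambda>x. pairing c x ^ n * F x)"
proof (induction n)
  case (Suc n)
  have "is_form (Suc (d + n)) (\<lambda>x. \<Sum>k\<in>UNIV. c $ k * x $ k * (pairing c x ^ n * F x))"
    by (intro is_form_sum is_form_mult_coord Suc)
  then show ?case by (simp add: pairing_def sum_distrib_right mult.assoc)
qed (use assms in simp)

lemma form_scale: "form d a (c *s x) = c ^ d * form d a x"
proof -
  have "(\<Sum>j\<le>d - i. a i j * (c * x $ 1) ^ i * (c * x $ 2) ^ j * (c * x $ 3) ^ (d - i - j)) =
      (\<Sum>j\<le>d - i. c ^ d * (a i j * (x $ 1) ^ i * (x $ 2) ^ j * (x $ 3) ^ (d - i - j)))" if "i \<le> d" for i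
  proof (rule sum.cong[OF refl])
    fix j assume "j \<in> {..d - i}"
    then have "c ^ d = c ^ i * c ^ j * c ^ (d - i - j)" using that by (simp flip: power_add)
    then show "a i j * (c * x $ 1) ^ i * (c * x $ 2) ^ j * (c * x $ 3) ^ (d - i - j) =
        c ^ d * (a i j * (x $ 1) ^ i * (x $ 2) ^ j * (x $ 3) ^ (d - i - j))"
      by (simp add: power_mult_distrib mult_ac)
  qed
  then show ?thesis by (simp add: form_def sum_distrib_left)
qed

lemma continuous_on_form [continuous_intros]:
  "continuous_on S f \<Longrightarrow> continuous_on S (\<lambda>x. form d a (f x))"
  unfolding form_def by (intro continuous_intros)

lemma holomorphic_on_form_line: "(\<lambda>t. form d a (x + t *s y)) holomorphic_on S"
  unfolding form_def vector_add_component vector_smult_component by (intro holomorphic_intros)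

lemma form_line_limit: "((\<lambda>t. form d a (inverse t *s x + y)) \<longlongrightarrow> form d a y) at_infinity"
proof -
  have "continuous_on UNIV (\<lambda>s. form d a (s *s x + y))"
    unfolding vector_scalar_mult_def by (intro continuous_intros)
  then have "isCont (\<lambda>s. form d a (s *s x + y)) 0" by (simp add: continuous_on_eq_continuous_at)
  from isCont_tendsto_compose[OF this tendsto_inverse_0] show ?thesis by simp
qed

lemma form_line_nonzero:
  assumes "form d a y \<noteq> 0"
  obtains t where "form d a (x + t *s y) \<noteq> 0"
proof -
  have "\<forall>\<^sub>F t in at_infinity. form d a (inverse t *s x + y) \<noteq> 0"
    by (rule tendsto_imp_eventually_ne[OF form_line_limit assms])
  moreover have "\<forall>\<^sub>F t :: complex in at_infinity. norm t \<ge> 1"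
    unfolding eventually_at_infinity by blast
  ultimately have "\<forall>\<^sub>F t :: complex in at_infinity. form d a (inverse t *s x + y) \<noteq> 0 \<and> norm t \<ge> 1"
    by (rule eventually_conj)
  then obtain t :: complex where t: "form d a (inverse t *s x + y) \<noteq> 0" "norm t \<ge> 1"
    using eventually_happens'[OF trivial_limit_at_infinity] by blast
  have "t \<noteq> 0" using t(2) by auto
  then have "x + t *s y = t *s (inverse t *s x + y)" by (simp add: vector_add_ldistrib vector_smult_assoc)
  then have "form d a (x + t *s y) = t ^ d * form d a (inverse t *s x + y)" by (simp only: form_scale)
  then have "form d a (x + t *s y) \<noteq> 0" using t(1) \<open>t \<noteq> 0\<close> by simp
  then show ?thesis by (rule that)
qed

text \<open>Along the line the form is a polynomial in \<open>t\<close> with leading term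
  \<open>form d a y * t^d\<close>. It tends to infinity, and by Liouville's theorem it has a
  zero.\<close>

lemma form_has_zero_on_line:
  assumes d: "d \<ge> 1" and y: "form d a y \<noteq> 0"
  obtains t where "form d a (x + t *s y) = 0"
proof (rule Liouville_weak_inverse[OF holomorphic_on_form_line[of d a x y UNIV]])
  fix B :: real
  \<comment> \<open>Half the modulus of the leading coefficient bounds the form from below by
    \<open>m * |t|^d\<close> for large \<open>t\<close>.\<close>
  define m where "m = cmod (form d a y) / 2"
  have m: "m > 0" using y by (simp add: m_def)
  have "\<forall>\<^sub>F t in at_infinity. dist (form d a (inverse t *s x + y)) (form d a y) < m"
    by (rule tendstoD[OF form_line_limit m])
  moreover have "\<forall>\<^sub>F t :: complex in at_infinity. norm t \<ge> max 1 (B / m)"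
    unfolding eventually_at_infinity by blast
  ultimately show "\<forall>\<^sub>F t in at_infinity. B \<le> cmod (form d a (x + t *s y))"
  proof eventually_elim
    case (elim t)
    have "t \<noteq> 0" using elim(2) by auto
    then have "x + t *s y = t *s (inverse t *s x + y)" by (simp add: vector_add_ldistrib vector_smult_assoc)
    then have eq: "form d a (x + t *s y) = t ^ d * form d a (inverse t *s x + y)" by (simp only: form_scale)
    have "cmod (form d a y) \<le> cmod (form d a (inverse t *s x + y)) + dist (form d a (inverse t *s x + y)) (form d a y)"
      using norm_triangle_ineq2[of "form d a y" "form d a (inverse t *s x + y)"]
      by (simp add: dist_norm norm_minus_commute)
    then have ge: "m \<le> cmod (form d a (inverse t *s x + y))" using elim(1) by (simp add: m_def)
    have "B \<le> norm t * m" using elim(2) m by (simp add: field_simps)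
    also have "\<dots> \<le> norm t ^ d * cmod (form d a (inverse t *s x + y))"
      using ge m elim(2) d power_increasing[of 1 d "norm t"] by (intro mult_mono) auto
    finally show ?case by (simp add: eq norm_mult norm_power)
  qed
qed (use that in blast)

text \<open>On the line through \<open>x\<close> in the direction \<open>v\<close> the zero
  \<open>x\<close> is isolated. By Hurwitz's argument it persists on the parallel lines, which shows
  that the curve through \<open>x\<close> has a point near \<open>x\<close> for every small shift
  \<open>s\<close> along \<open>e\<close>.\<close>

lemma form_zeros_nearby:
  assumes x: "form d a x = 0" and v: "form d a v \<noteq> 0" and W: "open W" "x \<in> W"
  obtains \<rho> where "\<rho> > 0"
    "\<And>s. s \<in> ball 0 \<rho> \<Longrightarrow> \<exists>t. x + s *s e + t *s v \<in> W \<and> form d a (x + s *s e + t *s v) = 0"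
proof -
  let ?y = "\<lambda>s t. x + s *s e + t *s v"
  have cy: "continuous_on S (\<lambda>(s, t). ?y s t)" for S by (rule continuous_on_affine_plane)
  have "open ((\<lambda>(s, t). ?y s t) -` W)" by (rule open_vimage[OF W(1) cy])
  moreover have "(0, 0) \<in> (\<lambda>(s, t). ?y s t) -` W" using W by simp
  ultimately obtain \<tau>' where \<tau>': "\<tau>' > 0" "cball 0 \<tau>' \<times> cball 0 \<tau>' \<subseteq> (\<lambda>(s, t). ?y s t) -` W"
    by (rule open_prod_cball)
  obtain t0 where t0: "form d a (x + t0 *s v) \<noteq> 0" using form_line_nonzero[OF v] .
  obtain r where r: "r > 0" "\<And>t. t \<in> ball 0 r - {0} \<Longrightarrow> form d a (x + t *s v) \<noteq> 0"
    using isolated_zeros[OF holomorphic_on_form_line[of d a x v UNIV] open_UNIV connected_UNIV UNIV_I _ UNIV_I t0, of 0] x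
    by auto
  define \<tau> where "\<tau> = min \<tau>' (r / 2)"
  have \<tau>: "\<tau> > 0" "\<tau> \<le> \<tau>'" "\<tau> < r" using \<tau>' r by (auto simp: \<tau>_def)
  define g where "g = (\<lambda>(s, t). form d a (?y s t))"
  have cg: "continuous_on S g" for S unfolding g_def case_prod_unfold
    by (rule continuous_on_form) (use cy[of S] in \<open>simp add: case_prod_unfold\<close>)
  \<comment> \<open>The inequality between centre and circle that forces a zero. It holds at
    \<open>s = 0\<close>, where the centre value is 0, and is an open condition.\<close>
  define V where "V = {p. cmod (g (fst p, 0)) < cmod (g p)}"
  have "open V" unfolding V_def
    by (intro open_Collect_less continuous_intros continuous_on_compose2[OF cg[of UNIV]] cg) auto
  moreover have "{0} \<times> sphere 0 \<tau> \<subseteq> V"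
    using r(2) \<tau> x by (auto simp: V_def g_def)
  ultimately obtain \<rho> where \<rho>: "\<rho> > 0" "ball 0 \<rho> \<times> sphere 0 \<tau> \<subseteq> V"
    using open_tube_sphere by (metis compact_sphere)
  show ?thesis
  proof (rule that[of "min \<rho> \<tau>"])
    fix s :: complex assume s: "s \<in> ball 0 (min \<rho> \<tau>)"
    have h: "(\<lambda>t. form d a (?y s t)) holomorphic_on S" for S by (rule holomorphic_on_form_line)
    have "cmod (form d a (?y s 0)) < cmod (form d a (?y s t))" if "cmod (0 - t) = \<tau>" for t
    proof -
      have "(s, t) \<in> V" by (rule subsetD[OF \<rho>(2)]) (use s that in auto)
      then show ?thesis by (simp add: V_def g_def)
    qed
    then obtain t where t: "t \<in> ball 0 \<tau>" "form d a (?y s t) = 0"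
      using holomorphic_contract_to_zero[of 0 \<tau> "\<lambda>t. form d a (?y s t)", OF holomorphic_on_imp_continuous_on[OF h] h \<tau>(1)]
      by blast
    have "(s, t) \<in> (\<lambda>(s, t). ?y s t) -` W" by (rule subsetD[OF \<tau>'(2)]) (use s t \<tau> in auto)
    then show "\<exists>t. ?y s t \<in> W \<and> form d a (?y s t) = 0" using t(2) by auto
  qed (use \<rho> \<tau> in auto)
qed

lemma open_not_fixed: "open {q \<in> mdom f. app f q \<noteq> q}"
proof -
  have "continuous_on (mdom f) (\<lambda>q. dist (app f q) q)"
    by (intro continuous_intros continuous_on_app)
  then have "open (mdom f \<inter> (\<lambda>q. dist (app f q) q) -` (- {0}))"
    by (intro continuous_open_preimage open_mdom) auto
  also have "mdom f \<inter> (\<lambda>q. dist (app f q) q) -` (- {0}) = {q \<in> mdom f. app f q \<noteq> q}" by auto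
  finally show ?thesis .
qed

lemma cross_nonzero_imp_app_eq:
  assumes c: "cross f P x" and P: "P a \<noteq> 0"
  shows "app f (proj x) = proj (\<chi> j. P j)"
proof -
  define y where "y = rep_cp2 (app f (proj x))"
  have y: "P i * y $ j = P j * y $ i" for i j using c by (simp add: cross_def y_def)
  have ya: "y $ a \<noteq> 0"
  proof
    assume "y $ a = 0"
    then have "y = 0" using y[of a] P by (simp add: vec_eq_iff)
    then show False by (simp add: y_def)
  qed
  have "(\<chi> j. P j) = (P a / y $ a) *s y"
  proof (subst vec_eq_iff, intro allI)
    fix j
    show "(\<chi> j. P j) $ j = ((P a / y $ a) *s y) $ j" using y[of a j] ya by (simp add: field_simps)
  qed
  then have "proj (\<chi> j. P j) = proj y" using P ya by (simp add: proj_scale y_def)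
  then show ?thesis by (simp add: y_def)
qed

lemma proj_eq_iff_minors:
  fixes x y :: "complex^3"
  assumes x: "x \<noteq> 0" and y: "y $ a \<noteq> 0"
  shows "proj y = proj x \<longleftrightarrow> (\<forall>i j. x $ i * y $ j = x $ j * y $ i)"
proof
  assume "proj y = proj x"
  then obtain c where "x = c *s y" using x nth_nonzero[OF y] by (auto simp: proj_eq_iff)
  then show "\<forall>i j. x $ i * y $ j = x $ j * y $ i" by simp
next
  assume m: "\<forall>i j. x $ i * y $ j = x $ j * y $ i"
  have "x = (x $ a / y $ a) *s y"
  proof (subst vec_eq_iff, intro allI)
    fix i show "x $ i = ((x $ a / y $ a) *s y) $ i" using m[rule_format, of i a] y by (simp add: field_simps)
  qed
  then show "proj y = proj x" using x nth_nonzero[OF y] by (subst proj_eq_iff) auto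
qed

section \<open>Fixed points as common zeros of minors\<close>

context frame begin

definition coord :: "3 \<Rightarrow> complex poly poly" where
  "coord j = [:[:x0 $ j, u $ j:], [:v $ j:]:]"

lemma poly2_coord [simp]: "poly2 (coord j) z w = pt z w $ j"
  by (simp add: coord_def poly2_def pt_def algebra_simps)

definition minor :: "(3 \<Rightarrow> complex poly poly) \<Rightarrow> 3 \<Rightarrow> 3 \<Rightarrow> complex poly poly" where
  "minor P i j = coord i * P j - coord j * P i"

lemma fixed_iff_minors:
  assumes c: "cross f (\<lambda>j. poly2 (P j) z w) (pt z w)" and nz: "\<exists>j. poly2 (P j) z w \<noteq> 0"
  shows "app f (proj (pt z w)) = proj (pt z w) \<longleftrightarrow> (\<forall>i j. poly2 (minor P i j) z w = 0)"
proof -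
  obtain a where a: "poly2 (P a) z w \<noteq> 0" using nz by blast
  show ?thesis
    unfolding cross_nonzero_imp_app_eq[OF c a]
    by (subst proj_eq_iff_minors[where a = a]) (use a in \<open>auto simp: minor_def\<close>)
qed

text \<open>\<open>d\<close> is the total degree of \<open>G\<close>, positive since
  \<open>G\<close> is not constant. The part of degree \<open>d\<close> survives on the line at
  infinity and is not zero there, which provides the point \<open>\<eta> *s u + v\<close> off the
  curve.\<close>

lemma homogenize:
  fixes G :: "complex poly poly"
  assumes G: "G \<noteq> 0" "\<And>c. G \<noteq> [:[:c:]:]"
  obtains d a \<eta> where "d \<ge> 1" "form d a (\<eta> *s u + v) \<noteq> 0"
    "\<And>x. pairing \<gamma> x \<noteq> 0 \<Longrightarrow>
       form d a x = pairing \<gamma> x ^ d * poly2 G (pairing \<alpha> x / pairing \<gamma> x) (pairing \<beta> x / pairing \<gamma> x)"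
proof -
  define c where "c i j = coeff (coeff G j) i" for i j
  define S where "S = {(i, j). c i j \<noteq> 0}"
  define n where "n = (\<Sum>j\<le>degree G. degree (coeff G j))"
  have n: "degree (coeff G j) \<le> n" for j
  proof (cases "j \<le> degree G")
    case True
    then show ?thesis unfolding n_def by (intro member_le_sum) auto
  qed (simp add: coeff_eq_0)
  have Ssub: "S \<subseteq> {..n} \<times> {..degree G}"
  proof
    fix p assume "p \<in> S"
    then obtain i j where p: "p = (i, j)" "c i j \<noteq> 0" by (auto simp: S_def)
    then have "i \<le> degree (coeff G j)" by (auto simp: c_def intro: le_degree)
    moreover have "j \<le> degree G" using p(2) by (metis c_def coeff_0 le_degree)
    ultimately show "p \<in> {..n} \<times> {..degree G}" using n[of j] by (auto simp: p(1))
  qed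
  then have finS: "finite S" by (rule finite_subset) simp
  obtain j0 i0 where ij0: "c i0 j0 \<noteq> 0"
    using G(1) unfolding c_def poly_eq_iff by (metis coeff_0)
  then have neS: "S \<noteq> {}" by (auto simp: S_def)
  define d where "d = Max ((\<lambda>(i, j). i + j) ` S)"
  have d: "i + j \<le> d" if "(i, j) \<in> S" for i j
    unfolding d_def using finS that by (intro Max_ge) (auto intro!: image_eqI[of _ _ "(i, j)"])
  have "d \<in> (\<lambda>(i, j). i + j) ` S" unfolding d_def using finS neS by (intro Max_in) auto
  then obtain i1 j1 where ij1: "(i1, j1) \<in> S" "i1 + j1 = d" by auto
  have "d \<ge> 1"
  proof (rule ccontr)
    assume "\<not> ?thesis"
    then have z: "c i j = 0" if "i + j \<noteq> 0" for i j using d[of i j] that by (auto simp: S_def)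
    have "G = [:[:c 0 0:]:]"
    proof (intro poly_eqI)
      fix j i show "coeff (coeff G j) i = coeff (coeff [:[:c 0 0:]:] j) i"
        using z[of i j] by (cases j; cases i) (auto simp: c_def)
    qed
    then show False using G(2) by blast
  qed
  have eval: "poly2 G z w = (\<Sum>(i, j)\<in>S. c i j * z ^ i * w ^ j)" for z w
  proof -
    have p: "poly (coeff G j) z = (\<Sum>i\<le>n. c i j * z ^ i)" for j
      unfolding poly_altdef c_def using n[of j]
      by (intro sum.mono_neutral_left) (auto simp: coeff_eq_0)
    have "poly2 G z w = (\<Sum>i\<le>n. \<Sum>j\<le>degree G. c i j * z ^ i * w ^ j)"
      unfolding poly2_expand p sum_distrib_right by (rule sum.swap)
    also have "\<dots> = (\<Sum>(i, j)\<in>{..n} \<times> {..degree G}. c i j * z ^ i * w ^ j)"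
      by (rule sum.cartesian_product)
    also have "\<dots> = (\<Sum>(i, j)\<in>S. c i j * z ^ i * w ^ j)"
      by (intro sum.mono_neutral_right Ssub) (auto simp: S_def)
    finally show ?thesis .
  qed
  define F where "F x = (\<Sum>p\<in>S. pairing \<alpha> x ^ fst p *
      (pairing \<beta> x ^ snd p * (pairing \<gamma> x ^ (d - fst p - snd p) * c (fst p) (snd p))))" for x
  have "is_form d F"
    unfolding F_def[abs_def]
  proof (intro is_form_sum)
    fix p assume "p \<in> S"
    then have e: "0 + (d - fst p - snd p) + snd p + fst p = d" using d[of "fst p" "snd p"] by simp
    have "is_form 0 (\<lambda>x. c (fst p) (snd p))" using is_form_monom[of 0 0 0 0 "c (fst p) (snd p)"] by simp
    then show "is_form d (\<lambda>x. pairing \<alpha> x ^ fst p *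
      (pairing \<beta> x ^ snd p * (pairing \<gamma> x ^ (d - fst p - snd p) * c (fst p) (snd p))))"
      by (subst e[symmetric], intro is_form_mult_pairing)
  qed
  then obtain a where a: "\<And>x. F x = form d a x" by (auto simp: is_form_def)
  have dehom: "F x = pairing \<gamma> x ^ d * poly2 G (pairing \<alpha> x / pairing \<gamma> x) (pairing \<beta> x / pairing \<gamma> x)"
    if g: "pairing \<gamma> x \<noteq> 0" for x
    unfolding eval F_def sum_distrib_left case_prod_unfold
  proof (rule sum.cong[OF refl])
    fix p assume "p \<in> S"
    then have "pairing \<gamma> x ^ d = pairing \<gamma> x ^ (d - fst p - snd p) * pairing \<gamma> x ^ fst p * pairing \<gamma> x ^ snd p"
      using d[of "fst p" "snd p"] by (simp flip: power_add)
    then show "pairing \<alpha> x ^ fst p * (pairing \<beta> x ^ snd p * (pairing \<gamma> x ^ (d - fst p - snd p) * c (fst p) (snd p))) =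
      pairing \<gamma> x ^ d * (c (fst p) (snd p) * (pairing \<alpha> x / pairing \<gamma> x) ^ fst p * (pairing \<beta> x / pairing \<gamma> x) ^ snd p)"
      using g by (simp add: power_divide field_simps)
  qed
  \<comment> \<open>The part of total degree \<open>d\<close>, with \<open>w\<close> set to 1.
    Monomials of this part with different exponents of \<open>z\<close> stay distinct, so
    \<open>q\<close> is not zero.\<close>
  define q where "q = (\<Sum>p\<in>{p \<in> S. fst p + snd p = d}. monom (c (fst p) (snd p)) (fst p))"
  have Fuv: "F (\<eta> *s u + v) = poly q \<eta>" for \<eta>
  proof -
    have "F (\<eta> *s u + v) = (\<Sum>p\<in>S. \<eta> ^ fst p * (0 ^ (d - fst p - snd p) * c (fst p) (snd p)))"
      by (simp add: F_def dual)
    also have "\<dots> = (\<Sum>p\<in>{p \<in> S. fst p + snd p = d}. \<eta> ^ fst p * (0 ^ (d - fst p - snd p) * c (fst p) (snd p)))"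
    proof (rule sum.mono_neutral_right[OF finS])
      show "\<forall>p\<in>S - {p \<in> S. fst p + snd p = d}. \<eta> ^ fst p * (0 ^ (d - fst p - snd p) * c (fst p) (snd p)) = 0"
      proof
        fix p assume p: "p \<in> S - {p \<in> S. fst p + snd p = d}"
        then have "d - fst p - snd p > 0" using d[of "fst p" "snd p"] by auto
        then show "\<eta> ^ fst p * (0 ^ (d - fst p - snd p) * c (fst p) (snd p)) = 0" by simp
      qed
    qed auto
    also have "\<dots> = poly q \<eta>"
      unfolding q_def poly_sum by (rule sum.cong) (auto simp: poly_monom)
    finally show ?thesis .
  qed
  have "coeff q i1 = c i1 j1"
  proof -
    have "coeff q i1 = (\<Sum>p\<in>{p \<in> S. fst p + snd p = d}. if p = (i1, j1) then c i1 j1 else 0)"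
      unfolding q_def coeff_sum using ij1 by (intro sum.cong) auto
    also have "\<dots> = c i1 j1" using ij1 finS by simp
    finally show ?thesis .
  qed
  then have "q \<noteq> 0" using ij1(1) by (auto simp: S_def)
  then obtain \<eta> where "poly q \<eta> \<noteq> 0" using poly_all_0_iff_0 by blast
  then show ?thesis using that[of d a \<eta>] \<open>d \<ge> 1\<close> dehom Fuv a by simp
qed

text \<open>The curve is the closure given by the homogenized factor. Were it to contain a point of
  the domain that is not fixed, possibly at infinity, then infinitely many affine points of the
  curve near it would not be fixed either. All minors vanish at these, so they would all be common
  zeros of \<open>P\<close>, which are finite in number.\<close>

lemma DFix_if_minors_have_common_factor:
  assumes fin: "finite {(z, w). \<forall>j. poly2 (P j) z w = 0}"
    and cross: "\<And>z w. proj (pt z w) \<in> mdom f \<Longrightarrow> cross f (\<lambda>j. poly2 (P j) z w) (pt z w)"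
    and G: "G \<noteq> 0" "\<And>c. G \<noteq> [:[:c:]:]" and dvd: "\<And>i j. G dvd minor P i j"
  shows "f \<in> DFix"
proof -
  obtain d a \<eta> where form: "d \<ge> 1" "form d a (\<eta> *s u + v) \<noteq> 0"
    "\<And>x. pairing \<gamma> x \<noteq> 0 \<Longrightarrow>
       form d a x = pairing \<gamma> x ^ d * poly2 G (pairing \<alpha> x / pairing \<gamma> x) (pairing \<beta> x / pairing \<gamma> x)"
    using homogenize[OF G] by metis
  define v' where "v' = \<eta> *s u + v"
  have v': "form d a v' \<noteq> 0" "pairing \<gamma> v' = 0" "pairing \<beta> v' = 1" using form by (simp_all add: v'_def dual)
  define C where "C = proj ` {x. x \<noteq> 0 \<and> form d a x = 0}"
  have "\<exists>i j. i + j \<le> d \<and> a i j \<noteq> 0"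
  proof (rule ccontr)
    assume no: "\<not> ?thesis"
    have "a i j = 0" if "i \<le> d" "j \<le> d - i" for i j
    proof -
      have "i + j \<le> d" using that by simp
      then show ?thesis using no by blast
    qed
    then have "form d a v' = 0" by (simp add: form_def)
    then show False using v' by simp
  qed
  then have "complex_curve C" using form(1) unfolding complex_curve_def C_def by blast
  moreover have "fixed_point f p" if p: "p \<in> C \<inter> mdom f" for p
  proof (rule ccontr)
    assume nf: "\<not> fixed_point f p"
    obtain x where x: "x \<noteq> 0" "form d a x = 0" "p = proj x" using p by (auto simp: C_def)
    define W where "W = {y. y \<noteq> 0 \<and> proj y \<in> {q \<in> mdom f. app f q \<noteq> q}}"
    have oW: "open W" unfolding W_def by (rule open_proj_vimage[OF open_not_fixed])
    have xW: "x \<in> W" using nf p x by (auto simp: W_def fixed_point_iff)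
    \<comment> \<open>A direction independent of \<open>x\<close> modulo \<open>v'\<close>. If
      \<open>x\<close> is at infinity, it also leads away from there, since \<open>\<gamma>\<close>
      then takes the value \<open>s\<close> at the shifted point.\<close>
    define e where "e = (if pairing \<gamma> x = 0 then x0 else u)"
    have indep: "b1 = 0 \<and> b2 = 0" if z: "b1 *s x + b2 *s e + b3 *s v' = 0" for b1 b2 b3
    proof (cases "pairing \<gamma> x = 0")
      case True
      have "pairing \<gamma> (b1 *s x + b2 *s e + b3 *s v') = 0" unfolding z by simp
      then have b2: "b2 = 0" using True v'(2) by (simp add: e_def dual)
      have "b1 = 0"
      proof (rule ccontr)
        assume b1: "b1 \<noteq> 0"
        have "b1 *s x = (- b3) *s v'" using z b2 by (simp add: add_eq_0_iff2)
        then have "form d a (b1 *s x) = form d a ((- b3) *s v')" by simp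
        then have "(- b3) ^ d * form d a v' = 0" unfolding form_scale by (simp add: x(2))
        then have "b3 = 0" using v'(1) form(1) by auto
        then show False using \<open>b1 *s x = (- b3) *s v'\<close> b1 x(1) by simp
      qed
      with b2 show ?thesis by simp
    next
      case False
      have "pairing \<gamma> (b1 *s x + b2 *s e + b3 *s v') = 0" unfolding z by simp
      then have b1: "b1 = 0" using False v'(2) by (simp add: e_def dual)
      have "pairing \<beta> (b1 *s x + b2 *s e + b3 *s v') = 0" unfolding z by simp
      then have b3: "b3 = 0" using False v'(3) b1 by (simp add: e_def dual)
      have "pairing \<alpha> (b1 *s x + b2 *s e + b3 *s v') = 0" unfolding z by simp
      then show ?thesis using False b1 b3 by (simp add: e_def dual)
    qed
    obtain \<rho> where \<rho>: "\<rho> > 0"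
      "\<And>s. s \<in> ball 0 \<rho> \<Longrightarrow> \<exists>t. x + s *s e + t *s v' \<in> W \<and> form d a (x + s *s e + t *s v') = 0"
      using form_zeros_nearby[OF x(2) v'(1) oW xW, of e] by blast
    then obtain t where t: "\<And>s. s \<in> ball 0 \<rho> \<Longrightarrow> x + s *s e + t s *s v' \<in> W"
      "\<And>s. s \<in> ball 0 \<rho> \<Longrightarrow> form d a (x + s *s e + t s *s v') = 0" by metis
    define y where "y s = x + s *s e + t s *s v'" for s
    define z where "z s = (pairing \<alpha> (y s) / pairing \<gamma> (y s), pairing \<beta> (y s) / pairing \<gamma> (y s))" for s
    define X where "X = ball 0 \<rho> - {s. pairing \<gamma> (y s) = 0}"
    have "finite {s. pairing \<gamma> (y s) = 0}"
    proof (cases "pairing \<gamma> x = 0")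
      case True
      then have "{s. pairing \<gamma> (y s) = 0} = {0}" using v'(2) by (auto simp: y_def e_def dual)
      then show ?thesis by simp
    next
      case False
      then have "{s. pairing \<gamma> (y s) = 0} = {}" using v'(2) by (auto simp: y_def e_def dual)
      then show ?thesis by simp
    qed
    then have infX: "infinite X"
      unfolding X_def using uncountable_infinite[OF uncountable_ball[OF \<rho>(1)]] by (rule Diff_infinite_finite)
    have projy: "proj (y s) = proj (pt (fst (z s)) (snd (z s)))" if "s \<in> X" for s
      using that proj_eq_pt[of "y s"] by (simp add: X_def z_def)
    have yW: "y s \<in> W" "form d a (y s) = 0" "y s \<noteq> 0" if "s \<in> X" for s
      using that t[of s] by (auto simp: X_def y_def W_def)
    have inj: "inj_on z X"
    proof (rule inj_onI)
      fix s s' assume s: "s \<in> X" "s' \<in> X" "z s = z s'"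
      then have "proj (y s) = proj (y s')" using projy by simp
      then obtain b where b: "y s' = b *s y s" using yW(3) s by (auto simp: proj_eq_iff)
      \<comment> \<open>Proportional vectors for \<open>s\<close> and \<open>s'\<close> give a
        linear relation; independence modulo \<open>v'\<close> forces \<open>b = 1\<close> and
        \<open>b * s = s'\<close>, whatever the values of \<open>t\<close>.\<close>
      have "(b - 1) *s x + (b * s - s') *s e + (b * t s - t s') *s v' = b *s y s - y s'"
        by (simp add: y_def vec_eq_iff algebra_simps)
      then have "(b - 1) *s x + (b * s - s') *s e + (b * t s - t s') *s v' = 0" using b by simp
      from indep[OF this] show "s = s'" by auto
    qed
    have "z ` X \<subseteq> {(z, w). \<forall>j. poly2 (P j) z w = 0}"
    proof
      fix q assume "q \<in> z ` X"
      then obtain s where s: "s \<in> X" "q = z s" by blast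
      obtain z1 w1 where q: "q = (z1, w1)" by (cases q)
      have pr: "proj (y s) = proj (pt z1 w1)" unfolding projy[OF s(1)] s(2)[symmetric] q by simp
      have "pairing \<gamma> (y s) ^ d * poly2 G z1 w1 = 0"
        using form(3)[of "y s"] yW(2)[OF s(1)] s q by (auto simp: X_def z_def)
      then have "poly2 G z1 w1 = 0" using s(1) by (simp add: X_def)
      then have m0: "poly2 (minor P i j) z1 w1 = 0" for i j using dvd[of i j] by (auto elim!: dvdE)
      have dom: "proj (pt z1 w1) \<in> mdom f" "app f (proj (pt z1 w1)) \<noteq> proj (pt z1 w1)"
        using yW(1)[OF s(1)] pr by (auto simp: W_def)
      then have "\<forall>j. poly2 (P j) z1 w1 = 0" using fixed_iff_minors[OF cross[OF dom(1)]] m0 by blast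
      then show "q \<in> {(z, w). \<forall>j. poly2 (P j) z w = 0}" by (simp add: q)
    qed
    then have "finite (z ` X)" using fin by (rule finite_subset)
    then show False using finite_imageD[OF _ inj] infX by blast
  qed
  ultimately show ?thesis unfolding DFix_def by blast
qed

text \<open>Off the common zeros of \<open>P\<close>, fixed points are common zeros of the minors.
  As \<open>f\<close> has no curve of fixed points, the greatest common divisor of the minors is a
  constant, and the remaining common zeros are finite in number.\<close>

lemma fixed_points_alternative_aux:
  assumes fin: "finite {(z, w). \<forall>j. poly2 (P j) z w = 0}"
    and cross: "\<And>z w. proj (pt z w) \<in> mdom f \<Longrightarrow> cross f (\<lambda>j. poly2 (P j) z w) (pt z w)"
    and nD: "f \<notin> DFix"
  shows "finite {(z, w). fixed_point f (proj (pt z w))}"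
proof -
  note DF = DFix_if_minors_have_common_factor[OF fin cross]
  have dvd_all: "G dvd minor P i j" if "G dvd minor P 1 2" "G dvd minor P 1 3" "G dvd minor P 2 3" for G i j
  proof -
    have minors: "minor P l l = 0" "minor P 2 1 = - minor P 1 2" "minor P 3 1 = - minor P 1 3"
      "minor P 3 2 = - minor P 2 3" for l by (simp_all add: minor_def)
    show ?thesis using exhaust_3[of i] exhaust_3[of j] by (elim disjE) (simp_all add: that minors)
  qed
  have "minor P 1 2 \<noteq> 0 \<or> minor P 1 3 \<noteq> 0 \<or> minor P 2 3 \<noteq> 0"
  proof (rule ccontr)
    assume no: "\<not> ?thesis"
    have "f \<in> DFix"
    \<comment> \<open>If all minors vanish, every polynomial divides them; \<open>[:0, 1:]\<close>
      is the polynomial \<open>w\<close>, a convenient nonconstant one.\<close>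
    proof (rule DF[of "[:0, 1:]"])
      show "[:0, 1:] dvd minor P i j" for i j by (rule dvd_all) (use no in auto)
    qed auto
    then show False using nD by blast
  qed
  then obtain g q1 q2 q3 where g: "g \<noteq> 0" "minor P 1 2 = g * q1" "minor P 1 3 = g * q2" "minor P 2 3 = g * q3"
    "finite {(z, w). poly2 q1 z w = 0 \<and> poly2 q2 z w = 0 \<and> poly2 q3 z w = 0}"
    by (rule gcd_decomposition3)
  have "\<exists>c. g = [:[:c:]:]"
  proof (rule ccontr)
    assume nc: "\<not> ?thesis"
    have "f \<in> DFix"
    proof (rule DF[OF _ g(1)])
      show "g dvd minor P i j" for i j by (rule dvd_all) (simp_all add: g)
    qed (use nc in auto)
    then show False using nD by blast
  qed
  then obtain c where c: "g = [:[:c:]:]" "c \<noteq> 0" using g(1) by auto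
  have "{(z, w). fixed_point f (proj (pt z w))} \<subseteq> {(z, w). \<forall>j. poly2 (P j) z w = 0} \<union>
      {(z, w). poly2 q1 z w = 0 \<and> poly2 q2 z w = 0 \<and> poly2 q3 z w = 0}"
  proof (rule subsetI, rule ccontr)
    fix p assume "p \<in> {(z, w). fixed_point f (proj (pt z w))}"
      and "p \<notin> {(z, w). \<forall>j. poly2 (P j) z w = 0} \<union>
        {(z, w). poly2 q1 z w = 0 \<and> poly2 q2 z w = 0 \<and> poly2 q3 z w = 0}"
    then obtain z w where fp: "fixed_point f (proj (pt z w))" and np: "\<exists>j. poly2 (P j) z w \<noteq> 0"
      and n: "(z, w) \<notin> {(z, w). poly2 q1 z w = 0 \<and> poly2 q2 z w = 0 \<and> poly2 q3 z w = 0}"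
      by (cases p) auto
    have dom: "proj (pt z w) \<in> mdom f" "app f (proj (pt z w)) = proj (pt z w)" using fp by (auto simp: fixed_point_iff)
    have "\<not> (\<forall>i j. poly2 (minor P i j) z w = 0)"
    proof
      assume "\<forall>i j. poly2 (minor P i j) z w = 0"
      then have "poly2 g z w * poly2 q1 z w = 0" "poly2 g z w * poly2 q2 z w = 0" "poly2 g z w * poly2 q3 z w = 0"
        using g by (metis poly2_simps(5))+
      moreover have "poly2 g z w \<noteq> 0" by (simp add: c)
      ultimately show False using n by simp
    qed
    then show False using fixed_iff_minors[OF cross[OF dom(1)] np] dom(2) by blast
  qed
  then show ?thesis using fin g(5) by (meson finite_UnI finite_subset)
qed

end

lemma (in mero_frame) fixed_points_finite_centred:
  assumes "f \<notin> DFix"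
  shows "finite {(z, w). fixed_point f (proj (pt z w))}"
proof -
  obtain P where "finite {(z, w). \<forall>j. poly2 (P j) z w = 0}"
    "\<And>z w. proj (pt z w) \<in> mdom f \<Longrightarrow> cross f (\<lambda>j. poly2 (P j) z w) (pt z w)"
    using polynomial_lift by blast
  then show ?thesis using fixed_points_alternative_aux assms by blast
qed

lemma (in frame) finite_fixed_points:
  assumes uv: "proj u \<in> mdom f" "proj v \<in> mdom f" and nD: "f \<notin> DFix"
  shows "finite {(z, w). fixed_point f (proj (pt z w))}"
proof -
  define Bad where "Bad = {p. proj (pt (fst p) (snd p)) \<notin> mdom f}"
  have fin: "finite (fst ` Bad)" "finite (snd ` Bad)" unfolding Bad_def using finite_bad_points by auto
  have inf: "infinite (UNIV :: complex set)" by (rule infinite_UNIV_char_0)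
  \<comment> \<open>With both coordinates different from those of the bad points, all lines parallel
    to the axes near \<open>(z0, w0)\<close> avoid them. The frame is moved to this point to satisfy
    \<open>mero_frame\<close>.\<close>
  obtain z0 w0 where z0: "z0 \<notin> fst ` Bad" and w0: "w0 \<notin> snd ` Bad" using fin inf ex_new_if_finite by metis
  interpret s: frame "pt z0 w0" u v "\<alpha> - z0 *s \<gamma>" "\<beta> - w0 *s \<gamma>" \<gamma> by (rule frame_shift)
  have spt: "s.pt z w = pt (z0 + z) (w0 + w)" for z w
    unfolding s.pt_def unfolding pt_def by (simp add: vec_eq_iff algebra_simps)
  obtain r1 where r1: "r1 > 0" "ball z0 r1 \<subseteq> - fst ` Bad"
    using z0 fin(1) open_contains_ball[of "- fst ` Bad"] finite_imp_closed by (metis ComplI open_Compl)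
  obtain r2 where r2: "r2 > 0" "ball w0 r2 \<subseteq> - snd ` Bad"
    using w0 fin(2) open_contains_ball[of "- snd ` Bad"] finite_imp_closed by (metis ComplI open_Compl)
  have dom: "proj (pt z w) \<in> mdom f" if "z \<notin> fst ` Bad \<or> w \<notin> snd ` Bad" for z w
  proof (rule ccontr)
    assume "proj (pt z w) \<notin> mdom f"
    then have "(z, w) \<in> Bad" by (simp add: Bad_def)
    from imageI[OF this, of fst] imageI[OF this, of snd] that show False by simp
  qed
  obtain k where k: "pt z0 w0 \<in> lift_dom f k" using lift_dom_exists[OF pt_nonzero dom] z0 by blast
  have "open ((\<lambda>(z, w). s.pt z w) -` lift_dom f k)"
    unfolding s.pt_def by (rule open_vimage[OF open_lift_dom continuous_on_affine_plane])
  moreover have "(0, 0) \<in> (\<lambda>(z, w). s.pt z w) -` lift_dom f k" using k by (simp add: spt)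
  ultimately obtain r3 where r3: "r3 > 0" "cball 0 r3 \<times> cball 0 r3 \<subseteq> (\<lambda>(z, w). s.pt z w) -` lift_dom f k"
    by (rule open_prod_cball)
  define r where "r = Min {r1, r2, r3}"
  have r: "r > 0" "r \<le> r1" "r \<le> r2" "r \<le> r3" using r1 r2 r3 by (auto simp: r_def)
  interpret m: mero_frame "pt z0 w0" u v "\<alpha> - z0 *s \<gamma>" "\<beta> - w0 *s \<gamma>" \<gamma> f k r
  proof
    show "proj (s.pt t w) \<in> mdom f" if "w \<in> ball 0 r" for w t
    proof -
      have "w0 + w \<in> ball w0 r2" using that r by (simp add: dist_norm)
      then show ?thesis unfolding spt using r2(2) by (intro dom) blast
    qed
    show "proj (s.pt z t) \<in> mdom f" if "z \<in> ball 0 r" for z t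
    proof -
      have "z0 + z \<in> ball z0 r1" using that r by (simp add: dist_norm)
      then show ?thesis unfolding spt using r1(2) by (intro dom) blast
    qed
    show "s.pt z w \<in> lift_dom f k" if "z \<in> ball 0 r" "w \<in> ball 0 r" for z w
    proof -
      have "(z, w) \<in> (\<lambda>(z, w). s.pt z w) -` lift_dom f k" by (rule subsetD[OF r3(2)]) (use that r in auto)
      then show ?thesis by simp
    qed
  qed (use uv r in auto)
  have "finite ((\<lambda>(z, w). (z0 + z, w0 + w)) ` {(z, w). fixed_point f (proj (s.pt z w))})"
    using m.fixed_points_finite_centred[OF nD] by (rule finite_imageI)
  moreover have "{(z, w). fixed_point f (proj (pt z w))} \<subseteq>
      (\<lambda>(z, w). (z0 + z, w0 + w)) ` {(z, w). fixed_point f (proj (s.pt z w))}"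
  proof safe
    fix z w assume "fixed_point f (proj (pt z w))"
    then show "(z, w) \<in> (\<lambda>(z, w). (z0 + z, w0 + w)) ` {(z, w). fixed_point f (proj (s.pt z w))}"
      by (intro image_eqI[of _ _ "(z - z0, w - w0)"]) (auto simp: spt)
  qed
  ultimately show ?thesis by (rule finite_subset[rotated])
qed

section \<open>Stability of fixed points and of their absence on a line\<close>

text \<open>A Lebesgue number for the cover of \<open>L\<close> by neighbourhoods of small
  oscillation. The point \<open>q'\<close> may lie outside \<open>L\<close>, as values of a nearby
  map do.\<close>

lemma rat_uniformly_near:
  assumes L: "compact L" "L \<subseteq> {q. nz k q}" and \<delta>: "\<delta> > 0"
  obtains \<epsilon> where "\<epsilon> > 0"
    "\<And>q q' j. q \<in> L \<Longrightarrow> dist q' q < \<epsilon> \<Longrightarrow> nz k q' \<and> cmod (rat j k q' - rat j k q) < \<delta>"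
proof -
  define N where "N q0 = {q. nz k q \<and> (\<forall>j. dist (rat j k q) (rat j k q0) < \<delta> / 2)}" for q0
  have oN: "open (N q0)" for q0
  proof -
    have "open (rat j k -` ball (rat j k q0) (\<delta> / 2) \<inter> {q. nz k q})" for j
      using continuous_on_open_vimage[OF open_nz] continuous_on_rat open_ball by blast
    then have "open (\<Inter>j\<in>UNIV. rat j k -` ball (rat j k q0) (\<delta> / 2) \<inter> {q. nz k q})" by (intro open_INT) auto
    also have "(\<Inter>j\<in>UNIV. rat j k -` ball (rat j k q0) (\<delta> / 2) \<inter> {q. nz k q}) = N q0"
      by (auto simp: N_def dist_commute)
    finally show ?thesis .
  qed
  have "L \<subseteq> \<Union> (N ` L)" using L(2) \<delta> by (auto simp: N_def)
  then obtain \<epsilon> where \<epsilon>: "\<epsilon> > 0" "\<And>q. q \<in> L \<Longrightarrow> \<exists>G\<in>N ` L. ball q \<epsilon> \<subseteq> G"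
    using Heine_Borel_lemma[OF L(1), of "N ` L"] oN by blast
  show ?thesis
  proof (rule that[OF \<epsilon>(1)])
    fix q q' j assume q: "q \<in> L" "dist q' q < \<epsilon>"
    obtain q0 where q0: "ball q \<epsilon> \<subseteq> N q0" using \<epsilon>(2)[OF q(1)] by blast
    have "q \<in> N q0" "q' \<in> N q0" using q0 q(2) \<epsilon>(1) by (auto simp: dist_commute subset_iff)
    then have "nz k q'" "dist (rat j k q) (rat j k q0) < \<delta> / 2" "dist (rat j k q') (rat j k q0) < \<delta> / 2"
      by (auto simp: N_def)
    then show "nz k q' \<and> cmod (rat j k q' - rat j k q) < \<delta>"
      using dist_triangle2[of "rat j k q'" "rat j k q" "rat j k q0"] by (simp add: dist_norm)
  qed
qed

context frame begin

lemma continuous_on_pt: "continuous_on S (\<lambda>(z, w). pt z w)"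
  unfolding pt_def by (rule continuous_on_affine_plane)

lemma hol2_fixed_equation:
  assumes B: "open B" and sub: "\<And>z w. (z, w) \<in> B \<Longrightarrow> pt z w \<in> lift_dom f k \<and> pt z w $ k \<noteq> 0"
  shows "hol2 B (\<lambda>z w. lift f j k (pt z w) - pt z w $ j / pt z w $ k)"
proof -
  have "hol2 B (\<lambda>z w. lift f j k (pt z w))"
    unfolding pt_def by (rule hol2_subset[OF hol2_lift B]) (use sub in \<open>auto simp: pt_def\<close>)
  moreover have "hol2 B (\<lambda>z w. pt z w $ i)" for i
    unfolding hol2_def pt_def vector_add_component vector_smult_component case_prod_unfold
    by (auto intro!: B continuous_intros derivative_intros)
  ultimately show ?thesis using sub by (intro hol2_diff hol2_divide) auto
qed

lemma fixed_iff_equation: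
  assumes "pt z w \<in> lift_dom f k" "pt z w $ k \<noteq> 0"
  shows "fixed_point f (proj (pt z w)) \<longleftrightarrow> (\<forall>l. lift f (other k l) k (pt z w) - pt z w $ other k l / pt z w $ k = 0)"
proof -
  have n: "nz k (app f (proj (pt z w)))" "nz k (proj (pt z w))" "proj (pt z w) \<in> mdom f"
    using assms by (auto simp: lift_dom_def nz_proj)
  show ?thesis
  proof
    assume "fixed_point f (proj (pt z w))"
    then have "app f (proj (pt z w)) = proj (pt z w)" by (simp add: fixed_point_iff)
    then show "\<forall>l. lift f (other k l) k (pt z w) - pt z w $ other k l / pt z w $ k = 0"
      by (simp add: lift_def rat_proj)
  next
    assume e: "\<forall>l. lift f (other k l) k (pt z w) - pt z w $ other k l / pt z w $ k = 0"
    have "app f (proj (pt z w)) = proj (pt z w)"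
      by (rule eq_if_rat_eq[OF n(1,2)]) (use e in \<open>auto elim!: other_exists simp: lift_def rat_proj\<close>)
    then show "fixed_point f (proj (pt z w))" using n(3) by (simp add: fixed_point_iff)
  qed
qed

text \<open>In a chart containing the fixed point, being fixed amounts to two scalar equations with
  an isolated common zero. Uniform closeness on a bidisc makes the equations of a nearby map close
  to them, and \<open>isolated_common_zero_stable\<close> applies.\<close>

lemma isolated_fixed_point_stable:
  assumes fin: "finite {(z, w). fixed_point f (proj (pt z w))}" and fp: "fixed_point f (proj x0)"
  obtains e where "e > 0" "\<And>g. dist g f < e \<Longrightarrow> g \<notin> FFix"
proof -
  have p0: "pt 0 0 = x0" by (simp add: pt_def)
  obtain k where k: "nz k (proj (pt 0 0))" by (rule nz_exists)
  have fp': "proj (pt 0 0) \<in> mdom f" "app f (proj (pt 0 0)) = proj (pt 0 0)"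
    using fp by (simp_all add: p0 fixed_point_iff)
  \<comment> \<open>Here both the point and its image lie in the chart \<open>k\<close>, and the
    finitely many other fixed points are taken out.\<close>
  define U where "U = (\<lambda>(z, w). pt z w) -` (lift_dom f k \<inter> {x. x $ k \<noteq> 0})
     - ({(z, w). fixed_point f (proj (pt z w))} - {(0, 0)})"
  have "open (lift_dom f k \<inter> {x. x $ k \<noteq> 0})"
    by (intro open_Int open_lift_dom open_Collect_neq continuous_intros)
  then have "open U" unfolding U_def
    using fin by (intro open_Diff open_vimage continuous_on_pt finite_imp_closed finite_Diff)
  moreover have "(0, 0) \<in> U" using k fp' by (simp add: U_def lift_dom_def nz_proj)
  ultimately obtain R where R: "R > 0" "cball 0 R \<times> cball 0 R \<subseteq> U" by (rule open_prod_cball)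
  have U: "pt z w \<in> lift_dom f k" "pt z w $ k \<noteq> 0" "fixed_point f (proj (pt z w)) \<Longrightarrow> z = 0 \<and> w = 0"
    if "z \<in> cball 0 R" "w \<in> cball 0 R" for z w
    using that subsetD[OF R(2), of "(z, w)"] by (auto simp: U_def)
  define F where "F g l z w = lift g (other k l) k (pt z w) - pt z w $ other k l / pt z w $ k" for g l z w
  have oB: "open (ball 0 R \<times> ball 0 R :: (complex \<times> complex) set)" by (simp add: open_Times)
  have holF: "hol2 (ball 0 R \<times> ball 0 R) (F g l)"
    if "\<And>z w. z \<in> cball 0 R \<Longrightarrow> w \<in> cball 0 R \<Longrightarrow> pt z w \<in> lift_dom g k" for g l
    unfolding F_def[abs_def] by (rule hol2_fixed_equation[OF oB]) (use U(2) that in auto)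
  have fixF: "fixed_point g (proj (pt z w)) \<longleftrightarrow> F g 1 z w = 0 \<and> F g 2 z w = 0"
    if "z \<in> cball 0 R" "w \<in> cball 0 R" "pt z w \<in> lift_dom g k" for g z w
    using fixed_iff_equation[OF that(3) U(2)[OF that(1,2)]] by (simp add: F_def forall_2)
  have zero: "F f 1 0 0 = 0" "F f 2 0 0 = 0" using fixF[of 0 0 f] U(1)[of 0 0] R fp p0 by auto
  obtain \<delta> t where \<delta>: "\<delta> > 0" "0 < t" "t < R"
    "\<And>H H2. hol2 (ball 0 R \<times> ball 0 R) H \<Longrightarrow> hol2 (ball 0 R \<times> ball 0 R) H2 \<Longrightarrow>
      (\<And>z w. z \<in> cball 0 t \<Longrightarrow> w \<in> cball 0 t \<Longrightarrow> cmod (H z w - F f 1 z w) < \<delta>) \<Longrightarrow>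
      (\<And>z w. z \<in> cball 0 t \<Longrightarrow> w \<in> cball 0 t \<Longrightarrow> cmod (H2 z w - F f 2 z w) < \<delta>) \<Longrightarrow>
      \<exists>z w. z \<in> cball 0 t \<and> w \<in> cball 0 t \<and> H z w = 0 \<and> H2 z w = 0"
  proof (rule isolated_common_zero_stable[OF holF[OF U(1)] holF[OF U(1)] zero R(1)], assumption+)
    fix z w :: complex assume "z \<in> ball 0 R" "w \<in> ball 0 R" "F f 1 z w = 0" "F f 2 z w = 0"
    then show "z = 0 \<and> w = 0" using fixF[of z w f] U[of z w] by auto
  qed blast
  define K where "K = proj ` ((\<lambda>(z, w). pt z w) ` (cball 0 R \<times> cball 0 R))"
  have "continuous_on ((\<lambda>(z, w). pt z w) ` (cball 0 R \<times> cball 0 R)) proj"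
    by (rule continuous_on_subset[OF continuous_on_proj]) auto
  then have cK: "compact K"
    unfolding K_def by (intro compact_continuous_image continuous_on_pt compact_Times compact_cball)
  have inK: "proj (pt z w) \<in> K" if "z \<in> cball 0 R" "w \<in> cball 0 R" for z w
    using that unfolding K_def by force
  have "q \<in> mdom f \<and> nz k (app f q)" if q: "q \<in> K" for q
  proof -
    obtain z w where zw: "z \<in> cball 0 R" "w \<in> cball 0 R" "q = proj (pt z w)" using q by (auto simp: K_def)
    show ?thesis using U(1)[OF zw(1,2)] unfolding zw(3) lift_dom_def by blast
  qed
  then have Kf: "K \<subseteq> mdom f" "app f ` K \<subseteq> {q. nz k q}" by blast+
  have "compact (app f ` K)"
    by (rule compact_continuous_image[OF continuous_on_subset[OF continuous_on_app Kf(1)] cK])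
  then obtain \<epsilon> where \<epsilon>: "\<epsilon> > 0" "\<And>q q' j. q \<in> app f ` K \<Longrightarrow> dist q' q < \<epsilon> \<Longrightarrow>
      nz k q' \<and> cmod (rat j k q' - rat j k q) < \<delta>" using rat_uniformly_near[OF _ Kf(2) \<delta>(1)] by metis
  obtain e where e: "e > 0" "\<And>g. dist g f < e \<Longrightarrow> K \<subseteq> mdom g \<and> (\<forall>q\<in>K. dist (app g q) (app f q) < \<epsilon>)"
    using uniformly_near_on_compact[OF cK Kf(1) \<epsilon>(1)] by blast
  show ?thesis
  proof (rule that[OF e(1)])
    fix g assume "dist g f < e"
    then have g: "K \<subseteq> mdom g" "\<And>q. q \<in> K \<Longrightarrow> dist (app g q) (app f q) < \<epsilon>" using e(2) by auto
    have near: "pt z w \<in> lift_dom g k" "cmod (lift g j k (pt z w) - lift f j k (pt z w)) < \<delta>"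
      if "z \<in> cball 0 R" "w \<in> cball 0 R" for z w j
      using \<epsilon>(2)[OF imageI[OF inK[OF that]] g(2)[OF inK[OF that]]] g(1) inK[OF that]
      by (auto simp: lift_dom_def lift_def)
    have "\<exists>z w. z \<in> cball 0 t \<and> w \<in> cball 0 t \<and> F g 1 z w = 0 \<and> F g 2 z w = 0"
      by (rule \<delta>(4)[OF holF[OF near(1)] holF[OF near(1)]]) (use near(2) \<delta>(3) in \<open>auto simp: F_def\<close>)
    then obtain z w where "z \<in> cball 0 R" "w \<in> cball 0 R" "F g 1 z w = 0" "F g 2 z w = 0" using \<delta>(3) by force
    then have "fixed_point g (proj (pt z w))" using fixF near(1) by blast
    then show "g \<notin> FFix" by (auto simp: FFix_def)
  qed
qed

text \<open>The line at infinity is itself a complex curve, with equation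
  \<open>pairing \<gamma> x = 0\<close>. So outside \<open>DFix\<close> it contains a point of the
  domain that is not fixed.\<close>

lemma not_fixed_at_infinity:
  assumes "f \<notin> DFix"
  obtains y where "y \<noteq> 0" "pairing \<gamma> y = 0" "proj y \<in> mdom f" "\<not> fixed_point f (proj y)"
proof -
  have "is_form 0 (\<lambda>x. 1)" using is_form_monom[of 0 0 0 0 1] by simp
  then have "is_form (0 + 1) (\<lambda>x. pairing \<gamma> x ^ 1 * 1)" by (rule is_form_mult_pairing)
  then obtain a where a: "\<And>x. pairing \<gamma> x = form 1 a x" by (auto simp: is_form_def)
  have "\<exists>i j. i + j \<le> 1 \<and> a i j \<noteq> 0"
  proof (rule ccontr)
    assume no: "\<not> ?thesis"
    have "a i j = 0" if "i \<le> 1" "j \<le> 1 - i" for i j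
    proof -
      have "i + j \<le> 1" using that by simp
      then show ?thesis using no by blast
    qed
    then have "form 1 a x0 = 0" unfolding form_def by (intro sum.neutral ballI) auto
    then show False using a[of x0] dual by simp
  qed
  then have "complex_curve (proj ` {x. x \<noteq> 0 \<and> form 1 a x = 0})" unfolding complex_curve_def by blast
  then obtain p where "p \<in> proj ` {x. x \<noteq> 0 \<and> form 1 a x = 0} \<inter> mdom f" "\<not> fixed_point f p"
    using assms unfolding DFix_def by blast
  then obtain x where "x \<noteq> 0" "form 1 a x = 0" "proj x \<in> mdom f" "\<not> fixed_point f (proj x)" by blast
  then show ?thesis using that[of x] a[of x] by simp
qed

text \<open>The lines through \<open>proj y\<close> other than the line at infinity are parallel in
  the affine plane. They are infinitely many, and finitely many points spoil only finitely many of
  them.\<close>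

lemma line_without_fixed_points:
  assumes fin: "finite {(z, w). fixed_point f (proj (pt z w))}" and nD: "f \<notin> DFix"
  obtains x y where "pairing \<gamma> x = 1" "y \<noteq> 0" "pairing \<gamma> y = 0"
    "proj y \<in> mdom f" "\<not> fixed_point f (proj y)"
    "\<And>t. proj (x + t *s y) \<in> mdom f \<and> \<not> fixed_point f (proj (x + t *s y))"
proof -
  obtain y where y: "y \<noteq> 0" "pairing \<gamma> y = 0" "proj y \<in> mdom f" "\<not> fixed_point f (proj y)"
    using not_fixed_at_infinity[OF nD] by blast
  define B where "B = {p. proj (pt (fst p) (snd p)) \<notin> mdom f} \<union> {(z, w). fixed_point f (proj (pt z w))}"
  have finB: "finite B" unfolding B_def using finite_bad_points fin by blast
  have B: "proj (pt z w) \<in> mdom f \<and> \<not> fixed_point f (proj (pt z w))" if "(z, w) \<notin> B" for z w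
    using that by (auto simp: B_def)
  define a b where "a = pairing \<alpha> y" and "b = pairing \<beta> y"
  have yab: "y = a *s u + b *s v" using expand[of y] y(2) by (simp add: a_def b_def)
  show ?thesis
  proof (cases "b = 0")
    case False
    have "infinite (UNIV :: complex set)" by (rule infinite_UNIV_char_0)
    \<comment> \<open>The image of a bad point is where the line through it in the direction
      \<open>(a, b)\<close> meets the axis \<open>w = 0\<close>.\<close>
    then obtain s where s: "s \<notin> (\<lambda>(z, w). z - w / b * a) ` B" using ex_new_if_finite finite_imageI[OF finB] by metis
    have "(s + t * a, 0 + t * b) \<notin> B" for t
    proof
      assume "(s + t * a, 0 + t * b) \<in> B"
      from imageI[OF this, of "\<lambda>(z, w). z - w / b * a"] s show False using False by simp
    qed
    then have "proj (pt s 0 + t *s y) \<in> mdom f \<and> \<not> fixed_point f (proj (pt s 0 + t *s y))" for t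
      using B unfolding yab pt_line[symmetric] by blast
    then show ?thesis using that[of "pt s 0" y] y by simp
  next
    case True
    then have a0: "a \<noteq> 0" using y(1) yab by auto
    have "infinite (UNIV :: complex set)" by (rule infinite_UNIV_char_0)
    then obtain s where s: "s \<notin> snd ` B" using ex_new_if_finite finite_imageI[OF finB] by metis
    have "(0 + t * a, s + t * b) \<notin> B" for t
    proof
      assume "(0 + t * a, s + t * b) \<in> B"
      from imageI[OF this, of snd] s show False using True by simp
    qed
    then have "proj (pt 0 s + t *s y) \<in> mdom f \<and> \<not> fixed_point f (proj (pt 0 s + t *s y))" for t
      using B unfolding yab pt_line[symmetric] by blast
    then show ?thesis using that[of "pt 0 s" y] y by simp
  qed
qed

text \<open>Every curve meets the line, and nearby maps have no fixed point on it.\<close>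

lemma not_DFix_stable:
  assumes fin: "finite {(z, w). fixed_point f (proj (pt z w))}" and nD: "f \<notin> DFix"
  obtains e where "e > 0" "\<And>g. dist g f < e \<Longrightarrow> g \<notin> DFix"
proof -
  obtain x y where xy: "pairing \<gamma> x = 1" "y \<noteq> 0" "pairing \<gamma> y = 0"
    "proj y \<in> mdom f" "\<not> fixed_point f (proj y)"
    "\<And>t. proj (x + t *s y) \<in> mdom f \<and> \<not> fixed_point f (proj (x + t *s y))"
    using line_without_fixed_points[OF fin nD] by metis
  define m where "m = (\<lambda>(a, b). a *s x + b *s y)"
  \<comment> \<open>The whole projective line through \<open>proj x\<close> and
    \<open>proj y\<close>, written as an image of the unit sphere to exhibit its
    compactness.\<close>
  define K where "K = proj ` (m ` sphere 0 1)"
  have m0: "m p \<noteq> 0" if "p \<noteq> 0" for p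
  proof
    assume z: "m p = 0"
    have "pairing \<gamma> (m p) = 0" unfolding z by simp
    then have "fst p = 0" using xy by (simp add: m_def case_prod_unfold)
    with z xy(2) have "snd p = 0" by (simp add: m_def case_prod_unfold)
    with \<open>fst p = 0\<close> that show False by (simp add: prod_eq_iff)
  qed
  have line: "x + t *s y \<noteq> 0" for t
  proof
    assume z: "x + t *s y = 0"
    have "pairing \<gamma> (x + t *s y) = 0" unfolding z by simp
    then show False using xy by simp
  qed
  have "continuous_on S m" for S
    unfolding m_def case_prod_unfold vector_scalar_mult_def by (intro continuous_intros)
  moreover have "continuous_on (m ` sphere 0 1) proj"
  proof (rule continuous_on_subset[OF continuous_on_proj], safe)
    fix p assume "p \<in> sphere (0 :: complex \<times> complex) 1" "m p = 0"
    moreover have "p \<noteq> 0" using \<open>p \<in> sphere 0 1\<close> by auto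
    ultimately show False using m0 by blast
  qed
  ultimately have cK: "compact K" unfolding K_def by (intro compact_continuous_image compact_sphere)
  have yK: "proj y \<in> K"
  proof -
    have "m (0, 1) = y" "(0, 1) \<in> sphere (0 :: complex \<times> complex) 1" by (simp_all add: m_def norm_Pair)
    then show ?thesis unfolding K_def by (metis image_eqI)
  qed
  have lineK: "proj (x + t *s y) \<in> K" for t
  proof -
    define c where "c = inverse (norm (1 :: complex, t))"
    have n: "norm (1 :: complex, t) > 0" by (simp add: prod_eq_iff)
    then have c: "c \<noteq> 0" by (simp add: c_def)
    have "norm (c *\<^sub>R (1 :: complex, t)) = 1" using n by (simp only: norm_scaleR) (simp add: c_def)
    then have "c *\<^sub>R (1 :: complex, t) \<in> sphere 0 1" by simp
    moreover have "m (c *\<^sub>R (1, t)) = of_real c *s (x + t *s y)"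
      by (simp add: m_def vec_eq_iff scaleR_conv_of_real algebra_simps)
    moreover have "proj (of_real c *s (x + t *s y)) = proj (x + t *s y)" using c by (intro proj_scale line) simp
    ultimately show ?thesis unfolding K_def by (metis image_eqI)
  qed
  have K: "q \<in> mdom f \<and> app f q \<noteq> q" if q: "q \<in> K" for q
  proof -
    obtain a b where ab: "(a, b) \<in> sphere (0 :: complex \<times> complex) 1" "q = proj (a *s x + b *s y)"
      using q by (auto simp: K_def m_def)
    show ?thesis
    proof (cases "a = 0")
      case True
      then have "b \<noteq> 0" using ab(1) by (auto simp: norm_Pair)
      then have "q = proj y" using ab(2) True xy(2) by (simp add: proj_scale)
      then show ?thesis using xy(4,5) by (simp add: fixed_point_iff)
    next
      case False
      then have "a *s x + b *s y = a *s (x + (b / a) *s y)" by (simp add: vector_add_ldistrib vector_smult_assoc)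
      then have "q = proj (x + (b / a) *s y)" unfolding ab(2) by (simp only: proj_scale[OF line False])
      then show ?thesis using xy(6)[of "b / a"] by (simp add: fixed_point_iff)
    qed
  qed
  then have Kf: "K \<subseteq> mdom f" by blast
  have "continuous_on K (\<lambda>q. dist (app f q) q)"
    by (intro continuous_intros continuous_on_subset[OF continuous_on_app Kf])
  then obtain q0 where q0: "q0 \<in> K" "\<And>q. q \<in> K \<Longrightarrow> dist (app f q0) q0 \<le> dist (app f q) q"
    using continuous_attains_inf[OF cK] yK by blast
  have pos: "dist (app f q0) q0 > 0" using K[OF q0(1)] by simp
  \<comment> \<open>The tolerance is the least displacement of a point of \<open>K\<close> under
    \<open>f\<close>; a map closer than that to \<open>f\<close> moves every point of
    \<open>K\<close>.\<close>
  obtain e where e: "e > 0" "\<And>g. dist g f < e \<Longrightarrow> K \<subseteq> mdom g \<and> (\<forall>q\<in>K. dist (app g q) (app f q) < dist (app f q0) q0)"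
    using uniformly_near_on_compact[OF cK Kf pos] by blast
  show ?thesis
  proof (rule that[OF e(1)])
    fix g assume "dist g f < e"
    then have g: "K \<subseteq> mdom g" "\<And>q. q \<in> K \<Longrightarrow> dist (app g q) (app f q) < dist (app f q0) q0" using e(2) by auto
    have nofix: "\<not> fixed_point g q" if "q \<in> K" for q
      using g(2)[OF that] q0(2)[OF that] by (auto simp: fixed_point_iff dist_commute)
    show "g \<notin> DFix"
    proof
      assume "g \<in> DFix"
      then obtain C where C: "complex_curve C" "\<And>p. p \<in> C \<Longrightarrow> p \<in> mdom g \<Longrightarrow> fixed_point g p"
        by (auto simp: DFix_def)
      then obtain d a where C': "d \<ge> 1" "C = proj ` {x. x \<noteq> 0 \<and> form d a x = 0}" by (auto simp: complex_curve_def)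
      \<comment> \<open>The curve passes through \<open>proj y\<close> or its equation has a zero on
        the affine part of the line.\<close>
      have "\<exists>q. q \<in> C \<inter> K"
      proof (cases "form d a y = 0")
        case True
        then show ?thesis using C'(2) xy(2) yK by blast
      next
        case False
        then obtain t where "form d a (x + t *s y) = 0" using form_has_zero_on_line[OF C'(1)] by metis
        then show ?thesis using C'(2) line lineK by blast
      qed
      then show False using C(2) g(1) nofix by blast
    qed
  qed
qed

end

theorem theorem1p2:
  shows "closed (FFix \<union> DFix)"
  unfolding closed_def open_dist
proof
  fix f assume "f \<in> - (FFix \<union> DFix)"
  then obtain p where fp: "fixed_point f p" and nD: "f \<notin> DFix" by (auto simp: FFix_def)
  define y where "y = rep_cp2 p"
  have y: "y \<noteq> 0" "proj y = p" by (simp_all add: y_def)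
  \<comment> \<open>The origin of the frame is placed at the fixed point, so that this point is
    affine and is covered by the finiteness statement.\<close>
  obtain u v \<alpha> \<beta> \<gamma> where frame: "frame y u v \<alpha> \<beta> \<gamma>" and uv: "proj u \<notin> - mdom f" "proj v \<notin> - mdom f"
    using frame_exists[OF y(1) finite_indeterminacy] by metis
  interpret frame y u v \<alpha> \<beta> \<gamma> by (rule frame)
  have fin: "finite {(z, w). fixed_point f (proj (pt z w))}" using finite_fixed_points uv nD by blast
  obtain e1 where e1: "e1 > 0" "\<And>g. dist g f < e1 \<Longrightarrow> g \<notin> FFix"
    using isolated_fixed_point_stable[OF fin] fp y(2) by metis
  obtain e2 where e2: "e2 > 0" "\<And>g. dist g f < e2 \<Longrightarrow> g \<notin> DFix"
    using not_DFix_stable[OF fin nD] by metis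
  show "\<exists>e>0. \<forall>g. dist g f < e \<longrightarrow> g \<in> - (FFix \<union> DFix)"
    using e1 e2 by (intro exI[of _ "min e1 e2"]) auto
qed

end
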